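(* For every $n\in\mathbb{N}$ let $X_n$ be a random vector in $\mathbb{R}^n$ with $\mathbb{E}(X_n)=0$ and $\mathbb{E}(X_n\otimes X_n)=I_n$, and let $(m_n)_{n\in\mathbb{N}}$ be a sequence in $\mathbb{N}$ with $$0<\liminf_{n\to\infty}\frac{n}{m_n}\le\limsup_{n\to\infty}\frac{n}{m_n}<\infty .$$ For every $n$ let $X_n^{(1)},\ldots,X_n^{(m_n)}$ be i.i.d. copies of $X_n$ and let $A_n:=\sum_{k=1}^{m_n}X_n^{(k)}\otimes X_n^{(k)}$. Assume that there exist functions $f:\mathbb{N}\to[0,1]$ and $g:\mathbb{N}\to\mathbb{R}_+$ with $f(r)\to0$ and $g(r)\to0$ as $r\to\infty$ such that for every $n\in\mathbb{N}$, every orthogonal projection $P:\mathbb{R}^n\to\mathbb{R}^n$ with $P\ne0$, and every real $t\ge f(\operatorname{rank}P)\operatorname{rank}P$, $$\mathbb{P}\bigl(\|PX_n\|^2-\operatorname{rank}P\ge t\bigr)\le\frac{g(\operatorname{rank}P)\operatorname{rank}P}{t^2}.$$ Then $$\limsup_{n\to\infty}\frac{\mathbb{E}(\lambda_{\max}(A_n))}{(\sqrt{m_n}+\sqrt{n})^2}\le1.$$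
   Context: $\mathbb{N}=\{1,2,\ldots\}$, $\mathbb{R}_+=[0,\infty)$. $\|\cdot\|$ is the Euclidean norm, $x\otimes x=xx^\top$, $I_n$ is the $n\times n$ identity matrix, and $\lambda_{\max}$ denotes the largest eigenvalue of a symmetric matrix. When $t=0$ is allowed, the right-hand side $g(\operatorname{rank}P)\operatorname{rank}P/t^2$ at $t=0$ is to be read as imposing no condition. *)

theory Defs
  imports "HOL-Probability.Probability" "Jordan_Normal_Form.Char_Poly" "Jordan_Normal_Form.DL_Rank"
begin

text \<open>
  The dimension varies inside the statement, so a point of $R^n$ is an element of
  \<^term>\<open>carrier_vec n\<close> (coordinates indexed by $0, \ldots, n - 1$) and an $n \times n$ matrix is an
  element of \<^term>\<open>carrier_mat n n\<close>.  HOL-Analysis overloads several names and infix symbols of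
  \<^theory>\<open>Jordan_Normal_Form.Matrix\<close>; the latter are referred to by qualified names.
\<close>

text \<open>
  The Borel sigma-algebra of $R^n$, i.e. the product sigma-algebra of $n$ copies of the Borel
  sigma-algebra of the reals, transported to \<^term>\<open>carrier_vec n\<close>.
\<close>
definition borel_vec :: "nat \<Rightarrow> real Matrix.vec measure" where
  "borel_vec n =
     vimage_algebra (carrier_vec n) (\<lambda>v. \<lambda>i\<in>{..<n}. vec_index v i) (\<Pi>\<^sub>M i\<in>{..<n}. borel)"

definition euclid_norm :: "real Matrix.vec \<Rightarrow> real" where
  "euclid_norm v = sqrt (scalar_prod v v)"

definition tensor_sq :: "real Matrix.vec \<Rightarrow> real Matrix.mat" where
  "tensor_sq v = Matrix.mat (dim_vec v) (dim_vec v) (\<lambda>(i, j). vec_index v i * vec_index v j)"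

definition orthogonal_projection :: "nat \<Rightarrow> real Matrix.mat \<Rightarrow> bool" where
  "orthogonal_projection n P \<longleftrightarrow> P \<in> carrier_mat n n \<and> P * P = P \<and> transpose_mat P = P"

abbreviation mat_rank :: "nat \<Rightarrow> real Matrix.mat \<Rightarrow> nat" where
  "mat_rank n P \<equiv> vec_space.rank n P"

text \<open>Meaningful for symmetric real matrices of positive dimension.\<close>
definition lambda_max :: "real Matrix.mat \<Rightarrow> real" where
  "lambda_max A = Max {e. eigenvalue A e}"

text \<open>
  Both predicates below use \<^const>\<open>has_bochner_integral\<close>, which includes integrability of each entry.
\<close>
definition has_mean :: "'a measure \<Rightarrow> nat \<Rightarrow> ('a \<Rightarrow> real Matrix.vec) \<Rightarrow> real Matrix.vec \<Rightarrow> bool" where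
  "has_mean M n X \<mu> \<longleftrightarrow>
     (\<forall>i<n. has_bochner_integral M (\<lambda>\<omega>. vec_index (X \<omega>) i) (vec_index \<mu> i))"

definition has_mean_mat :: "'a measure \<Rightarrow> nat \<Rightarrow> ('a \<Rightarrow> real Matrix.mat) \<Rightarrow> real Matrix.mat \<Rightarrow> bool" where
  "has_mean_mat M n Z C \<longleftrightarrow>
     (\<forall>i<n. \<forall>j<n. has_bochner_integral M (\<lambda>\<omega>. Z \<omega> $$ (i, j)) (C $$ (i, j)))"

text \<open>
  $Y_1, \ldots, Y_m$, on a probability space \<open>N\<close> of their own, are independent and each has
  the law of the random vector $X$ on \<open>M\<close>.
\<close>
definition iid_copies ::
  "'b measure \<Rightarrow> nat \<Rightarrow> (nat \<Rightarrow> 'b \<Rightarrow> real Matrix.vec) \<Rightarrow> nat \<Rightarrow> 'a measure \<Rightarrow> ('a \<Rightarrow> real Matrix.vec) \<Rightarrow> bool"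
  where
  "iid_copies N m Y n M X \<longleftrightarrow>
     prob_space.indep_vars N (\<lambda>_. borel_vec n) Y {1..m} \<and>
     (\<forall>k\<in>{1..m}. distr N (borel_vec n) (Y k) = distr M (borel_vec n) X)"

text \<open>The sum of the matrices \<^term>\<open>tensor_sq (Y k)\<close> for $1 \le k \le m$, written entrywise.\<close>
definition cov_sum :: "nat \<Rightarrow> nat \<Rightarrow> (nat \<Rightarrow> real Matrix.vec) \<Rightarrow> real Matrix.mat" where
  "cov_sum n m Y = Matrix.mat n n (\<lambda>(i, j). \<Sum>k=1..m. tensor_sq (Y k) $$ (i, j))"

lemma measurable_borel_vec_iff:
  "X \<in> measurable M (borel_vec n) \<longleftrightarrow>
     (\<forall>\<omega>\<in>space M. X \<omega> \<in> carrier_vec n) \<and>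
     (\<forall>i<n. (\<lambda>\<omega>. vec_index (X \<omega>) i) \<in> borel_measurable M)"
proof -
  let ?r = "\<lambda>v. \<lambda>i\<in>{..<n}. vec_index v i"
  let ?P = "Pi\<^sub>M {..<n} (\<lambda>_. borel) :: (nat \<Rightarrow> real) measure"
  have r: "?r \<in> carrier_vec n \<rightarrow> space ?P"
    by (auto simp: space_PiM)
  have 1: "X \<in> measurable M (borel_vec n) \<longleftrightarrow>
      (\<forall>\<omega>\<in>space M. X \<omega> \<in> carrier_vec n) \<and> (\<lambda>\<omega>. ?r (X \<omega>)) \<in> measurable M ?P"
  proof
    assume X: "X \<in> measurable M (borel_vec n)"
    have "?r \<in> measurable (borel_vec n) ?P"
      unfolding borel_vec_def by (rule measurable_vimage_algebra1[OF r])
    from measurable_compose[OF X this] measurable_space[OF X]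
    show "(\<forall>\<omega>\<in>space M. X \<omega> \<in> carrier_vec n) \<and> (\<lambda>\<omega>. ?r (X \<omega>)) \<in> measurable M ?P"
      by (auto simp: borel_vec_def)
  next
    assume "(\<forall>\<omega>\<in>space M. X \<omega> \<in> carrier_vec n) \<and> (\<lambda>\<omega>. ?r (X \<omega>)) \<in> measurable M ?P"
    then show "X \<in> measurable M (borel_vec n)"
      unfolding borel_vec_def by (intro measurable_vimage_algebra2) auto
  qed
  have 2: "(\<lambda>\<omega>. ?r (X \<omega>)) \<in> measurable M ?P \<longleftrightarrow>
      (\<forall>i<n. (\<lambda>\<omega>. vec_index (X \<omega>) i) \<in> borel_measurable M)"
  proof
    assume A: "(\<lambda>\<omega>. ?r (X \<omega>)) \<in> measurable M ?P"
    show "\<forall>i<n. (\<lambda>\<omega>. vec_index (X \<omega>) i) \<in> borel_measurable M"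
    proof (intro allI impI)
      fix i assume i: "i < n"
      have "(\<lambda>\<omega>. ?r (X \<omega>) i) \<in> borel_measurable M"
        by (rule measurable_compose[OF A measurable_component_singleton]) (use i in auto)
      then show "(\<lambda>\<omega>. vec_index (X \<omega>) i) \<in> borel_measurable M"
        using i by simp
    qed
  next
    assume "\<forall>i<n. (\<lambda>\<omega>. vec_index (X \<omega>) i) \<in> borel_measurable M"
    then show "(\<lambda>\<omega>. ?r (X \<omega>)) \<in> measurable M ?P"
      by (intro measurable_restrict) auto
  qed
  show ?thesis using 1 2 by simp
qed

end

theory Submission
  imports Defs "HOL-Real_Asymp.Real_Asymp"
begin

text \<open>
  The proof is a randomised barrier argument in the style of Batson, Spielman and Srivastava.
  For \<open>u\<close> above the spectrum of \<open>A\<close> consider the potential \<open>tr (u - A)^-1\<close>.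
  When \<open>A\<close> is replaced by \<open>A + x x^T\<close>, the barrier \<open>u\<close> has to move by some \<open>D\<close> for the potential
  not to exceed its old value, and by the Sherman-Morrison formula a \<open>D\<close> with mean close to
  \<open>1 / (1 - phi)\<close> suffices if the potential is at most \<open>phi\<close> and the quadratic form
  \<open>x^T (u - A)^-1 x\<close> does not exceed its mean by much.  Starting from \<open>u = n / phi\<close> at \<open>A = 0\<close>,
  the largest eigenvalue is on average at most about \<open>n / phi + m / (1 - phi)\<close>, which is
  \<open>(sqrt m + sqrt n)^2\<close> for \<open>phi = sqrt n / (sqrt m + sqrt n)\<close>.

  The concentration of the quadratic form needs that \<open>(u - A)^-1\<close> is not dominated by few
  eigenvalues.  This comes for free by tracking the minimum of \<open>u + eps n tr (u - A)^-1\<close>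
  over all \<open>u\<close> with potential at most \<open>phi\<close>: at a minimiser \<open>eps n tr (u - A)^-2 \<le> 1\<close>.
\<close>

section \<open>The spectral theorem\<close>

text \<open>The tail hypothesis may say little about projections of small rank, and tails of order
  \<open>1 / t^2\<close> do not give a second moment. So a random shift is affordable only if it is
  essentially linear in the excesses of projected norms over their means, and small ranks must be
  harmless by themselves. With sorted eigenvalues, summation by parts writes
  \<open>x^T (u - A)^-1 x\<close> through the norms of the projections of \<open>x\<close> onto
  spans of leading eigenvectors; a small rank enters with weight at most the top eigenvalue of
  \<open>(u - A)^-1\<close>, which the regularisation bounds by order \<open>1 / sqrt n\<close>. The
  shift has two tasks: to keep the Sherman-Morrison denominator
  \<open>1 - x^T (u + D - A)^-1 x\<close> above a constant \<open>c\<close> slightly below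
  \<open>1 - phi\<close>, and to compensate the increase of the trace. Each task gets its own shift,
  the first with small mean, the second with mean about \<open>1 / c\<close>. The value
  \<open>phi\<close> minimises \<open>n / phi + m / (1 - phi)\<close> and stays away from 1 because
  \<open>n / m\<close> is eventually bounded above. Every step is an inequality for one fixed
  symmetric \<open>A\<close>, so independence enters only as Fubini's theorem on a product
  measure.\<close>

definition ip :: "nat \<Rightarrow> (nat \<Rightarrow> real) \<Rightarrow> (nat \<Rightarrow> real) \<Rightarrow> real" where
  "ip n x y = (\<Sum>i<n. x i * y i)"

definition mv :: "nat \<Rightarrow> (nat \<Rightarrow> nat \<Rightarrow> real) \<Rightarrow> (nat \<Rightarrow> real) \<Rightarrow> nat \<Rightarrow> real" where
  "mv n A x = (\<lambda>i. \<Sum>k<n. A i k * x k)"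

definition orthonormal :: "nat \<Rightarrow> nat \<Rightarrow> (nat \<Rightarrow> nat \<Rightarrow> real) \<Rightarrow> bool" where
  "orthonormal n k e \<longleftrightarrow> (\<forall>i<k. \<forall>j<k. ip n (e i) (e j) = of_bool (i = j))"

definition symf :: "nat \<Rightarrow> (nat \<Rightarrow> nat \<Rightarrow> real) \<Rightarrow> bool" where
  "symf n A \<longleftrightarrow> (\<forall>i<n. \<forall>j<n. A i j = A j i)"

lemma ip_commute: "ip n x y = ip n y x"
  by (simp add: ip_def mult.commute)

lemma ip_nonneg: "ip n x x \<ge> 0"
  by (simp add: ip_def sum_nonneg)

lemma ip_lincomb_left: "ip n (\<lambda>i. a * x i + b * y i) z = a * ip n x z + b * ip n y z"
  by (simp add: ip_def sum.distrib sum_distrib_left algebra_simps)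

lemma ip_lincomb_right: "ip n z (\<lambda>i. a * x i + b * y i) = a * ip n z x + b * ip n z y"
  by (simp add: ip_def sum.distrib sum_distrib_left algebra_simps)

lemma ip_eq_0_imp: "ip n x x = 0 \<Longrightarrow> i < n \<Longrightarrow> x i = 0"
  unfolding ip_def by (subst (asm) sum_nonneg_eq_0_iff) auto

lemma mv_lincomb: "mv n A (\<lambda>i. a * x i + b * y i) = (\<lambda>i. a * mv n A x i + b * mv n A y i)"
  by (rule ext) (simp add: mv_def sum.distrib sum_distrib_left algebra_simps)

lemma ip_mv_symf:
  assumes "symf n A"
  shows "ip n x (mv n A y) = ip n (mv n A x) y"
proof -
  have "ip n x (mv n A y) = (\<Sum>i<n. \<Sum>k<n. x i * A i k * y k)"
    by (simp add: ip_def mv_def sum_distrib_left mult.assoc)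
  also have "\<dots> = (\<Sum>k<n. \<Sum>i<n. x i * A i k * y k)"
    by (rule sum.swap)
  also have "\<dots> = (\<Sum>k<n. \<Sum>i<n. A k i * x i * y k)"
    using assms by (intro sum.cong refl) (auto simp: symf_def)
  also have "\<dots> = ip n (mv n A x) y"
    by (simp add: ip_def mv_def sum_distrib_right)
  finally show ?thesis .
qed

lemma orthonormal_coordinates:
  assumes e: "orthonormal n k e" and j: "j < k"
  shows "ip n (e j) (\<lambda>l. \<Sum>i<k. c i * e i l) = c j"
proof -
  have "ip n (e j) (\<lambda>l. \<Sum>i<k. c i * e i l) = (\<Sum>l<n. \<Sum>i<k. c i * (e j l * e i l))"
    by (simp add: ip_def sum_distrib_left algebra_simps)
  also have "\<dots> = (\<Sum>i<k. c i * ip n (e j) (e i))"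
    by (subst sum.swap) (simp add: ip_def sum_distrib_left)
  also have "\<dots> = (\<Sum>i<k. if i = j then c i else 0)"
    using e j by (intro sum.cong refl) (auto simp: orthonormal_def)
  finally show ?thesis using j by simp
qed

text \<open>\<open>r\<close> is the \<open>i\<close>-th standard basis vector minus its projection
  onto the span of the \<open>e j\<close>. It is orthogonal to that projection, so its squared norm
  is its own \<open>i\<close>-th entry.\<close>

lemma orthonormal_residual:
  fixes n k e i
  defines "r \<equiv> \<lambda>l. of_bool (l = i) - (\<Sum>j<k. e j i * e j l)"
  assumes e: "orthonormal n k e" and i: "i < n"
  shows "ip n r r = 1 - (\<Sum>j<k. (e j i)\<^sup>2)" and "j < k \<Longrightarrow> ip n (e j) r = 0"
proof -
  have delta: "ip n x (\<lambda>l. of_bool (l = i)) = x i" for x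
    using i by (simp add: ip_def)
  have r: "r = (\<lambda>l. 1 * of_bool (l = i) + (-1) * (\<Sum>j<k. e j i * e j l))"
    by (simp add: r_def)
  show orth: "ip n (e j) r = 0" if "j < k" for j
    unfolding r ip_lincomb_right delta using orthonormal_coordinates[OF e that, of "\<lambda>j. e j i"] by simp
  have "ip n r (\<lambda>l. \<Sum>j<k. e j i * e j l) = (\<Sum>l<n. \<Sum>j<k. e j i * (e j l * r l))"
    by (simp add: ip_def sum_distrib_left algebra_simps)
  also have "\<dots> = (\<Sum>j<k. e j i * ip n (e j) r)"
    by (subst sum.swap) (simp add: ip_def sum_distrib_left)
  also have "\<dots> = 0"
    by (simp add: orth)
  finally have 0: "ip n r (\<lambda>l. \<Sum>j<k. e j i * e j l) = 0" .
  have "ip n r r = 1 * ip n r (\<lambda>l. of_bool (l = i)) + (-1) * ip n r (\<lambda>l. \<Sum>j<k. e j i * e j l)"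
    by (subst (2) r, subst ip_lincomb_right) simp
  also have "\<dots> = r i" using 0 delta[of r] by simp
  finally show "ip n r r = 1 - (\<Sum>j<k. (e j i)\<^sup>2)"
    by (simp add: r_def power2_eq_square)
qed

lemma orthonormal_sum_squares:
  assumes "orthonormal n k e"
  shows "(\<Sum>i<n. \<Sum>j<k. (e j i)\<^sup>2) = real k"
proof -
  have "(\<Sum>i<n. \<Sum>j<k. (e j i)\<^sup>2) = (\<Sum>j<k. ip n (e j) (e j))"
    by (subst sum.swap) (simp add: ip_def power2_eq_square)
  also have "\<dots> = (\<Sum>j<k. 1)"
    using assms by (intro sum.cong) (auto simp: orthonormal_def)
  finally show ?thesis by simp
qed

text \<open>The squared norms of the residuals of all \<open>n\<close> basis vectors add up to
  \<open>n - n = 0\<close>, so every residual vanishes.\<close>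

lemma orthonormal_complete:
  assumes e: "orthonormal n n e" and "i < n" "l < n"
  shows "(\<Sum>j<n. e j i * e j l) = of_bool (i = l)"
proof -
  define r where "r = (\<lambda>i l. of_bool (l = i) - (\<Sum>j<n. e j i * e j l))"
  have rr: "ip n (r i) (r i) = 1 - (\<Sum>j<n. (e j i)\<^sup>2)" if "i < n" for i
    using orthonormal_residual(1)[OF e that] by (simp add: r_def)
  have "(\<Sum>i<n. ip n (r i) (r i)) = (\<Sum>i<n. 1 - (\<Sum>j<n. (e j i)\<^sup>2))"
    using rr by (intro sum.cong) auto
  also have "\<dots> = 0"
    using orthonormal_sum_squares[OF e] by (simp add: sum_subtractf)
  finally have "ip n (r i) (r i) = 0"
    using assms by (subst (asm) sum_nonneg_eq_0_iff) (auto simp: ip_nonneg)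
  then have "r i l = 0"
    using assms ip_eq_0_imp by blast
  then show ?thesis by (auto simp: r_def)
qed

text \<open>The \<open>e j\<close> carry total mass \<open>k < n\<close> over \<open>n\<close>
  coordinates, so some coordinate carries mass below 1 and its basis vector has a nonzero residual.
  Entries from \<open>n\<close> on are 0 because vectors are functions on all naturals and the unit
  sphere should be compact.\<close>

lemma orthonormal_extend:
  assumes "orthonormal n k e" "k < n"
  shows "\<exists>x. ip n x x = 1 \<and> (\<forall>j<k. ip n (e j) x = 0) \<and> (\<forall>i\<ge>n. x i = 0)"
proof -
  have "\<exists>i<n. (\<Sum>j<k. (e j i)\<^sup>2) < 1"
  proof (rule ccontr)
    assume "\<not> ?thesis"
    then have "(\<Sum>i<n. 1) \<le> (\<Sum>i<n. \<Sum>j<k. (e j i)\<^sup>2)"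
      by (intro sum_mono) auto
    then show False using orthonormal_sum_squares[OF assms(1)] assms(2) by simp
  qed
  then obtain i where i: "i < n" "(\<Sum>j<k. (e j i)\<^sup>2) < 1" by blast
  define r where "r = (\<lambda>l. of_bool (l = i) - (\<Sum>j<k. e j i * e j l))"
  have rr: "ip n r r > 0" and orth: "\<And>j. j < k \<Longrightarrow> ip n (e j) r = 0"
    using orthonormal_residual[OF assms(1) i(1)] i(2) by (simp_all add: r_def)
  define x where "x = (\<lambda>l. if l < n then r l / sqrt (ip n r r) else 0)"
  have "ip n y x = ip n y r / sqrt (ip n r r)" for y
    by (simp add: ip_def x_def sum_divide_distrib)
  moreover have "ip n x r = ip n r r / sqrt (ip n r r)"
    by (simp add: ip_def x_def sum_divide_distrib)
  ultimately show ?thesis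
    using rr orth by (intro exI[of _ x]) (auto simp: x_def)
qed

lemma compact_sphere:
  "compact {x :: nat \<Rightarrow> real. ip n x x = 1 \<and> (\<forall>j<k. ip n (e j) x = 0) \<and> (\<forall>i\<ge>n. x i = 0)}"
    (is "compact ?S")
proof -
  let ?B = "PiE UNIV (\<lambda>i. if i < n then {-1..1} else {0}) :: (nat \<Rightarrow> real) set"
  have "compact ?B"
  proof -
    have "compactin (product_topology (\<lambda>_. euclidean) UNIV) ?B"
      by (simp add: compactin_PiE)
    then show ?thesis by (simp add: euclidean_product_topology)
  qed
  moreover have "closed ?S"
  proof -
    have coord: "continuous_on UNIV (\<lambda>x :: nat \<Rightarrow> real. x i)" for i
      by simp
    have "?S = {x. ip n x x = 1} \<inter> (\<Inter>j\<in>{..<k}. {x. ip n (e j) x = 0}) \<inter> (\<Inter>i\<in>{n..}. {x. x i = 0})"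
      by auto
    also have "closed \<dots>"
      unfolding ip_def
      by (intro closed_Int closed_INT ballI closed_Collect_eq continuous_on_sum continuous_on_mult
          continuous_on_const coord)
    finally show ?thesis .
  qed
  moreover have "?S \<subseteq> ?B"
  proof safe
    fix x i assume x: "ip n x x = 1" "\<forall>i\<ge>n. x i = 0"
    show "x i \<in> (if i < n then {-1..1} else {0})"
    proof (cases "i < n")
      case True
      then have "(x i)\<^sup>2 \<le> (\<Sum>i<n. (x i)\<^sup>2)"
        by (intro member_le_sum) auto
      then have "(x i)\<^sup>2 \<le> 1"
        using x by (simp add: ip_def power2_eq_square)
      then show ?thesis using True by (simp add: abs_square_le_1 abs_le_iff)
    qed (use x in auto)
  qed auto
  ultimately show ?thesis
    using compact_Int_closed[of ?B ?S] by (simp add: Int_absorb1)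
qed

text \<open>A maximiser \<open>x\<close> of the Rayleigh quotient on the orthogonal complement of
  the \<open>e j\<close> is an eigenvector. Maximality of its value \<open>l\<close> stays in the
  conclusion because it later orders the eigenvalues.\<close>

lemma eigenvector_extend:
  assumes A: "symf n A" and e: "orthonormal n k e" and k: "k < n"
    and eig: "\<And>j i. j < k \<Longrightarrow> i < n \<Longrightarrow> mv n A (e j) i = lam j * e j i"
  shows "\<exists>x l. ip n x x = 1 \<and> (\<forall>j<k. ip n (e j) x = 0) \<and> (\<forall>i<n. mv n A x i = l * x i) \<and>
    (\<forall>w. (\<forall>j<k. ip n (e j) w = 0) \<longrightarrow> ip n w (mv n A w) \<le> l * ip n w w)"
proof -
  define S where "S = {x. ip n x x = 1 \<and> (\<forall>j<k. ip n (e j) x = 0) \<and> (\<forall>i\<ge>n. x i = 0)}"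
  have "compact S" unfolding S_def by (rule compact_sphere)
  moreover have "S \<noteq> {}"
    using orthonormal_extend[OF e k] unfolding S_def by blast
  moreover have "continuous_on S (\<lambda>x. ip n x (mv n A x))"
    unfolding ip_def mv_def
    by (intro continuous_on_sum continuous_on_mult continuous_on_const
        continuous_on_subset[OF continuous_on_product_coordinates subset_UNIV])
  ultimately have "\<exists>x\<in>S. \<forall>y\<in>S. ip n y (mv n A y) \<le> ip n x (mv n A x)"
    by (rule continuous_attains_sup)
  then obtain x where xS: "x \<in> S" and xmax: "\<forall>y\<in>S. ip n y (mv n A y) \<le> ip n x (mv n A x)"
    by blast
  define l where "l = ip n x (mv n A x)"
  have x: "ip n x x = 1" "\<And>j. j < k \<Longrightarrow> ip n (e j) x = 0"
    using xS by (auto simp: S_def)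
  have max: "ip n w (mv n A w) \<le> l * ip n w w" if w: "\<And>j. j < k \<Longrightarrow> ip n (e j) w = 0" for w
  proof (cases "ip n w w = 0")
    case True
    have "w i = 0" if "i < n" for i
      using ip_eq_0_imp[OF True that] .
    then have "ip n w (mv n A w) = 0"
      by (simp add: ip_def)
    then show ?thesis using True by simp
  next
    case False
    then have pos: "ip n w w > 0" using ip_nonneg[of n w] by linarith
    define s where "s = 1 / sqrt (ip n w w)"
    have ss: "s * s = 1 / ip n w w" using pos by (simp add: s_def)
    define y where "y = (\<lambda>i. if i < n then s * w i else 0)"
    have y: "ip n z y = s * ip n z w" "mv n A y = (\<lambda>i. s * mv n A w i)" for z
      by (auto simp: ip_def mv_def y_def sum_distrib_left algebra_simps)
    have yy: "ip n y z = s * ip n w z" for z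
      using y(1)[of z] by (simp add: ip_commute)
    have "ip n y y = s * s * ip n w w" unfolding y(1) yy by simp
    then have "ip n y y = 1" using ss pos by simp
    moreover have "\<forall>i\<ge>n. y i = 0" by (simp add: y_def)
    ultimately have "y \<in> S" using w by (simp add: S_def y(1))
    with xmax have "ip n y (mv n A y) \<le> l" by (simp add: l_def)
    moreover have "ip n y (mv n A y) = s * (s * ip n w (mv n A w))"
      unfolding yy y by (simp add: ip_def sum_distrib_left algebra_simps)
    ultimately have "s * s * ip n w (mv n A w) \<le> l" by (simp add: mult.assoc)
    then show ?thesis using pos by (simp add: ss field_simps)
  qed
  have *: "mv n A x i = l * x i" if "i < n" for i
  proof -
    \<comment> \<open>The defect \<open>A x - l x\<close> lies in the complement again, so
      \<open>x + t w\<close> competes with \<open>x\<close>; the first-order gain is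
      \<open>2 * t\<close> times the squared norm of \<open>w\<close>, which must therefore be
      0.\<close>
    define w where "w = (\<lambda>i. 1 * mv n A x i + (- l) * x i)"
    have worth: "ip n (e j) w = 0" if "j < k" for j
    proof -
      have "ip n (e j) (mv n A x) = ip n (mv n A (e j)) x" by (rule ip_mv_symf[OF A])
      also have "\<dots> = lam j * ip n (e j) x"
        using eig[OF that] by (simp add: ip_def sum_distrib_left mult.assoc)
      finally have "ip n (e j) (mv n A x) = 0" using x(2)[OF that] by simp
      then show ?thesis unfolding w_def ip_lincomb_right using x(2)[OF that] by simp
    qed
    define c where "c = ip n w (mv n A w) - l * ip n w w"
    have ww: "ip n w w = ip n w (mv n A x) - l * ip n w x"
      by (subst (2) w_def, subst ip_lincomb_right) simp
    have ineq: "2 * t * ip n w w + t\<^sup>2 * c \<le> 0" for t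
    proof -
      define z where "z = (\<lambda>i. 1 * x i + t * w i)"
      have "ip n z (mv n A z) \<le> l * ip n z z"
        by (rule max, unfold z_def ip_lincomb_right) (simp add: x worth)
      moreover have "ip n z z = 1 + 2 * t * ip n w x + t\<^sup>2 * ip n w w"
        unfolding z_def ip_lincomb_right ip_lincomb_left x using ip_commute[of n x w]
        by (simp add: algebra_simps power2_eq_square)
      moreover have "ip n z (mv n A z) = l + 2 * t * ip n w (mv n A x) + t\<^sup>2 * ip n w (mv n A w)"
        unfolding z_def mv_lincomb ip_lincomb_right ip_lincomb_left l_def
        using ip_mv_symf[OF A, of x w] ip_commute[of n w "mv n A x"]
        by (simp add: algebra_simps power2_eq_square)
      ultimately show ?thesis by (simp add: ww c_def algebra_simps)
    qed
    have "ip n w w = 0"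
    proof (rule ccontr)
      assume "ip n w w \<noteq> 0"
      then have pos: "ip n w w > 0" using ip_nonneg[of n w] by linarith
      \<comment> \<open>Small enough that the term \<open>t^2 * c\<close> can cancel at most half of
        the first-order gain.\<close>
      define t where "t = ip n w w / (\<bar>c\<bar> + 1)"
      have t: "t > 0" using pos by (simp add: t_def)
      have "t * \<bar>c\<bar> \<le> ip n w w" using pos by (simp add: t_def field_simps)
      then have "t * (t * \<bar>c\<bar>) \<le> t * ip n w w" using t by (intro mult_left_mono) auto
      moreover have "t * (t * \<bar>c\<bar>) \<ge> - (t\<^sup>2 * c)"
        using t by (simp add: power2_eq_square mult.assoc[symmetric] abs_if mult_less_0_iff)
      moreover have "t * ip n w w > 0" using t pos by simp
      ultimately show False using ineq[of t] by (simp add: mult.assoc)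
    qed
    from ip_eq_0_imp[OF this \<open>i < n\<close>] show ?thesis by (simp add: w_def)
  qed
  show ?thesis
    using x * max by (intro exI[of _ x] exI[of _ l]) auto
qed

text \<open>Deflation: a later eigenvector lies in every complement over which an earlier one was
  maximal, so the eigenvalues come out in decreasing order.\<close>

lemma spectral_decomposition:
  assumes A: "symf n A"
  obtains e lam where "orthonormal n n e"
    and "\<And>j i. j < n \<Longrightarrow> i < n \<Longrightarrow> mv n A (e j) i = lam j * e j i"
    and "\<And>i j. i \<le> j \<Longrightarrow> j < n \<Longrightarrow> lam j \<le> lam i"
proof -
  have "\<exists>e lam. orthonormal n k e \<and> (\<forall>j<k. \<forall>i<n. mv n A (e j) i = lam j * e j i) \<and>
     (\<forall>j<k. \<forall>w. (\<forall>i<j. ip n (e i) w = 0) \<longrightarrow> ip n w (mv n A w) \<le> lam j * ip n w w)"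
    if "k \<le> n" for k using that
  proof (induction k)
    case 0
    show ?case by (auto simp: orthonormal_def)
  next
    case (Suc k)
    then obtain e lam where e: "orthonormal n k e"
      and eig': "\<forall>j<k. \<forall>i<n. mv n A (e j) i = lam j * e j i"
      and mx: "\<forall>j<k. \<forall>w. (\<forall>i<j. ip n (e i) w = 0) \<longrightarrow> ip n w (mv n A w) \<le> lam j * ip n w w"
      using Suc_leD by blast
    have eig: "mv n A (e j) i = lam j * e j i" if "j < k" "i < n" for j i
      using eig' that by blast
    from Suc.prems have "k < n" by simp
    from eigenvector_extend[OF A e this eig] obtain x l where x: "ip n x x = 1"
      "\<forall>j<k. ip n (e j) x = 0" "\<forall>i<n. mv n A x i = l * x i"
      "\<forall>w. (\<forall>j<k. ip n (e j) w = 0) \<longrightarrow> ip n w (mv n A w) \<le> l * ip n w w"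
      by blast
    show ?case
    proof (intro exI[of _ "e(k := x)"] exI[of _ "lam(k := l)"] conjI allI impI)
      show "orthonormal n (Suc k) (e(k := x))"
        unfolding orthonormal_def
      proof (intro allI impI)
        fix i j assume "i < Suc k" "j < Suc k"
        then consider "i < k" "j < k" | "i = k" "j < k" | "i < k" "j = k" | "i = k" "j = k"
          by linarith
        then show "ip n ((e(k := x)) i) ((e(k := x)) j) = of_bool (i = j)"
          using e x(1,2) by cases (simp_all add: orthonormal_def ip_commute)
      qed
    next
      fix j i assume "j < Suc k" "i < n"
      then show "mv n A ((e(k := x)) j) i = (lam(k := l)) j * (e(k := x)) j i"
        using eig x(3) by (cases "j = k") auto
    next
      fix j w assume j: "j < Suc k" and w: "\<forall>i<j. ip n ((e(k := x)) i) w = 0"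
      have "\<forall>i<j. ip n (e i) w = 0" using w j by auto
      then show "ip n w (mv n A w) \<le> (lam(k := l)) j * ip n w w"
        using mx x(4) j by (cases "j = k") auto
    qed
  qed
  from this[OF order_refl] obtain e lam where e: "orthonormal n n e"
    and eig: "\<forall>j<n. \<forall>i<n. mv n A (e j) i = lam j * e j i"
    and mx: "\<forall>j<n. \<forall>w. (\<forall>i<j. ip n (e i) w = 0) \<longrightarrow> ip n w (mv n A w) \<le> lam j * ip n w w"
    by blast
  have sorted: "lam j \<le> lam i" if ij: "i \<le> j" "j < n" for i j
  proof -
    have "ip n (e j) (mv n A (e j)) \<le> lam i * ip n (e j) (e j)"
    proof (cases "i = j")
      case True
      have "\<forall>i<j. ip n (e i) (e j) = 0"
        using e ij by (auto simp: orthonormal_def)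
      then show ?thesis using mx ij True by blast
    next
      case False
      have "\<forall>l<i. ip n (e l) (e j) = 0"
        using e ij by (auto simp: orthonormal_def)
      then show ?thesis using mx ij by (meson order_le_less_trans)
    qed
    moreover have "ip n (e j) (mv n A (e j)) = lam j * ip n (e j) (e j)"
      using eig ij(2) by (simp add: ip_def sum_distrib_left algebra_simps)
    moreover have "ip n (e j) (e j) = 1" using e ij by (auto simp: orthonormal_def)
    ultimately show ?thesis by simp
  qed
  show ?thesis
    by (rule that[of e lam]) (simp_all add: e eig sorted)
qed

section \<open>The barrier potential\<close>

text \<open>With decreasing eigenvalues the weights \<open>1 / (u - lam i)\<close> decrease as well,
  as required for summation by parts over leading eigenvectors.\<close>

locale eigensystem =
  fixes n :: nat and A :: "nat \<Rightarrow> nat \<Rightarrow> real" and e :: "nat \<Rightarrow> nat \<Rightarrow> real" and lam :: "nat \<Rightarrow> real"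
  assumes symf: "symf n A"
    and orthonormal: "orthonormal n n e"
    and eigenvector: "\<And>j i. j < n \<Longrightarrow> i < n \<Longrightarrow> mv n A (e j) i = lam j * e j i"
    and sorted: "\<And>i j. i \<le> j \<Longrightarrow> j < n \<Longrightarrow> lam j \<le> lam i"
begin

lemma parseval: "ip n w z = (\<Sum>i<n. ip n (e i) w * ip n (e i) z)"
proof -
  have "(\<Sum>i<n. ip n (e i) w * ip n (e i) z) = (\<Sum>i<n. \<Sum>k<n. \<Sum>l<n. e i k * w k * (e i l * z l))"
    by (simp add: ip_def sum_product)
  also have "\<dots> = (\<Sum>k<n. \<Sum>i<n. \<Sum>l<n. e i k * w k * (e i l * z l))"
    by (rule sum.swap)
  also have "\<dots> = (\<Sum>k<n. \<Sum>l<n. \<Sum>i<n. e i k * w k * (e i l * z l))"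
    by (intro sum.cong refl sum.swap)
  also have "\<dots> = (\<Sum>k<n. \<Sum>l<n. w k * z l * (\<Sum>i<n. e i k * e i l))"
    by (simp add: sum_distrib_left mult_ac)
  also have "\<dots> = (\<Sum>k<n. \<Sum>l<n. if k = l then w k * z l else 0)"
    by (intro sum.cong refl) (auto simp: orthonormal_complete[OF orthonormal])
  also have "\<dots> = ip n w z" by (simp add: ip_def)
  finally show ?thesis ..
qed

lemma ip_mv_eigen: "ip n w (mv n A w) = (\<Sum>i<n. lam i * (ip n (e i) w)\<^sup>2)"
proof -
  have "ip n (e i) (mv n A w) = lam i * ip n (e i) w" if "i < n" for i
  proof -
    have "ip n (e i) (mv n A w) = ip n (mv n A (e i)) w" by (rule ip_mv_symf[OF symf])
    also have "\<dots> = lam i * ip n (e i) w"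
      using eigenvector[OF that] by (simp add: ip_def sum_distrib_left mult.assoc)
    finally show ?thesis .
  qed
  then show ?thesis
    unfolding parseval[of w "mv n A w"] by (intro sum.cong) (auto simp: power2_eq_square)
qed

lemma sum_coordinate_squares: "i < n \<Longrightarrow> (\<Sum>j<n. (e i j)\<^sup>2) = 1"
  using orthonormal by (simp add: orthonormal_def ip_def power2_eq_square)

lemma sum_weighted_coordinates:
  "(\<Sum>j<n. \<Sum>i<n. d i * (e i j)\<^sup>2) = (\<Sum>i<n. d i)"
proof -
  have "(\<Sum>j<n. \<Sum>i<n. d i * (e i j)\<^sup>2) = (\<Sum>i<n. d i * (\<Sum>j<n. (e i j)\<^sup>2))"
    by (subst sum.swap) (simp add: sum_distrib_left)
  then show ?thesis by (simp add: sum_coordinate_squares)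
qed

end

lemma eigensystem_exists:
  assumes "symf n A" obtains e lam where "eigensystem n A e lam"
proof (rule spectral_decomposition[OF assms])
  fix e lam assume *: "orthonormal n n e"
    "\<And>j i. j < n \<Longrightarrow> i < n \<Longrightarrow> mv n A (e j) i = lam j * e j i"
    "\<And>i j. i \<le> j \<Longrightarrow> j < n \<Longrightarrow> lam j \<le> lam i"
  have "eigensystem n A e lam"
    by (rule eigensystem.intro) (fact assms *)+
  then show thesis by (rule that)
qed

text \<open>
  Encodes that \<open>u\<close> exceeds all eigenvalues of \<open>A\<close> and \<open>tr (u - A)^-1 \<le> p\<close>, through
  \<open>tr Q^-1 = sup V. 2 tr V - tr (V^T Q V)\<close>; \<open>V j\<close> is the \<open>j\<close>-th column of the test matrix.
  In this form monotonicity in \<open>u\<close> and measurability in \<open>A\<close> are immediate.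
\<close>
definition pot_le :: "nat \<Rightarrow> (nat \<Rightarrow> nat \<Rightarrow> real) \<Rightarrow> real \<Rightarrow> real \<Rightarrow> bool" where
  "pot_le n A u p \<longleftrightarrow>
     (\<forall>V. (\<Sum>j<n. 2 * V j j - u * ip n (V j) (V j) + ip n (V j) (mv n A (V j))) \<le> p)"

lemma pot_le_mono: 
  assumes "pot_le n A u p" "u \<le> u'" "p \<le> p'"
  shows "pot_le n A u' p'"
  unfolding pot_le_def
proof
  fix V
  have "(\<Sum>j<n. 2 * V j j - u' * ip n (V j) (V j) + ip n (V j) (mv n A (V j)))
      \<le> (\<Sum>j<n. 2 * V j j - u * ip n (V j) (V j) + ip n (V j) (mv n A (V j)))"
    using assms(2) ip_nonneg by (intro sum_mono) (auto intro: mult_right_mono)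
  also have "\<dots> \<le> p" using assms(1) by (simp add: pot_le_def)
  finally show "(\<Sum>j<n. 2 * V j j - u' * ip n (V j) (V j) + ip n (V j) (mv n A (V j))) \<le> p'"
    using assms(3) by linarith
qed

section \<open>The potential in eigenvalue coordinates\<close>

context eigensystem
begin

text \<open>The test matrix is the one with eigenvectors \<open>e i\<close> and eigenvalues
  \<open>d i\<close>; it commutes with \<open>A\<close>, so both traces become sums over
  eigenvalues.\<close>

lemma pot_le_diagonal:
  assumes "pot_le n A u p"
  shows "(\<Sum>i<n. 2 * d i - (u - lam i) * (d i)\<^sup>2) \<le> p"
proof -
  define V where "V = (\<lambda>j l. \<Sum>i<n. d i * e i j * e i l)"
  have coord: "ip n (e i) (V j) = d i * e i j" if "i < n" for i j
    unfolding V_def using orthonormal_coordinates[OF orthonormal that, of "\<lambda>i. d i * e i j"] by simp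
  have "(\<Sum>j<n. 2 * V j j - u * ip n (V j) (V j) + ip n (V j) (mv n A (V j)))
      = (\<Sum>j<n. \<Sum>i<n. (2 * d i - (u - lam i) * (d i)\<^sup>2) * (e i j)\<^sup>2)"
  proof (intro sum.cong refl)
    fix j
    have "ip n (V j) (V j) = (\<Sum>i<n. (d i)\<^sup>2 * (e i j)\<^sup>2)"
      unfolding parseval[of "V j" "V j"]
      by (intro sum.cong) (auto simp: coord power2_eq_square)
    moreover have "ip n (V j) (mv n A (V j)) = (\<Sum>i<n. lam i * ((d i)\<^sup>2 * (e i j)\<^sup>2))"
      unfolding ip_mv_eigen by (intro sum.cong) (auto simp: coord power2_eq_square)
    moreover have "V j j = (\<Sum>i<n. d i * (e i j)\<^sup>2)"
      by (simp add: V_def power2_eq_square mult.assoc)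
    ultimately show "2 * V j j - u * ip n (V j) (V j) + ip n (V j) (mv n A (V j)) =
        (\<Sum>i<n. (2 * d i - (u - lam i) * (d i)\<^sup>2) * (e i j)\<^sup>2)"
      by (simp add: sum_distrib_left sum_subtractf[symmetric] sum.distrib[symmetric] algebra_simps)
  qed
  also have "\<dots> = (\<Sum>i<n. 2 * d i - (u - lam i) * (d i)\<^sup>2)"
    by (rule sum_weighted_coordinates)
  finally show ?thesis using assms[unfolded pot_le_def, rule_format, of V] by linarith
qed

lemma pot_le_imp_eigenvalue_less:
  assumes "pot_le n A u p" "i < n"
  shows "lam i < u"
proof (rule ccontr)
  assume "\<not> lam i < u"
  \<comment> \<open>If \<open>u \<le> lam i\<close>, the test matrix \<open>t e_i e_i^T\<close> has
    value at least \<open>2 * t\<close>, which exceeds \<open>p\<close>.\<close>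
  define t where "t = \<bar>p\<bar> + 1"
  define d where "d = (\<lambda>k. if k = i then t else 0)"
  have "(\<Sum>k<n. 2 * d k - (u - lam k) * (d k)\<^sup>2) = (\<Sum>k<n. if k = i then 2 * t - (u - lam i) * t\<^sup>2 else 0)"
    by (intro sum.cong) (auto simp: d_def)
  then have "2 * t - (u - lam i) * t\<^sup>2 \<le> p"
    using pot_le_diagonal[OF assms(1), of d] assms(2) by simp
  moreover have "(u - lam i) * t\<^sup>2 \<le> 0"
    using \<open>\<not> lam i < u\<close> by (simp add: mult_nonpos_nonneg)
  ultimately show False by (simp add: t_def)
qed

text \<open>The supremum over test matrices is attained at \<open>(u - A)^-1\<close>, that is at
  \<open>d i = 1 / (u - lam i)\<close>.\<close>

lemma pot_le_imp_sum_le: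
  assumes "pot_le n A u p"
  shows "(\<Sum>i<n. 1 / (u - lam i)) \<le> p"
proof -
  have "(\<Sum>i<n. 2 * (1 / (u - lam i)) - (u - lam i) * (1 / (u - lam i))\<^sup>2) = (\<Sum>i<n. 1 / (u - lam i))"
  proof (intro sum.cong refl)
    fix i assume "i \<in> {..<n}"
    then have "u - lam i \<noteq> 0" using pot_le_imp_eigenvalue_less[OF assms, of i] by auto
    then show "2 * (1 / (u - lam i)) - (u - lam i) * (1 / (u - lam i))\<^sup>2 = 1 / (u - lam i)"
      by (simp add: power2_eq_square)
  qed
  then show ?thesis using pot_le_diagonal[OF assms, of "\<lambda>i. 1 / (u - lam i)"] by simp
qed

end

section \<open>Rank-one updates, shifts and regularisation of the barrier\<close>

text \<open>The right-hand side is \<open>h^T (B^-1 - y y^T)^-1 h\<close> for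
  \<open>B = diag b\<close>, expanded by Sherman-Morrison. With \<open>s\<close> the inner product
  of \<open>y\<close> and \<open>w\<close> treated as a number, completing the square around
  \<open>b i * (h i + s * y i)\<close> removes \<open>w\<close>; what is left is a concave quadratic
  in \<open>s\<close>.\<close>

lemma rank_one_quadratic_bound:
  fixes b h y w :: "nat \<Rightarrow> real"
  assumes b: "\<And>i. i < n \<Longrightarrow> b i > 0" and Q: "(\<Sum>i<n. b i * (y i)\<^sup>2) < 1"
  shows "2 * (\<Sum>i<n. h i * w i) - (\<Sum>i<n. (w i)\<^sup>2 / b i) + (\<Sum>i<n. y i * w i)\<^sup>2
    \<le> (\<Sum>i<n. b i * (h i)\<^sup>2) + (\<Sum>i<n. b i * h i * y i)\<^sup>2 / (1 - (\<Sum>i<n. b i * (y i)\<^sup>2))"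
proof -
  define s Q1 H where "s = (\<Sum>i<n. y i * w i)" and "Q1 = (\<Sum>i<n. b i * (y i)\<^sup>2)"
    and "H = (\<Sum>i<n. b i * h i * y i)"
  have "0 \<le> (\<Sum>i<n. (w i - b i * (h i + s * y i))\<^sup>2 / b i)"
    using b by (intro sum_nonneg) (auto simp: less_imp_le)
  also have "\<dots> = (\<Sum>i<n. (w i)\<^sup>2 / b i - 2 * (h i * w i) - 2 * s * (y i * w i) + b i * (h i)\<^sup>2
      + 2 * s * (b i * h i * y i) + s\<^sup>2 * (b i * (y i)\<^sup>2))"
  proof (intro sum.cong refl)
    fix i assume "i \<in> {..<n}"
    then have "b i \<noteq> 0" using b[of i] by auto
    then show "(w i - b i * (h i + s * y i))\<^sup>2 / b i = (w i)\<^sup>2 / b i - 2 * (h i * w i) - 2 * s * (y i * w i)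
        + b i * (h i)\<^sup>2 + 2 * s * (b i * h i * y i) + s\<^sup>2 * (b i * (y i)\<^sup>2)"
      by (simp add: field_simps power2_eq_square)
  qed
  also have "\<dots> = (\<Sum>i<n. (w i)\<^sup>2 / b i) - 2 * (\<Sum>i<n. h i * w i) - 2 * s * s + (\<Sum>i<n. b i * (h i)\<^sup>2)
      + 2 * s * H + s\<^sup>2 * Q1"
    by (simp add: sum.distrib sum_subtractf sum_distrib_left[symmetric] s_def[symmetric] Q1_def[symmetric]
        H_def[symmetric])
  finally have "2 * (\<Sum>i<n. h i * w i) - (\<Sum>i<n. (w i)\<^sup>2 / b i) + s\<^sup>2
      \<le> (\<Sum>i<n. b i * (h i)\<^sup>2) + (2 * s * H - s\<^sup>2 * (1 - Q1))"
    by (simp add: power2_eq_square algebra_simps)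
  also have "2 * s * H - s\<^sup>2 * (1 - Q1) \<le> H\<^sup>2 / (1 - Q1)"
  proof -
    have pos: "1 - Q1 > 0" using Q by (simp add: Q1_def)
    have "0 \<le> (s * (1 - Q1) - H)\<^sup>2" by simp
    then show ?thesis using pos by (simp add: field_simps power2_eq_square)
  qed
  finally show ?thesis by (simp add: s_def Q1_def H_def)
qed

definition add_sq :: "(nat \<Rightarrow> nat \<Rightarrow> real) \<Rightarrow> (nat \<Rightarrow> real) \<Rightarrow> nat \<Rightarrow> nat \<Rightarrow> real" where
  "add_sq A x = (\<lambda>i k. A i k + x i * x k)"

lemma ip_mv_add_sq: "ip n w (mv n (add_sq A x) w) = ip n w (mv n A w) + (ip n x w)\<^sup>2"
proof -
  have "mv n (add_sq A x) w = (\<lambda>i. 1 * mv n A w i + ip n x w * x i)"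
    by (rule ext) (simp add: mv_def add_sq_def ip_def sum.distrib sum_distrib_right sum_distrib_left algebra_simps)
  then show ?thesis
    using ip_lincomb_right[of n w 1 "mv n A w" "ip n x w" x]
    by (simp add: ip_commute[of n w x] power2_eq_square)
qed

context eigensystem
begin

text \<open>The trace form of Sherman-Morrison: the \<open>b i\<close> are the eigenvalues of
  \<open>(u - A)^-1\<close>, and adding \<open>x x^T\<close> to \<open>A\<close> raises the trace of
  the resolvent \<open>B\<close> by \<open>|B x|^2 / (1 - x^T B x)\<close>.\<close>

lemma pot_le_add_sq:
  fixes x :: "nat \<Rightarrow> real"
  defines "y \<equiv> \<lambda>i. ip n (e i) x"
  assumes b: "\<And>i. i < n \<Longrightarrow> b i > 0 \<and> lam i = u - 1 / b i" and Q: "(\<Sum>i<n. b i * (y i)\<^sup>2) < 1"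
  shows "pot_le n (add_sq A x) u
    ((\<Sum>i<n. b i) + (\<Sum>i<n. (b i * y i)\<^sup>2) / (1 - (\<Sum>i<n. b i * (y i)\<^sup>2)))"
  unfolding pot_le_def
proof
  fix V :: "nat \<Rightarrow> nat \<Rightarrow> real"
  define w where "w = (\<lambda>j i. ip n (e i) (V j))"
  define D where "D = 1 - (\<Sum>i<n. b i * (y i)\<^sup>2)"
  have "(\<Sum>j<n. 2 * V j j - u * ip n (V j) (V j) + ip n (V j) (mv n (add_sq A x) (V j)))
     \<le> (\<Sum>j<n. (\<Sum>i<n. b i * (e i j)\<^sup>2) + (\<Sum>i<n. b i * e i j * y i)\<^sup>2 / D)"
  proof (intro sum_mono)
    fix j assume j: "j \<in> {..<n}"
    \<comment> \<open>In eigencoordinates the \<open>j\<close>-th standard basis vector has entries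
      \<open>e i j\<close>. It plays the role of \<open>h\<close> in the quadratic bound, and
      summing over \<open>j\<close> turns the bounds for single columns into traces.\<close>
    have "V j j = ip n (\<lambda>l. of_bool (l = j)) (V j)"
      using j by (simp add: ip_def)
    also have "\<dots> = (\<Sum>i<n. e i j * w j i)"
      by (subst parseval, intro sum.cong refl) (use j in \<open>auto simp: ip_def w_def\<close>)
    finally have 1: "V j j = (\<Sum>i<n. e i j * w j i)" .
    have 2: "ip n x (V j) = (\<Sum>i<n. y i * w j i)"
      unfolding parseval[of x "V j"] by (simp add: y_def w_def)
    have "u * ip n (V j) (V j) - ip n (V j) (mv n A (V j)) = (\<Sum>i<n. u * (w j i)\<^sup>2 - lam i * (w j i)\<^sup>2)"
      unfolding parseval[of "V j" "V j"] ip_mv_eigen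
      by (simp add: w_def sum_distrib_left sum_subtractf power2_eq_square)
    also have "\<dots> = (\<Sum>i<n. (w j i)\<^sup>2 / b i)"
    proof (intro sum.cong refl)
      fix i assume "i \<in> {..<n}"
      then have "lam i = u - 1 / b i" using b[of i] by simp
      then show "u * (w j i)\<^sup>2 - lam i * (w j i)\<^sup>2 = (w j i)\<^sup>2 / b i"
        by (simp add: left_diff_distrib)
    qed
    finally have 3: "u * ip n (V j) (V j) - ip n (V j) (mv n A (V j)) = (\<Sum>i<n. (w j i)\<^sup>2 / b i)" .
    have "2 * V j j - u * ip n (V j) (V j) + ip n (V j) (mv n (add_sq A x) (V j))
      = 2 * (\<Sum>i<n. e i j * w j i) - (\<Sum>i<n. (w j i)\<^sup>2 / b i) + (\<Sum>i<n. y i * w j i)\<^sup>2"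
      unfolding ip_mv_add_sq 1 2 3[symmetric] by simp
    also have "\<dots> \<le> (\<Sum>i<n. b i * (e i j)\<^sup>2) + (\<Sum>i<n. b i * e i j * y i)\<^sup>2 / D"
      unfolding D_def using rank_one_quadratic_bound[of n b y "\<lambda>i. e i j" "w j"] b Q by simp
    finally show "2 * V j j - u * ip n (V j) (V j) + ip n (V j) (mv n (add_sq A x) (V j))
        \<le> (\<Sum>i<n. b i * (e i j)\<^sup>2) + (\<Sum>i<n. b i * e i j * y i)\<^sup>2 / D" .
  qed
  also have "\<dots> = (\<Sum>i<n. b i) + (\<Sum>j<n. (\<Sum>i<n. b i * e i j * y i)\<^sup>2) / D"
    by (simp add: sum.distrib sum_weighted_coordinates sum_divide_distrib)
  also have "(\<Sum>j<n. (\<Sum>i<n. b i * e i j * y i)\<^sup>2) = (\<Sum>i<n. (b i * y i)\<^sup>2)"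
  proof -
    let ?z = "\<lambda>j. \<Sum>i<n. (b i * y i) * e i j"
    have "(\<Sum>j<n. (\<Sum>i<n. b i * e i j * y i)\<^sup>2) = ip n ?z ?z"
      by (simp add: ip_def power2_eq_square mult_ac)
    also have "\<dots> = (\<Sum>i<n. (b i * y i)\<^sup>2)"
      unfolding parseval[of ?z ?z]
      by (intro sum.cong refl)
        (simp add: orthonormal_coordinates[OF orthonormal, of _ "\<lambda>i. b i * y i"] power2_eq_square)
    finally show ?thesis .
  qed
  finally show "(\<Sum>j<n. 2 * V j j - u * ip n (V j) (V j) + ip n (V j) (mv n (add_sq A x) (V j)))
     \<le> (\<Sum>i<n. b i) + (\<Sum>i<n. (b i * y i)\<^sup>2) / (1 - (\<Sum>i<n. b i * (y i)\<^sup>2))"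
    by (simp add: D_def)
qed

text \<open>The converse of \<open>pot_le_imp_sum_le\<close>, obtained from the rank-one update with
  \<open>x = 0\<close>.\<close>

lemma pot_le_sum:
  assumes "\<And>i. i < n \<Longrightarrow> lam i < u"
  shows "pot_le n A u (\<Sum>i<n. 1 / (u - lam i))"
proof -
  have "add_sq A (\<lambda>_. 0) = A" by (simp add: add_sq_def)
  then show ?thesis
    using pot_le_add_sq[of "\<lambda>i. 1 / (u - lam i)" u "\<lambda>_. 0"] assms by (simp add: ip_def)
qed

text \<open>\<open>D * (\<Sum>i<n. a i * b i)\<close> is the decrease of the potential caused by the shift \<open>D\<close>.\<close>
lemma barrier_shift_feasible:
  fixes x :: "nat \<Rightarrow> real" and u D c :: real
  defines "y \<equiv> \<lambda>i. ip n (e i) x" and "a \<equiv> \<lambda>i. 1 / (u - lam i)"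
  defines "b \<equiv> \<lambda>i. a i / (1 + D * a i)"
  assumes lam: "\<And>i. i < n \<Longrightarrow> lam i < u" and "D \<ge> 0" "c > 0"
    and Q1: "(\<Sum>i<n. b i * (y i)\<^sup>2) \<le> 1 - c"
    and Q2: "(\<Sum>i<n. (b i * y i)\<^sup>2) \<le> c * (D * (\<Sum>i<n. a i * b i))"
  shows "pot_le n (add_sq A x) (u + D) (\<Sum>i<n. a i)"
proof -
  have a: "a i > 0" if "i < n" for i using lam[OF that] by (simp add: a_def)
  have b: "b i > 0 \<and> lam i = u + D - 1 / b i" if "i < n" for i
  proof -
    have "1 + D * a i > 0" using a[OF that] \<open>D \<ge> 0\<close> by (simp add: add_pos_nonneg)
    moreover have "lam i = u - 1 / a i" using lam[OF that] by (simp add: a_def)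
    ultimately show ?thesis using a[OF that] by (simp add: b_def field_simps)
  qed
  \<comment> \<open>The resolvent identity between \<open>u\<close> and \<open>u + D\<close>, read
    off on eigenvalues.\<close>
  have ab: "a i - b i = D * (a i * b i)" if "i < n" for i
  proof -
    have "1 + D * a i > 0" using a[OF that] \<open>D \<ge> 0\<close> by (simp add: add_pos_nonneg)
    then show ?thesis by (simp add: b_def field_simps)
  qed
  have diff: "(\<Sum>i<n. a i) - (\<Sum>i<n. b i) = D * (\<Sum>i<n. a i * b i)"
    unfolding sum_subtractf[symmetric] sum_distrib_left using ab by (intro sum.cong) auto
  have "(\<Sum>i<n. (b i * y i)\<^sup>2) / (1 - (\<Sum>i<n. b i * (y i)\<^sup>2)) \<le> (\<Sum>i<n. (b i * y i)\<^sup>2) / c"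
    using Q1 \<open>c > 0\<close> by (intro divide_left_mono sum_nonneg mult_pos_pos) auto
  also have "\<dots> \<le> D * (\<Sum>i<n. a i * b i)"
    using Q2 \<open>c > 0\<close> by (simp add: field_simps)
  finally have "(\<Sum>i<n. b i) + (\<Sum>i<n. (b i * y i)\<^sup>2) / (1 - (\<Sum>i<n. b i * (y i)\<^sup>2)) \<le> (\<Sum>i<n. a i)"
    using diff by linarith
  moreover have "(\<Sum>i<n. b i * (y i)\<^sup>2) < 1" using Q1 \<open>c > 0\<close> by linarith
  ultimately show ?thesis
    using pot_le_mono[OF pot_le_add_sq[of b "u + D" x]] b unfolding y_def by simp
qed

text \<open>At a minimiser of \<open>v + C * (\<Sum>i<n. 1 / (v - lam i))\<close> the derivative is nonnegative.\<close>
lemma barrier_regularise: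
  assumes pot: "pot_le n A u p" and C: "C > 0"
  obtains v where "v \<ge> u" "\<And>i. i < n \<Longrightarrow> lam i < v"
    "v + C * (\<Sum>i<n. 1 / (v - lam i)) \<le> u + C * p" "(\<Sum>i<n. 1 / (v - lam i)) \<le> p"
    "C * (\<Sum>i<n. (1 / (v - lam i))\<^sup>2) \<le> 1"
proof -
  define P where "P = (\<lambda>v. \<Sum>i<n. 1 / (v - lam i))"
  define h where "h = (\<lambda>v. v + C * P v)"
  have less: "lam i < v" if "i < n" "u \<le> v" for i v
    using pot_le_imp_eigenvalue_less[OF pot that(1)] that(2) by linarith
  have P0: "P v \<ge> 0" if "u \<le> v" for v
    unfolding P_def using less[OF _ that] by (intro sum_nonneg) (auto simp: less_imp_le)
  \<comment> \<open>Minimising over this compact interval is enough, since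
    \<open>h z \<ge> z\<close> and hence \<open>h z > h u\<close> beyond its right end.\<close>
  have "continuous_on {u..h u} h"
    unfolding h_def P_def using less by (intro continuous_intros) fastforce
  moreover have "u \<in> {u..h u}"
    using P0[of u] C by (simp add: h_def)
  ultimately have "\<exists>v\<in>{u..h u}. \<forall>y\<in>{u..h u}. h v \<le> h y"
    by (intro continuous_attains_inf) auto
  then obtain v where v: "v \<in> {u..h u}" and vmin: "\<forall>y\<in>{u..h u}. h v \<le> h y" by blast
  have uv: "u \<le> v" using v by simp
  have min: "h v \<le> h z" if "u \<le> z" for z
  proof (cases "z \<le> h u")
    case False
    have "h v \<le> h u" using vmin \<open>u \<in> {u..h u}\<close> by blast
    also have "h u \<le> z" using False by simp
    also have "z \<le> h z" using P0[OF that] C by (simp add: h_def)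
    finally show ?thesis .
  qed (use vmin that in simp)
  \<comment> \<open>The minimiser may be the left endpoint \<open>u\<close>, so only increments to
    the right are compared; by the resolvent identity the quotient tends to
    \<open>1 - C * (\<Sum>i<n. (1 / (v - lam i))\<^sup>2)\<close>.\<close>
  have key: "C * (\<Sum>i<n. 1 / ((v - lam i) * (v + t - lam i))) \<le> 1" if t: "t > 0" for t
  proof -
    have "h v \<le> h (v + t)" using min[of "v + t"] uv t by simp
    then have "C * (P v - P (v + t)) \<le> t" by (simp add: h_def algebra_simps)
    also have "P v - P (v + t) = (\<Sum>i<n. t * (1 / ((v - lam i) * (v + t - lam i))))"
      unfolding P_def sum_subtractf[symmetric]
    proof (intro sum.cong refl)
      fix i assume "i \<in> {..<n}"
      then have "v - lam i > 0" "v + t - lam i > 0" using less[of i v] uv t by auto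
      then show "1 / (v - lam i) - 1 / (v + t - lam i) = t * (1 / ((v - lam i) * (v + t - lam i)))"
        by (simp add: field_simps)
    qed
    finally have "t * (C * (\<Sum>i<n. 1 / ((v - lam i) * (v + t - lam i)))) \<le> t * 1"
      by (simp add: sum_distrib_left mult_ac)
    then show ?thesis using t by (rule mult_left_le_imp_le)
  qed
  have "((\<lambda>t. C * (\<Sum>i<n. 1 / ((v - lam i) * (v + t - lam i)))) \<longlongrightarrow>
      C * (\<Sum>i<n. 1 / ((v - lam i) * (v + 0 - lam i)))) (at_right 0)"
  proof (intro tendsto_intros)
    fix i assume "i \<in> {..<n}"
    then have "v - lam i > 0" using less[of i v] uv by auto
    then show "(v - lam i) * (v + 0 - lam i) \<noteq> 0" by simp
  qed
  moreover have "eventually (\<lambda>t. C * (\<Sum>i<n. 1 / ((v - lam i) * (v + t - lam i))) \<le> 1) (at_right 0)"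
    using key by (auto simp: eventually_at_right_field intro!: exI[of _ 1])
  ultimately have "C * (\<Sum>i<n. 1 / ((v - lam i) * (v + 0 - lam i))) \<le> 1"
    by (rule tendsto_upperbound) simp
  then have reg: "C * (\<Sum>i<n. (1 / (v - lam i))\<^sup>2) \<le> 1"
    by (simp add: power2_eq_square)
  have Pu: "P u \<le> p" unfolding P_def by (rule pot_le_imp_sum_le[OF pot])
  have "P v \<le> P u"
    unfolding P_def using less[of _ u] uv
    by (intro sum_mono divide_left_mono mult_pos_pos) (auto, smt (verit))
  with Pu have Pv: "P v \<le> p" by simp
  have "h v \<le> h u" using min by simp
  also have "h u \<le> u + C * p" using Pu C by (simp add: h_def)
  finally have hv: "h v \<le> u + C * p" .
  show ?thesis
    by (rule that[OF uv less[OF _ uv] hv[unfolded h_def P_def] Pv[unfolded P_def] reg])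
qed

end

section \<open>Weighted sums\<close>

text \<open>Abel summation. With \<open>z i\<close> the squared coordinates of a vector in an
  eigenbasis, the head sums are the squared norms of its projections onto leading eigenvectors, the
  quantities that the tail hypothesis controls.\<close>

lemma sum_by_parts:
  fixes b z :: "nat \<Rightarrow> real"
  shows "(\<Sum>r<N. (b r - b (Suc r)) * (\<Sum>i\<le>r. z i)) = (\<Sum>i<N. b i * z i) - b N * (\<Sum>i<N. z i)"
  by (induction N) (simp_all add: algebra_simps lessThan_Suc_atMost[symmetric])

lemma sum_by_parts_0:
  fixes b z :: "nat \<Rightarrow> real"
  assumes "b N = 0"
  shows "(\<Sum>i<N. b i * z i) = (\<Sum>r<N. (b r - b (Suc r)) * (\<Sum>i\<le>r. z i))"
  by (simp add: sum_by_parts assms)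

lemma sum_by_parts_1:
  fixes b :: "nat \<Rightarrow> real"
  assumes "b N = 0"
  shows "(\<Sum>r<N. (b r - b (Suc r)) * real (Suc r)) = (\<Sum>i<N. b i)"
  using sum_by_parts_0[of b N "\<lambda>_. 1", OF assms] by simp

text \<open>Weights are indexed from 0 and extended by \<open>a n = 0\<close>, so that summation by parts has no
  boundary term.\<close>
locale weights =
  fixes n :: nat and a :: "nat \<Rightarrow> real"
  assumes pos: "\<And>i. i < n \<Longrightarrow> a i > 0"
    and decreasing: "\<And>r. r < n \<Longrightarrow> a (Suc r) \<le> a r"
    and zero: "a n = 0"
    and n_pos: "n \<ge> 1"
begin

lemma nonneg: "i \<le> n \<Longrightarrow> a i \<ge> 0"
  using pos[of i] zero by (cases "i < n") (auto simp: less_imp_le)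

lemma antimono: "i \<le> j \<Longrightarrow> j \<le> n \<Longrightarrow> a j \<le> a i"
proof (induction j)
  case (Suc j)
  then show ?case using decreasing[of j] by (cases "i = Suc j") auto
qed simp

lemma sum_differences: "(\<Sum>r<n. a r - a (Suc r)) = a 0"
  by (simp add: sum_lessThan_telescope' zero)

lemma sum_squares_ge: "r < n \<Longrightarrow> real (Suc r) * (a r)\<^sup>2 \<le> (\<Sum>i<n. (a i)\<^sup>2)"
proof -
  assume r: "r < n"
  have "real (Suc r) * (a r)\<^sup>2 = (\<Sum>i\<le>r. (a r)\<^sup>2)" by simp
  also have "\<dots> \<le> (\<Sum>i\<le>r. (a i)\<^sup>2)"
    using r antimono pos by (intro sum_mono power_mono) (auto simp: less_imp_le)
  also have "\<dots> \<le> (\<Sum>i<n. (a i)\<^sup>2)"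
    using r by (intro sum_mono2) auto
  finally show ?thesis .
qed

text \<open>A shift by \<open>D\<close> turns the weight \<open>a\<close> into \<open>b\<close>. The
  second bound is for the deterministic part of a weighted sum; the third, from
  \<open>(1 + D * p) * (1 + D * q) \<ge> D * p\<close>, lets a large \<open>D\<close> suppress the
  random excess.\<close>

lemma shrink_difference:
  fixes D :: real
  assumes D: "D \<ge> 0" and r: "r < n"
  defines "b \<equiv> \<lambda>i. a i / (1 + D * a i)"
  shows "b (Suc r) \<le> b r" "b r - b (Suc r) \<le> a r - a (Suc r)"
    "D * (b r - b (Suc r)) \<le> (a r - a (Suc r)) / a r"
proof -
  define p q where "p = a r" and "q = a (Suc r)"
  have pq: "p > 0" "q \<ge> 0" "q \<le> p"
    using pos[OF r] nonneg[of "Suc r"] decreasing[OF r] r by (auto simp: p_def q_def)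
  have pp: "1 + D * p \<ge> 1" "1 + D * q \<ge> 1" using D pq by auto
  have eq: "b r - b (Suc r) = (p - q) / ((1 + D * p) * (1 + D * q))"
    using pp by (simp add: b_def p_def[symmetric] q_def[symmetric] field_simps)
  show "b (Suc r) \<le> b r"
  proof -
    have "(p - q) / ((1 + D * p) * (1 + D * q)) \<ge> 0" using pq pp by simp
    then show ?thesis using eq by simp
  qed
  have "(p - q) / ((1 + D * p) * (1 + D * q)) \<le> (p - q) / 1"
    using pq pp mult_mono[OF pp] by (intro divide_left_mono) auto
  then show "b r - b (Suc r) \<le> a r - a (Suc r)" using eq by (simp add: p_def q_def)
  have "D * p \<le> (1 + D * p) * (1 + D * q)"
  proof -
    have "0 \<le> 1 + D * p" using pp by linarith
    from mult_left_mono[OF pp(2) this] show ?thesis by (rule order_trans[rotated]) simp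
  qed
  then have "D * p * (p - q) \<le> (1 + D * p) * (1 + D * q) * (p - q)"
    using pq by (intro mult_right_mono) auto
  then have "D * p * (p - q) / ((1 + D * p) * (1 + D * q) * p)
      \<le> (1 + D * p) * (1 + D * q) * (p - q) / ((1 + D * p) * (1 + D * q) * p)"
    using pq pp by (intro divide_right_mono) auto
  moreover have "(1 + D * p) * (1 + D * q) \<noteq> 0" using pp by auto
  ultimately have "D * ((p - q) / ((1 + D * p) * (1 + D * q))) \<le> (p - q) / p"
    using pq by simp
  then show "D * (b r - b (Suc r)) \<le> (a r - a (Suc r)) / a r"
    using eq by (simp add: p_def q_def)
qed

text \<open>\<open>W r\<close> is the excess of the head sum over its mean \<open>Suc r\<close> and
  the tolerance \<open>th r\<close>. After the shift it is weighted by at most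
  \<open>(a r - a (Suc r)) / (D * a r)\<close>, so \<open>D \<ge> S / eta\<close> brings the total
  excess below \<open>eta\<close>.\<close>

lemma shifted_trace_bound:
  fixes z th :: "nat \<Rightarrow> real" and D eta :: real
  defines "W \<equiv> \<lambda>r. max 0 ((\<Sum>i\<le>r. z i) - real (Suc r) - th r)"
  assumes D: "D \<ge> 0" "D \<ge> (\<Sum>r<n. (a r - a (Suc r)) / a r * W r) / eta" and eta: "eta > 0"
    and th: "\<And>r. r < n \<Longrightarrow> th r \<ge> 0"
  shows "(\<Sum>i<n. a i / (1 + D * a i) * z i) \<le> (\<Sum>i<n. a i) + (\<Sum>r<n. (a r - a (Suc r)) * th r) + eta"
proof -
  define b where "b = (\<lambda>i. a i / (1 + D * a i))"
  have b: "b (Suc r) \<le> b r" "b r - b (Suc r) \<le> a r - a (Suc r)"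
    "D * (b r - b (Suc r)) \<le> (a r - a (Suc r)) / a r" if "r < n" for r
    using shrink_difference[OF D(1) that] by (simp_all add: b_def)
  have bn: "b n = 0" by (simp add: b_def zero)
  have W: "W r \<ge> 0" for r by (simp add: W_def)
  define S where "S = (\<Sum>r<n. (a r - a (Suc r)) / a r * W r)"
  have terms: "(a r - a (Suc r)) / a r * W r \<ge> 0" if "r < n" for r
    using W[of r] decreasing[OF that] pos[OF that] by simp
  have "(\<Sum>i<n. b i * z i) = (\<Sum>r<n. (b r - b (Suc r)) * (\<Sum>i\<le>r. z i))"
    by (rule sum_by_parts_0[of b, OF bn])
  also have "\<dots> \<le> (\<Sum>r<n. (b r - b (Suc r)) * (real (Suc r) + th r + W r))"
    using b(1) by (intro sum_mono mult_left_mono) (auto simp: W_def)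
  also have "\<dots> = (\<Sum>r<n. (b r - b (Suc r)) * real (Suc r)) + (\<Sum>r<n. (b r - b (Suc r)) * th r)
      + (\<Sum>r<n. (b r - b (Suc r)) * W r)"
    by (simp add: sum.distrib[symmetric] algebra_simps)
  also have "(\<Sum>r<n. (b r - b (Suc r)) * real (Suc r)) = (\<Sum>i<n. b i)"
    by (rule sum_by_parts_1[of b, OF bn])
  also have "(\<Sum>i<n. b i) \<le> (\<Sum>i<n. a i)"
  proof (intro sum_mono)
    fix i assume "i \<in> {..<n}"
    then have "a i > 0" using pos by auto
    moreover have "1 + D * a i \<ge> 1" using D(1) \<open>a i > 0\<close> by simp
    ultimately have "a i / (1 + D * a i) \<le> a i / 1" by (intro divide_left_mono) auto
    then show "b i \<le> a i" by (simp add: b_def)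
  qed
  also have "(\<Sum>r<n. (b r - b (Suc r)) * th r) \<le> (\<Sum>r<n. (a r - a (Suc r)) * th r)"
    using b(2) th by (intro sum_mono mult_right_mono) auto
  also have "(\<Sum>r<n. (b r - b (Suc r)) * W r) \<le> eta"
  \<comment> \<open>Without a shift nothing is divided by \<open>D\<close>; but then
    \<open>S = 0\<close>, so every excess with a positive coefficient vanishes already.\<close>
  proof (cases "D = 0")
    case True
    then have "S / eta \<le> 0" using D(2) by (simp add: S_def)
    then have "S \<le> 0" using eta by (simp add: divide_le_0_iff)
    moreover have "S \<ge> 0" unfolding S_def using terms by (intro sum_nonneg) auto
    ultimately have "S = 0" by simp
    then have "\<forall>r<n. (a r - a (Suc r)) / a r * W r = 0"
      unfolding S_def using terms by (subst (asm) sum_nonneg_eq_0_iff) auto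
    then have "(\<Sum>r<n. (a r - a (Suc r)) * W r) = 0"
      using pos by (intro sum.neutral) fastforce
    moreover have "(\<Sum>r<n. (b r - b (Suc r)) * W r) \<le> (\<Sum>r<n. (a r - a (Suc r)) * W r)"
      using b(2) W by (intro sum_mono mult_right_mono) auto
    ultimately show ?thesis using eta by simp
  next
    case False
    then have Dpos: "D > 0" using D(1) by simp
    have "D * (\<Sum>r<n. (b r - b (Suc r)) * W r) = (\<Sum>r<n. D * (b r - b (Suc r)) * W r)"
      by (simp add: sum_distrib_left mult.assoc)
    also have "\<dots> \<le> S"
      unfolding S_def using b(3) W by (intro sum_mono mult_right_mono) auto
    also have "S \<le> D * eta" using D(2) eta by (simp add: S_def field_simps)
    finally show ?thesis using Dpos by simp
  qed
  finally show ?thesis by (simp add: b_def)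
qed

text \<open>A lower Riemann sum for the integral of \<open>s powr (-3/2)\<close>, with
  antiderivative \<open>-2 / sqrt s\<close>. The last increment, from \<open>a (n - 1)\<close> down
  to \<open>a n = 0\<close>, is handled separately and turns the 2 into a 3.\<close>

lemma sum_differences_three_halves:
  assumes L: "L > 0" "\<And>i. i < n \<Longrightarrow> L \<le> a i"
  shows "(\<Sum>r<n. (a r - a (Suc r)) / (a r * sqrt (a r))) \<le> 3 / sqrt L"
proof -
  have *: "(\<Sum>r<N. (a r - a (Suc r)) / (a r * sqrt (a r))) \<le> 2 / sqrt (a N) - 2 / sqrt (a 0)" if "N < n" for N
    using that
  proof (induction N)
    case (Suc N)
    define p q where "p = sqrt (a N)" and "q = sqrt (a (Suc N))"
    have pq: "p > 0" "q > 0" "q \<le> p" "a N = p * p" "a (Suc N) = q * q"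
      using Suc.prems pos[of N] pos[of "Suc N"] decreasing[of N] by (auto simp: p_def q_def)
    have "(p * p - q * q) * q \<le> 2 * (p - q) * (p * p)"
    proof -
      have "(p + q) * q \<le> 2 * (p * p)"
        using mult_mono[of "p + q" "2 * p" q p] pq by simp
      then have "(p - q) * ((p + q) * q) \<le> (p - q) * (2 * (p * p))"
        using pq by (intro mult_left_mono) auto
      then show ?thesis by (simp add: algebra_simps)
    qed
    then have "(p * p - q * q) * q / (p * p * p * q) \<le> 2 * (p - q) * (p * p) / (p * p * p * q)"
      using pq(1,2) by (intro divide_right_mono) auto
    moreover have "(p * p - q * q) * q / (p * p * p * q) = (p * p - q * q) / (p * p * p)"
      using pq(1,2) by simp
    moreover have "2 * (p - q) * (p * p) / (p * p * p * q) = 2 / q - 2 / p"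
      using pq(1,2) by (simp add: field_simps)
    ultimately have "(a N - a (Suc N)) / (a N * sqrt (a N)) \<le> 2 / q - 2 / p"
      unfolding p_def[symmetric] unfolding pq(4,5) by simp
    then show ?case using Suc by (simp add: p_def q_def)
  qed simp
  obtain N where N: "n = Suc N" using n_pos by (cases n) auto
  have aN: "a N > 0" using pos N by simp
  have "(\<Sum>r<n. (a r - a (Suc r)) / (a r * sqrt (a r))) \<le> 2 / sqrt (a N) - 2 / sqrt (a 0) + 1 / sqrt (a N)"
    using *[of N] N zero aN by simp
  also have "\<dots> \<le> 3 / sqrt (a N)" using pos[of 0] n_pos by simp
  also have "\<dots> \<le> 3 / sqrt L" using L(2)[of N] L(1) N by (intro divide_left_mono) auto
  finally show ?thesis .
qed

text \<open>
  If \<open>kap * q * s \<le> eps\<close>, shifting by \<open>kap * q\<close> hardly changes the weights; otherwise the shift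
  exceeds \<open>2 / (c * s)\<close> and the claim follows from the trace bound alone.
\<close>
lemma shift_dominates_square_sum:
  fixes z :: "nat \<Rightarrow> real" and D c eps kap T s :: real
  defines "b \<equiv> \<lambda>i. a i / (1 + D * a i)" and "q \<equiv> (\<Sum>i<n. (a i)\<^sup>2 * z i) / s\<^sup>2"
  assumes z: "\<And>i. i < n \<Longrightarrow> z i \<ge> 0" and s: "s > 0" "s\<^sup>2 = (\<Sum>i<n. (a i)\<^sup>2)"
    and c: "c > 0" "c \<le> 1" and eps: "eps > 0" and kap: "kap = (1 + eps) / c"
    and T: "2 * T * kap * s \<le> eps"
    and D: "D \<ge> kap * q + 4 * kap / (c * eps) * max 0 (q - T)"
    and trace: "(\<Sum>i<n. b i * z i) \<le> 1"
  shows "(\<Sum>i<n. (b i)\<^sup>2 * z i) \<le> c * (D * (\<Sum>i<n. a i * b i))"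
proof -
  have kap0: "kap > 0" using c eps by (simp add: kap)
  have q0: "q \<ge> 0" unfolding q_def using z by (intro divide_nonneg_nonneg sum_nonneg) auto
  have rest: "4 * kap / (c * eps) * max 0 (q - T) \<ge> 0" using kap0 c eps by simp
  have D0: "D \<ge> kap * q" "D \<ge> 0"
    using D rest mult_nonneg_nonneg[of kap q] kap0 q0 by linarith+
  have as: "a i \<le> s" if "i < n" for i
  proof -
    have "(a i)\<^sup>2 \<le> (\<Sum>i<n. (a i)\<^sup>2)" using that by (intro member_le_sum) auto
    then show ?thesis using s(1) unfolding s(2)[symmetric] by (rule power2_le_imp_le[OF _ less_imp_le])
  qed
  have b: "0 \<le> b i" "b i \<le> a i" "D * b i \<le> 1" "1 + D * a i > 0" if "i < n" for i
  proof -
    have pp: "1 + D * a i \<ge> 1" using D0(2) pos[OF that] by simp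
    then show "1 + D * a i > 0" by simp
    show "0 \<le> b i" using pp pos[OF that] by (simp add: b_def)
    have "a i / (1 + D * a i) \<le> a i / 1" using pp pos[OF that] by (intro divide_left_mono) auto
    then show "b i \<le> a i" by (simp add: b_def)
    show "D * b i \<le> 1" using pp by (simp add: b_def)
  qed
  show ?thesis
  proof (cases "kap * q * s \<le> eps")
    case True
    have "(\<Sum>i<n. (b i)\<^sup>2 * z i) \<le> (\<Sum>i<n. (a i)\<^sup>2 * z i)"
      using b z by (intro sum_mono mult_right_mono power_mono) auto
    also have "\<dots> = q * s\<^sup>2" using s(1) by (simp add: q_def)
    also have "\<dots> = c * (kap * q / (1 + eps) * s\<^sup>2)" using c eps by (simp add: kap)
    also have "kap * q / (1 + eps) * s\<^sup>2 = (\<Sum>i<n. kap * q / (1 + eps) * (a i)\<^sup>2)"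
      unfolding s(2) by (rule sum_distrib_left)
    also have "\<dots> \<le> (\<Sum>i<n. D * (a i * b i))"
    proof (intro sum_mono)
      fix i assume "i \<in> {..<n}"
      then have i: "i < n" by simp
      \<comment> \<open>Since \<open>D \<ge> kap * q\<close>, the shifted weight loses at most a
        factor \<open>1 + eps\<close> against \<open>kap * q\<close>; the same factor was put into
        \<open>kap\<close>.\<close>
      have "kap * q * a i \<le> eps"
        using mult_left_mono[OF as[OF i] mult_nonneg_nonneg[OF less_imp_le[OF kap0] q0]] True by linarith
      then have "kap * q * (1 + D * a i) \<le> D * (1 + eps)"
        using D0 mult_left_mono[of "kap * q * a i" eps D] by (simp add: algebra_simps)
      then have "kap * q / (1 + eps) \<le> D / (1 + D * a i)"
        using b(4)[OF i] eps by (simp add: field_simps)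
      then have "kap * q / (1 + eps) * (a i)\<^sup>2 \<le> D / (1 + D * a i) * (a i)\<^sup>2"
        by (rule mult_right_mono) simp
      then show "kap * q / (1 + eps) * (a i)\<^sup>2 \<le> D * (a i * b i)"
        by (simp add: b_def power2_eq_square)
    qed
    also have "\<dots> = D * (\<Sum>i<n. a i * b i)" by (rule sum_distrib_left[symmetric])
    finally show ?thesis using c by simp
  next
    case False
    then have q: "kap * q * s > eps" by simp
    have "2 * T * (kap * s) < q * (kap * s)" using q T by (simp add: mult_ac)
    then have qT: "2 * T < q" using kap0 s(1) by (simp add: mult_less_cancel_right)
    \<comment> \<open>Here \<open>q > 2 * T\<close>, so the excess term of \<open>D\<close> is at
      least \<open>2 * kap * q / (c * eps)\<close>, and \<open>kap * q * s > eps\<close> makes this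
      at least \<open>2 / (c * s)\<close>. The coefficient \<open>4 * kap / (c * eps)\<close> is
      designed for this case.\<close>
    have "2 / (c * s) \<le> 4 * kap / (c * eps) * (q / 2)"
      using q c eps s(1) by (simp add: field_simps)
    also have "\<dots> \<le> 4 * kap / (c * eps) * max 0 (q - T)"
    proof (intro mult_left_mono)
      show "q / 2 \<le> max 0 (q - T)" using qT by (simp add: max_def field_simps)
    qed (use kap0 c eps in simp)
    also have "\<dots> \<le> D" using D mult_nonneg_nonneg[of kap q] kap0 q0 by linarith
    finally have Dbig: "2 / (c * s) \<le> D" .
    then have Ds: "2 \<le> c * (D * s)" using c s(1) by (simp add: field_simps)
    have Dpos: "D > 0" using Dbig c s(1) by (smt (verit) divide_pos_pos mult_pos_pos)
    have "D * (\<Sum>i<n. (b i)\<^sup>2 * z i) = (\<Sum>i<n. D * b i * (b i * z i))"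
      by (simp add: sum_distrib_left power2_eq_square mult_ac)
    also have "\<dots> \<le> (\<Sum>i<n. 1 * (b i * z i))"
      using b z by (intro sum_mono mult_right_mono) auto
    also have "\<dots> \<le> 1" using trace by simp
    finally have 1: "D * (\<Sum>i<n. (b i)\<^sup>2 * z i) \<le> 1" .
    \<comment> \<open>The left side of the claim times \<open>D\<close> is at most 1 by the trace
      bound. The right side times \<open>D\<close> is at least
      \<open>c * (D * s)^2 / (1 + D * s)\<close>, and \<open>D * s \<ge> 2\<close> and
      \<open>c * (D * s) \<ge> 2\<close> put that above 1.\<close>
    have "1 + D * s \<le> c * (D * s) * (D * s)"
    proof -
      have "c * (D * s) \<le> 1 * (D * s)"
        using c Dpos s(1) by (intro mult_right_mono) auto
      then have "2 \<le> D * s" using Ds by linarith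
      moreover have "2 * (D * s) \<le> c * (D * s) * (D * s)"
        using Ds Dpos s(1) by (intro mult_right_mono) auto
      ultimately show ?thesis by linarith
    qed
    then have "1 \<le> c * (D * s) * (D * s) / (1 + D * s)"
      using Dpos s(1) by (simp add: add_pos_pos)
    also have "\<dots> = D * (c * (D * (s\<^sup>2 / (1 + D * s))))"
      by (simp add: power2_eq_square)
    also have "s\<^sup>2 / (1 + D * s) = (\<Sum>i<n. (a i)\<^sup>2 / (1 + D * s))"
      unfolding s(2) by (rule sum_divide_distrib)
    also have "D * (c * (D * (\<Sum>i<n. (a i)\<^sup>2 / (1 + D * s)))) \<le> D * (c * (D * (\<Sum>i<n. a i * b i)))"
    proof (intro mult_left_mono sum_mono)
      fix i assume "i \<in> {..<n}"
      then have i: "i < n" by simp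
      have "1 + D * a i \<le> 1 + D * s" using as[OF i] Dpos by simp
      then have "(a i)\<^sup>2 / (1 + D * s) \<le> (a i)\<^sup>2 / (1 + D * a i)"
        using b(4)[OF i] by (intro divide_left_mono) auto
      then show "(a i)\<^sup>2 / (1 + D * s) \<le> a i * b i"
        by (simp add: b_def power2_eq_square)
    qed (use Dpos c in auto)
    finally have "D * (\<Sum>i<n. (b i)\<^sup>2 * z i) \<le> D * (c * (D * (\<Sum>i<n. a i * b i)))"
      using 1 by linarith
    then show ?thesis using Dpos by simp
  qed
qed

text \<open>The numbers \<open>(a i)^2 / s^2\<close> are decreasing probability weights, so
  summation by parts distributes \<open>T\<close> over the ranks as \<open>T * Suc r\<close>;
  replacing each summand by its positive part only increases the sum.\<close>

lemma weighted_excess_le: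
  fixes z :: "nat \<Rightarrow> real"
  assumes s: "s > 0" "s\<^sup>2 = (\<Sum>i<n. (a i)\<^sup>2)"
  shows "max 0 ((\<Sum>i<n. (a i)\<^sup>2 * z i) / s\<^sup>2 - T)
    \<le> (\<Sum>r<n. ((a r)\<^sup>2 - (a (Suc r))\<^sup>2) / s\<^sup>2 * max 0 ((\<Sum>i\<le>r. z i) - T * real (Suc r)))"
proof -
  define p where "p = (\<lambda>r. (a r)\<^sup>2 / s\<^sup>2)"
  have pn: "p n = 0" by (simp add: p_def zero)
  have p: "p r - p (Suc r) \<ge> 0" if "r < n" for r
    using decreasing[OF that] nonneg[of "Suc r"] that
    by (auto simp: p_def divide_simps intro!: power_mono)
  have "(\<Sum>i<n. p i) = 1"
    unfolding p_def sum_divide_distrib[symmetric] s(2)[symmetric] using s(1) by simp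
  then have T: "T = (\<Sum>r<n. (p r - p (Suc r)) * (T * real (Suc r)))"
    using sum_by_parts_1[of p n, OF pn] by (simp add: sum_distrib_left[symmetric] mult.left_commute)
  have "(\<Sum>i<n. (a i)\<^sup>2 * z i) / s\<^sup>2 = (\<Sum>i<n. p i * z i)"
    by (simp add: p_def sum_divide_distrib)
  also have "\<dots> = (\<Sum>r<n. (p r - p (Suc r)) * (\<Sum>i\<le>r. z i))"
    by (rule sum_by_parts_0[of p, OF pn])
  finally have "(\<Sum>i<n. (a i)\<^sup>2 * z i) / s\<^sup>2 - T
    = (\<Sum>r<n. (p r - p (Suc r)) * ((\<Sum>i\<le>r. z i) - T * real (Suc r)))"
    by (subst T) (simp add: sum_subtractf[symmetric] right_diff_distrib)
  also have "\<dots> \<le> (\<Sum>r<n. (p r - p (Suc r)) * max 0 ((\<Sum>i\<le>r. z i) - T * real (Suc r)))"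
    using p by (intro sum_mono mult_left_mono) auto
  finally have "(\<Sum>i<n. (a i)\<^sup>2 * z i) / s\<^sup>2 - T \<le> \<dots>" .
  moreover have "0 \<le> (\<Sum>r<n. (p r - p (Suc r)) * max 0 ((\<Sum>i\<le>r. z i) - T * real (Suc r)))"
    using p by (intro sum_nonneg mult_nonneg_nonneg) auto
  ultimately show ?thesis by (simp add: p_def diff_divide_distrib)
qed

end

section \<open>Isotropic random vectors\<close>

text \<open>Dyadic layers: if \<open>2 ^ K * t\<close> is the first level above \<open>Z\<close>,
  then \<open>Z - t\<close> is at most the sum \<open>(2 ^ K - 1) * t\<close> of the levels reached.
  Level \<open>k\<close> contributes at most \<open>B / t * (1 / 2) ^ k\<close> to the mean.\<close>

lemma (in prob_space) nn_integral_excess_le: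
  fixes Z :: "'a \<Rightarrow> real"
  assumes Z[measurable]: "Z \<in> borel_measurable M" and t: "t > 0" and B: "B \<ge> 0"
    and tail: "\<And>s. s \<ge> t \<Longrightarrow> prob {\<omega> \<in> space M. Z \<omega> \<ge> s} \<le> B / s\<^sup>2"
  shows "(\<integral>\<^sup>+\<omega>. ennreal (max 0 (Z \<omega> - t)) \<partial>M) \<le> ennreal (2 * B / t)"
proof -
  let ?E = "\<lambda>k. {\<omega> \<in> space M. Z \<omega> \<ge> 2 ^ k * t}"
  have "(\<integral>\<^sup>+\<omega>. ennreal (max 0 (Z \<omega> - t)) \<partial>M)
      \<le> (\<integral>\<^sup>+\<omega>. (\<Sum>k. ennreal (2 ^ k * t) * indicator (?E k) \<omega>) \<partial>M)"
  proof (rule nn_integral_mono)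
    fix \<omega> assume \<omega>: "\<omega> \<in> space M"
    show "ennreal (max 0 (Z \<omega> - t)) \<le> (\<Sum>k. ennreal (2 ^ k * t) * indicator (?E k) \<omega>)"
    proof (cases "Z \<omega> \<ge> t")
      case False
      then have "max 0 (Z \<omega> - t) = 0" by simp
      then show ?thesis by simp
    next
      case True
      have "\<exists>k. Z \<omega> / t < 2 ^ k" by (rule real_arch_pow) simp
      then have ex: "\<exists>k. Z \<omega> < 2 ^ k * t" using t by (simp add: pos_divide_less_eq)
      define K where "K = (LEAST k. Z \<omega> < 2 ^ k * t)"
      have K: "Z \<omega> < 2 ^ K * t" unfolding K_def using ex by (rule LeastI_ex)
      have below: "2 ^ k * t \<le> Z \<omega>" if "k < K" for k
        using not_less_Least[of k "\<lambda>k. Z \<omega> < 2 ^ k * t"] that unfolding K_def by (simp add: not_less)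
      have "(\<Sum>k<K. 2 ^ k * t) = (2 ^ K - 1) * t"
        by (simp add: sum_distrib_right[symmetric] sum_gp_strict)
      then have "Z \<omega> - t \<le> (\<Sum>k<K. 2 ^ k * t)" using K by (simp add: algebra_simps)
      then have "ennreal (max 0 (Z \<omega> - t)) \<le> ennreal (\<Sum>k<K. 2 ^ k * t)"
        using True by (intro ennreal_leI) simp
      also have "\<dots> = (\<Sum>k<K. ennreal (2 ^ k * t) * indicator (?E k) \<omega>)"
        using t below \<omega> by (subst sum_ennreal[symmetric]) (auto intro!: sum.cong)
      also have "\<dots> \<le> (\<Sum>k. ennreal (2 ^ k * t) * indicator (?E k) \<omega>)"
        by (intro sum_le_suminf) auto
      finally show ?thesis .
    qed
  qed
  also have "\<dots> = (\<Sum>k. \<integral>\<^sup>+\<omega>. ennreal (2 ^ k * t) * indicator (?E k) \<omega> \<partial>M)"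
    by (intro nn_integral_suminf) measurable
  also have "\<dots> = (\<Sum>k. ennreal (2 ^ k * t * prob (?E k)))"
    using t by (intro suminf_cong) (simp add: nn_integral_cmult_indicator emeasure_eq_measure ennreal_mult)
  also have "\<dots> \<le> (\<Sum>k. ennreal (B / t * (1 / 2) ^ k))"
  proof (intro suminf_le ennreal_leI)
    fix k :: nat
    have "2 ^ k * t \<ge> t" using t by simp
    from tail[OF this] have "2 ^ k * t * prob (?E k) \<le> 2 ^ k * t * (B / (2 ^ k * t)\<^sup>2)"
      using t by (intro mult_left_mono) auto
    also have "\<dots> = B / t * (1 / 2) ^ k"
      using t by (simp add: power2_eq_square power_one_over)
    finally show "2 ^ k * t * prob (?E k) \<le> B / t * (1 / 2) ^ k" .
  qed auto
  also have "\<dots> = ennreal (B / t * 2)"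
  proof (rule suminf_ennreal_eq)
    show "(\<lambda>k. B / t * (1 / 2) ^ k) sums (B / t * 2)"
      using sums_mult[OF geometric_sums[of "1/2 :: real"], of "B / t"] by simp
  qed (use B t in auto)
  finally show ?thesis by (simp add: mult.commute)
qed

lemma nn_integral_lincomb_le:
  fixes W :: "'i \<Rightarrow> 'a \<Rightarrow> real"
  assumes "finite I" "\<And>i. i \<in> I \<Longrightarrow> W i \<in> borel_measurable M" "\<And>i. i \<in> I \<Longrightarrow> c i \<ge> 0"
    "\<And>i \<omega>. i \<in> I \<Longrightarrow> W i \<omega> \<ge> 0" "\<And>i. i \<in> I \<Longrightarrow> w i \<ge> 0"
    "\<And>i. i \<in> I \<Longrightarrow> (\<integral>\<^sup>+\<omega>. ennreal (W i \<omega>) \<partial>M) \<le> ennreal (w i)"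
  shows "(\<integral>\<^sup>+\<omega>. ennreal (\<Sum>i\<in>I. c i * W i \<omega>) \<partial>M) \<le> ennreal (\<Sum>i\<in>I. c i * w i)"
proof -
  have "(\<integral>\<^sup>+\<omega>. ennreal (\<Sum>i\<in>I. c i * W i \<omega>) \<partial>M) = (\<integral>\<^sup>+\<omega>. (\<Sum>i\<in>I. ennreal (c i) * ennreal (W i \<omega>)) \<partial>M)"
    using assms by (intro nn_integral_cong) (simp add: ennreal_mult[symmetric] sum_ennreal)
  also have "\<dots> = (\<Sum>i\<in>I. ennreal (c i) * (\<integral>\<^sup>+\<omega>. ennreal (W i \<omega>) \<partial>M))"
    using assms by (subst nn_integral_sum) (auto intro!: sum.cong nn_integral_cmult)
  also have "\<dots> \<le> (\<Sum>i\<in>I. ennreal (c i) * ennreal (w i))"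
    using assms by (intro sum_mono mult_left_mono) auto
  also have "\<dots> = ennreal (\<Sum>i\<in>I. c i * w i)"
    using assms by (simp add: ennreal_mult[symmetric] sum_ennreal)
  finally show ?thesis .
qed

text \<open>Projections appear only as spans of the first \<open>r\<close> vectors of an orthonormal
  basis, the form in which they arise from an eigenbasis; \<open>t > 0\<close> leaves out the case
  without condition.\<close>

locale isotropic = prob_space M for M :: "'a measure" +
  fixes n :: nat and x :: "'a \<Rightarrow> nat \<Rightarrow> real" and f g :: "nat \<Rightarrow> real"
  assumes coord_measurable: "\<And>i. i < n \<Longrightarrow> (\<lambda>\<omega>. x \<omega> i) \<in> borel_measurable M"
    and covariance: "\<And>i j. i < n \<Longrightarrow> j < n \<Longrightarrow>
      has_bochner_integral M (\<lambda>\<omega>. x \<omega> i * x \<omega> j) (of_bool (i = j))"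
    and tail: "\<And>e r t. orthonormal n n e \<Longrightarrow> 1 \<le> r \<Longrightarrow> r \<le> n \<Longrightarrow> t \<ge> f r * real r \<Longrightarrow> t > 0 \<Longrightarrow>
      prob {\<omega> \<in> space M. (\<Sum>i<r. (ip n (e i) (x \<omega>))\<^sup>2) - real r \<ge> t} \<le> g r * real r / t\<^sup>2"
    and f_range: "\<And>r. 1 \<le> r \<Longrightarrow> 0 \<le> f r \<and> f r \<le> 1"
    and g_nonneg: "\<And>r. 1 \<le> r \<Longrightarrow> 0 \<le> g r"
begin

lemma ip_measurable [measurable]: "(\<lambda>\<omega>. ip n y (x \<omega>)) \<in> borel_measurable M"
  unfolding ip_def using coord_measurable by (intro borel_measurable_sum borel_measurable_times) auto

lemma nn_integral_coordinate_square:
  assumes "ip n y y = 1"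
  shows "(\<integral>\<^sup>+\<omega>. ennreal ((ip n y (x \<omega>))\<^sup>2) \<partial>M) = 1"
proof -
  have "has_bochner_integral M (\<lambda>\<omega>. \<Sum>k<n. \<Sum>l<n. y k * y l * (x \<omega> k * x \<omega> l))
      (\<Sum>k<n. \<Sum>l<n. y k * y l * of_bool (k = l))"
    using covariance by (intro has_bochner_integral_sum has_bochner_integral_mult_right) auto
  moreover have "(\<Sum>k<n. \<Sum>l<n. y k * y l * (x \<omega> k * x \<omega> l)) = (ip n y (x \<omega>))\<^sup>2" for \<omega>
    by (simp add: ip_def power2_eq_square sum_product mult_ac)
  moreover have "(\<Sum>k<n. \<Sum>l<n. y k * y l * of_bool (k = l)) = 1"
    using assms by (simp add: ip_def of_bool_def if_distrib[of "\<lambda>t. _ * t"] cong: if_cong)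
  ultimately have "has_bochner_integral M (\<lambda>\<omega>. (ip n y (x \<omega>))\<^sup>2) 1" by simp
  then show ?thesis
    by (subst nn_integral_eq_integral) (auto simp: has_bochner_integral_iff)
qed

lemma nn_integral_projection_excess:
  assumes e: "orthonormal n n e" and r: "r < n" and t: "t \<ge> f (Suc r) * real (Suc r)" "t > 0"
  shows "(\<integral>\<^sup>+\<omega>. ennreal (max 0 ((\<Sum>i\<le>r. (ip n (e i) (x \<omega>))\<^sup>2) - real (Suc r) - t)) \<partial>M)
    \<le> ennreal (2 * (g (Suc r) * real (Suc r)) / t)"
proof (rule nn_integral_excess_le)
  fix s assume "s \<ge> t"
  then show "prob {\<omega> \<in> space M. s \<le> (\<Sum>i\<le>r. (ip n (e i) (x \<omega>))\<^sup>2) - real (Suc r)}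
      \<le> g (Suc r) * real (Suc r) / s\<^sup>2"
    using tail[OF e, of "Suc r" s] r t by (simp add: lessThan_Suc_atMost)
qed (use t g_nonneg[of "Suc r"] in auto)

text \<open>
  The part of the threshold \<open>th\<close> proportional to \<open>a r powr (-3/2)\<close> is a compromise: the excess it
  leaves in the trace and the expected shift it causes are both controlled by
  \<open>sum_differences_three_halves\<close>.
\<close>
lemma trace_shift_exists:
  assumes e: "orthonormal n n e" and "weights n a"
    and f: "\<And>r. 1 \<le> r \<Longrightarrow> f r * real r \<le> R + eta * real r"
    and g: "\<And>r. 1 \<le> r \<Longrightarrow> g r * real r \<le> R2 + eta2 * real r"
    and eta: "eta > 0" "eta2 \<ge> 0" "R \<ge> 0" "R2 \<ge> 0"
    and H: "(\<Sum>i<n. (a i)\<^sup>2) \<le> H / real n" and L: "L > 0" "\<And>i. i < n \<Longrightarrow> L \<le> a i"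
  obtains D1 where "D1 \<in> borel_measurable M" "\<And>\<omega>. D1 \<omega> \<ge> 0"
    "(\<integral>\<^sup>+\<omega>. ennreal (D1 \<omega>) \<partial>M)
      \<le> ennreal (2 * sqrt n / eta\<^sup>2 * (R2 * (a 0 * sqrt (a 0)) + 3 * eta2 * H / (n * sqrt L)))"
    "\<And>\<omega> D. D \<ge> D1 \<omega> \<Longrightarrow> (\<Sum>i<n. a i / (1 + D * a i) * (ip n (e i) (x \<omega>))\<^sup>2)
      \<le> (\<Sum>i<n. a i) + (R * a 0 + eta * (\<Sum>i<n. a i) + 3 * eta / (sqrt n * sqrt L)) + eta"
proof -
  interpret weights n a by fact
  define z where "z = (\<lambda>\<omega> i. (ip n (e i) (x \<omega>))\<^sup>2)"
  \<comment> \<open>\<open>R\<close> pays for the finitely many small ranks and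
    \<open>eta * Suc r\<close> for the others, so that \<open>th r\<close> always lies in the range
    of the tail hypothesis at rank \<open>Suc r\<close>.\<close>
  define th where "th = (\<lambda>r. R + eta * real (Suc r) + eta / sqrt n * (1 / (a r * sqrt (a r))))"
  define W where "W = (\<lambda>r \<omega>. max 0 ((\<Sum>i\<le>r. z \<omega> i) - real (Suc r) - th r))"
  define S where "S = (\<lambda>\<omega>. \<Sum>r<n. (a r - a (Suc r)) / a r * W r \<omega>)"
  have [measurable]: "(\<lambda>\<omega>. z \<omega> i) \<in> borel_measurable M" for i unfolding z_def by measurable
  have [measurable]: "W r \<in> borel_measurable M" for r unfolding W_def by measurable
  have [measurable]: "S \<in> borel_measurable M" unfolding S_def by measurable
  have c: "(a r - a (Suc r)) / a r \<ge> 0" if "r < n" for r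
    using decreasing[OF that] pos[OF that] by simp
  have W: "W r \<omega> \<ge> 0" for r \<omega> by (simp add: W_def)
  have S: "S \<omega> \<ge> 0" for \<omega>
    unfolding S_def using c W by (intro sum_nonneg mult_nonneg_nonneg) auto
  have n0: "sqrt n > 0" using n_pos by simp
  have three: "(\<Sum>r<n. (a r - a (Suc r)) / (a r * sqrt (a r))) \<le> 3 / sqrt L"
    by (rule sum_differences_three_halves[OF L])
  have th_last: "th r \<ge> eta / sqrt n * (1 / (a r * sqrt (a r)))"
    "eta / sqrt n * (1 / (a r * sqrt (a r))) > 0" "th r \<ge> f (Suc r) * real (Suc r)" if "r < n" for r
  proof -
    show p: "eta / sqrt n * (1 / (a r * sqrt (a r))) > 0" using eta n0 pos[OF that] by simp
    have "eta * real (Suc r) \<ge> 0" using eta by simp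
    then show "th r \<ge> eta / sqrt n * (1 / (a r * sqrt (a r)))" using eta by (simp add: th_def)
    show "th r \<ge> f (Suc r) * real (Suc r)" using f[of "Suc r"] p unfolding th_def by linarith
  qed
  define w where "w = (\<lambda>r. 2 * (g (Suc r) * real (Suc r)) / th r)"
  have w: "w r \<ge> 0" if "r < n" for r
    using g_nonneg[of "Suc r"] th_last[OF that] by (simp add: w_def)
  have "(\<integral>\<^sup>+\<omega>. ennreal (S \<omega>) \<partial>M) \<le> ennreal (\<Sum>r<n. (a r - a (Suc r)) / a r * w r)"
    unfolding S_def
  proof (rule nn_integral_lincomb_le)
    fix r assume "r \<in> {..<n}"
    then have r: "r < n" by simp
    show "(\<integral>\<^sup>+\<omega>. ennreal (W r \<omega>) \<partial>M) \<le> ennreal (w r)"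
      unfolding W_def w_def z_def using th_last[OF r]
      by (intro nn_integral_projection_excess[OF e r]) auto
  qed (use c W w in auto)
  also have "\<dots> \<le> ennreal (2 * sqrt n / eta * (R2 * (a 0 * sqrt (a 0)) + 3 * eta2 * H / (n * sqrt L)))"
  proof (rule ennreal_leI)
    have "(\<Sum>r<n. (a r - a (Suc r)) / a r * w r)
        \<le> (\<Sum>r<n. 2 * sqrt n / eta * (R2 * ((a r - a (Suc r)) * sqrt (a 0))
            + eta2 * (H / n) * ((a r - a (Suc r)) / (a r * sqrt (a r)))))"
    proof (intro sum_mono)
      fix r assume "r \<in> {..<n}"
      then have r: "r < n" by simp
      define d where "d = a r - a (Suc r)"
      have ar: "a r > 0" using pos[OF r] .
      have d: "d \<ge> 0" using decreasing[OF r] by (simp add: d_def)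
      have "w r \<le> 2 * (R2 + eta2 * real (Suc r)) / th r"
        unfolding w_def using g[of "Suc r"] th_last[OF r] by (intro divide_right_mono) auto
      also have "\<dots> \<le> 2 * (R2 + eta2 * real (Suc r)) / (eta / sqrt n * (1 / (a r * sqrt (a r))))"
      proof (rule divide_left_mono)
        show "0 < th r * (eta / sqrt n * (1 / (a r * sqrt (a r))))"
          by (rule mult_pos_pos[OF order.strict_trans2[OF th_last(2,1)[OF r]] th_last(2)[OF r]])
      qed (use th_last(1)[OF r] eta in auto)
      also have "\<dots> = 2 * sqrt n / eta * (a r * (sqrt (a r) * (R2 + eta2 * real (Suc r))))"
        by (simp add: field_simps)
      finally have "d / a r * w r \<le> d / a r * (2 * sqrt n / eta * (a r * (sqrt (a r) * (R2 + eta2 * real (Suc r)))))"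
        using d ar by (intro mult_left_mono) auto
      also have "\<dots> = 2 * sqrt n / eta * (R2 * (d * sqrt (a r)) + eta2 * (real (Suc r)) * (d * sqrt (a r)))"
        using ar by (simp add: algebra_simps)
      also have "\<dots> \<le> 2 * sqrt n / eta * (R2 * (d * sqrt (a 0)) + eta2 * (H / n) * (d / (a r * sqrt (a r))))"
      proof (intro mult_left_mono add_mono)
        show "sqrt (a r) \<le> sqrt (a 0)" using antimono[of 0 r] r by simp
        \<comment> \<open>For decreasing weights a high rank forces a small weight. This trades the
          factor \<open>Suc r\<close> for \<open>1 / (a r)^2\<close> and produces the power
          3/2.\<close>
        have "real (Suc r) * (a r)\<^sup>2 \<le> H / n" using sum_squares_ge[OF r] H by simp
        then have "real (Suc r) \<le> (H / n) / (a r)\<^sup>2"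
          using pos_le_divide_eq[of "(a r)\<^sup>2" "real (Suc r)" "H / n"] ar by simp
        then have "eta2 * (real (Suc r)) * (d * sqrt (a r)) \<le> eta2 * ((H / n) / (a r)\<^sup>2) * (d * sqrt (a r))"
          using eta d ar by (intro mult_right_mono mult_left_mono) auto
        also have "\<dots> = eta2 * (H / n) * (d / (a r * sqrt (a r)))"
        proof -
          have "sqrt (a r) / (a r)\<^sup>2 = 1 / (a r * sqrt (a r))"
            using ar by (simp add: divide_simps power2_eq_square)
          then have "eta2 * (H / n) * d * (sqrt (a r) / (a r)\<^sup>2) = eta2 * (H / n) * d * (1 / (a r * sqrt (a r)))"
            by (rule arg_cong)
          then show ?thesis by simp
        qed
        finally show "eta2 * (real (Suc r)) * (d * sqrt (a r)) \<le> eta2 * (H / n) * (d / (a r * sqrt (a r)))" .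
      qed (use eta d n0 in auto)
      finally show "(a r - a (Suc r)) / a r * w r \<le> 2 * sqrt n / eta * (R2 * ((a r - a (Suc r)) * sqrt (a 0))
            + eta2 * (H / n) * ((a r - a (Suc r)) / (a r * sqrt (a r))))" by (simp add: d_def)
    qed
    also have "\<dots> = 2 * sqrt n / eta * (R2 * ((\<Sum>r<n. a r - a (Suc r)) * sqrt (a 0))
            + eta2 * (H / n) * (\<Sum>r<n. (a r - a (Suc r)) / (a r * sqrt (a r))))"
      by (simp only: sum_distrib_left[symmetric] sum_distrib_right[symmetric] sum.distrib)
    also have "\<dots> \<le> 2 * sqrt n / eta * (R2 * ((\<Sum>r<n. a r - a (Suc r)) * sqrt (a 0))
            + eta2 * (H / n) * (3 / sqrt L))"
    proof -
      have "H / n \<ge> 0" using order_trans[OF sum_nonneg H] by simp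
      from mult_nonneg_nonneg[OF eta(2) this] have "eta2 * (H / n) \<ge> 0" .
      from add_left_mono[OF mult_left_mono[OF three this]] show ?thesis
        by (rule mult_left_mono) (use eta n0 in simp)
    qed
    also have "\<dots> = 2 * sqrt n / eta * (R2 * (a 0 * sqrt (a 0)) + 3 * eta2 * H / (n * sqrt L))"
      by (simp add: sum_differences)
    finally show "(\<Sum>r<n. (a r - a (Suc r)) / a r * w r)
      \<le> 2 * sqrt n / eta * (R2 * (a 0 * sqrt (a 0)) + 3 * eta2 * H / (n * sqrt L))" .
  qed
  finally have ES: "(\<integral>\<^sup>+\<omega>. ennreal (S \<omega>) \<partial>M)
      \<le> ennreal (2 * sqrt n / eta * (R2 * (a 0 * sqrt (a 0)) + 3 * eta2 * H / (n * sqrt L)))" .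
  show ?thesis
  \<comment> \<open>The smallest shift that \<open>shifted_trace_bound\<close> accepts; dividing by
    \<open>eta\<close> once more yields the factor \<open>1 / eta^2\<close> in its mean.\<close>
  proof (rule that[of "\<lambda>\<omega>. S \<omega> / eta"])
    show "(\<lambda>\<omega>. S \<omega> / eta) \<in> borel_measurable M" by measurable
    show "S \<omega> / eta \<ge> 0" for \<omega> using S eta by simp
    have "(\<integral>\<^sup>+\<omega>. ennreal (S \<omega> / eta) \<partial>M) = (\<integral>\<^sup>+\<omega>. ennreal (1 / eta) * ennreal (S \<omega>) \<partial>M)"
      using S eta by (intro nn_integral_cong) (simp add: ennreal_mult[symmetric])
    also have "\<dots> = ennreal (1 / eta) * (\<integral>\<^sup>+\<omega>. ennreal (S \<omega>) \<partial>M)"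
      by (intro nn_integral_cmult) measurable
    also have "\<dots> \<le> ennreal (1 / eta) * ennreal (2 * sqrt n / eta * (R2 * (a 0 * sqrt (a 0)) + 3 * eta2 * H / (n * sqrt L)))"
      using ES by (rule mult_left_mono) simp
    also have "\<dots> = ennreal (2 * sqrt n / eta\<^sup>2 * (R2 * (a 0 * sqrt (a 0)) + 3 * eta2 * H / (n * sqrt L)))"
      using eta by (subst ennreal_mult'[symmetric]) (auto simp: power2_eq_square)
    finally show "(\<integral>\<^sup>+\<omega>. ennreal (S \<omega> / eta) \<partial>M)
      \<le> ennreal (2 * sqrt n / eta\<^sup>2 * (R2 * (a 0 * sqrt (a 0)) + 3 * eta2 * H / (n * sqrt L)))" .
    fix \<omega> D assume D: "D \<ge> S \<omega> / eta"
    have D0: "D \<ge> 0" using D S[of \<omega>] eta by (meson divide_nonneg_pos order_trans)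
    have "(\<Sum>i<n. a i / (1 + D * a i) * z \<omega> i)
        \<le> (\<Sum>i<n. a i) + (\<Sum>r<n. (a r - a (Suc r)) * th r) + eta"
    proof (rule shifted_trace_bound[OF D0 _ eta(1)])
      show "(\<Sum>r<n. (a r - a (Suc r)) / a r * max 0 ((\<Sum>i\<le>r. z \<omega> i) - real (Suc r) - th r)) / eta \<le> D"
        using D by (simp add: S_def W_def)
    qed (use th_last in fastforce)
    also have "(\<Sum>r<n. (a r - a (Suc r)) * th r) = (\<Sum>r<n. R * (a r - a (Suc r))
        + eta * ((a r - a (Suc r)) * real (Suc r)) + eta / sqrt n * ((a r - a (Suc r)) / (a r * sqrt (a r))))"
    proof (intro sum.cong refl)
      have "d * (R + eta * m + k * (1 / w)) = R * d + eta * (d * m) + k * (d / w)" for d m k w :: real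
        by (simp add: algebra_simps)
      then show "(a r - a (Suc r)) * th r = R * (a r - a (Suc r)) + eta * ((a r - a (Suc r)) * real (Suc r))
          + eta / sqrt n * ((a r - a (Suc r)) / (a r * sqrt (a r)))" for r
        unfolding th_def .
    qed
    also have "\<dots> = R * a 0 + eta * (\<Sum>i<n. a i) + eta / sqrt n * (\<Sum>r<n. (a r - a (Suc r)) / (a r * sqrt (a r)))"
      by (simp only: sum.distrib sum_distrib_left[symmetric] sum_differences sum_by_parts_1[of a n, OF zero])
    also have "eta / sqrt n * (\<Sum>r<n. (a r - a (Suc r)) / (a r * sqrt (a r))) \<le> eta / sqrt n * (3 / sqrt L)"
      using three eta n0 by (intro mult_left_mono) auto
    also have "eta / sqrt n * (3 / sqrt L) = 3 * eta / (sqrt n * sqrt L)" by simp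
    finally show "(\<Sum>i<n. a i / (1 + D * a i) * (ip n (e i) (x \<omega>))\<^sup>2)
      \<le> (\<Sum>i<n. a i) + (R * a 0 + eta * (\<Sum>i<n. a i) + 3 * eta / (sqrt n * sqrt L)) + eta"
      by (simp add: z_def)
  qed
qed

text \<open>\<open>q\<close> is an average of squared coordinates of mean 1, so its mean is at most
  1. Its excess over \<open>T\<close> is a mixture of excesses at level \<open>T * Suc r\<close>, a
  distance \<open>(T - 1) * Suc r\<close> above the mean; as \<open>f \<le> 1\<close> and
  \<open>T \<ge> 2\<close>, every rank is admissible there, and the gain comes from the size of
  \<open>T\<close>.\<close>

lemma nn_integral_square_shift:
  fixes e :: "nat \<Rightarrow> nat \<Rightarrow> real" and a :: "nat \<Rightarrow> real" and s :: real
  defines "q \<equiv> \<lambda>\<omega>. (\<Sum>i<n. (a i)\<^sup>2 * (ip n (e i) (x \<omega>))\<^sup>2) / s\<^sup>2"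
  assumes e: "orthonormal n n e" and "weights n a"
    and s: "s > 0" "s\<^sup>2 = (\<Sum>i<n. (a i)\<^sup>2)"
    and G: "\<And>r. 1 \<le> r \<Longrightarrow> g r \<le> G" and T: "T \<ge> 2" and k: "k1 \<ge> 0" "k2 \<ge> 0"
  shows "(\<lambda>\<omega>. k1 * q \<omega> + k2 * max 0 (q \<omega> - T)) \<in> borel_measurable M"
    and "(\<integral>\<^sup>+\<omega>. ennreal (k1 * q \<omega> + k2 * max 0 (q \<omega> - T)) \<partial>M) \<le> ennreal (k1 + k2 * (2 * G / (T - 1)))"
    and "q \<omega> \<ge> 0"
proof -
  interpret weights n a by fact
  have G0: "G \<ge> 0" using G[of 1] g_nonneg[of 1] by simp
  have q0: "q \<omega> \<ge> 0" for \<omega> by (simp add: q_def sum_nonneg)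
  then show "q \<omega> \<ge> 0" .
  have [measurable]: "q \<in> borel_measurable M" unfolding q_def by measurable
  show "(\<lambda>\<omega>. k1 * q \<omega> + k2 * max 0 (q \<omega> - T)) \<in> borel_measurable M" by measurable
  define V where "V = (\<lambda>r \<omega>. max 0 ((\<Sum>i\<le>r. (ip n (e i) (x \<omega>))\<^sup>2) - T * real (Suc r)))"
  have Vm: "V r \<in> borel_measurable M" for r unfolding V_def by measurable
  define p where "p = (\<lambda>r. ((a r)\<^sup>2 - (a (Suc r))\<^sup>2) / s\<^sup>2)"
  have p: "p r \<ge> 0" if "r < n" for r
    unfolding p_def using decreasing[OF that] nonneg[of "Suc r"] that by (simp add: power_mono)
  have Eq: "(\<integral>\<^sup>+\<omega>. ennreal (q \<omega>) \<partial>M) \<le> ennreal 1"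
  proof -
    have "(\<integral>\<^sup>+\<omega>. ennreal (\<Sum>i<n. (a i)\<^sup>2 / s\<^sup>2 * (ip n (e i) (x \<omega>))\<^sup>2) \<partial>M) \<le> ennreal (\<Sum>i<n. (a i)\<^sup>2 / s\<^sup>2 * 1)"
      using e by (intro nn_integral_lincomb_le)
        (auto simp: orthonormal_def nn_integral_coordinate_square)
    also have "(\<Sum>i<n. (a i)\<^sup>2 / s\<^sup>2 * 1) = 1"
      unfolding mult_1_right sum_divide_distrib[symmetric] s(2)[symmetric] using s(1) by simp
    finally show ?thesis by (simp add: q_def sum_divide_distrib)
  qed
  have Ex: "(\<integral>\<^sup>+\<omega>. ennreal (max 0 (q \<omega> - T)) \<partial>M) \<le> ennreal (2 * G / (T - 1))"
  proof -
    have "(\<integral>\<^sup>+\<omega>. ennreal (max 0 (q \<omega> - T)) \<partial>M) \<le> (\<integral>\<^sup>+\<omega>. ennreal (\<Sum>r<n. p r * V r \<omega>) \<partial>M)"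
      unfolding q_def V_def p_def by (intro nn_integral_mono ennreal_leI weighted_excess_le[OF s])
    also have "\<dots> \<le> ennreal (\<Sum>r<n. p r * (2 * G / (T - 1)))"
    proof (rule nn_integral_lincomb_le)
      fix r assume "r \<in> {..<n}"
      then have r: "r < n" by simp
      define t where "t = (T - 1) * real (Suc r)"
      have t: "t > 0" using T by (simp add: t_def)
      have "f (Suc r) * real (Suc r) \<le> t"
        unfolding t_def using f_range[of "Suc r"] T by (intro mult_right_mono) auto
      from nn_integral_projection_excess[OF e r this t]
      have "(\<integral>\<^sup>+\<omega>. ennreal (V r \<omega>) \<partial>M) \<le> ennreal (2 * (g (Suc r) * real (Suc r)) / t)"
        by (simp add: V_def t_def algebra_simps)
      also have "2 * (g (Suc r) * real (Suc r)) / t = 2 * g (Suc r) / (T - 1)"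
      proof -
        have "real (Suc r) > 0" by simp
        then show ?thesis unfolding t_def by simp
      qed
      also have "ennreal (2 * g (Suc r) / (T - 1)) \<le> ennreal (2 * G / (T - 1))"
        using G[of "Suc r"] T by (intro ennreal_leI divide_right_mono) auto
      finally show "(\<integral>\<^sup>+\<omega>. ennreal (V r \<omega>) \<partial>M) \<le> ennreal (2 * G / (T - 1))" .
    next
      show "0 \<le> 2 * G / (T - 1)" using G0 T by simp
    qed (use p Vm in \<open>auto simp: V_def\<close>)
    also have "(\<Sum>r<n. p r * (2 * G / (T - 1))) = (a 0)\<^sup>2 / s\<^sup>2 * (2 * G / (T - 1))"
    proof -
      have "(\<Sum>r<n. p r) = (\<Sum>r<n. (a r)\<^sup>2 - (a (Suc r))\<^sup>2) / s\<^sup>2"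
        by (simp add: p_def sum_divide_distrib)
      also have "\<dots> = (a 0)\<^sup>2 / s\<^sup>2"
        using sum_lessThan_telescope'[of "\<lambda>r. (a r)\<^sup>2" n] by (simp add: zero)
      finally show ?thesis by (simp only: sum_distrib_right[symmetric])
    qed
    also have "ennreal \<dots> \<le> ennreal (1 * (2 * G / (T - 1)))"
    proof (intro ennreal_leI mult_right_mono)
      have "(a 0)\<^sup>2 \<le> (\<Sum>i<n. (a i)\<^sup>2)" using n_pos by (intro member_le_sum) auto
      then show "(a 0)\<^sup>2 / s\<^sup>2 \<le> 1" unfolding s(2)[symmetric] using s(1) by simp
    qed (use G0 T in simp)
    finally show ?thesis by simp
  qed
  have "(\<integral>\<^sup>+\<omega>. ennreal (k1 * q \<omega> + k2 * max 0 (q \<omega> - T)) \<partial>M)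
    = (\<integral>\<^sup>+\<omega>. ennreal k1 * ennreal (q \<omega>) + ennreal k2 * ennreal (max 0 (q \<omega> - T)) \<partial>M)"
  proof (intro nn_integral_cong)
    have "ennreal (k1 * u + k2 * v) = ennreal k1 * ennreal u + ennreal k2 * ennreal v"
      if "u \<ge> 0" "v \<ge> 0" for u v
      using k that by (simp add: ennreal_mult)
    then show "ennreal (k1 * q \<omega> + k2 * max 0 (q \<omega> - T))
        = ennreal k1 * ennreal (q \<omega>) + ennreal k2 * ennreal (max 0 (q \<omega> - T))" for \<omega>
      using q0 by simp
  qed
  also have "\<dots> = ennreal k1 * (\<integral>\<^sup>+\<omega>. ennreal (q \<omega>) \<partial>M) + ennreal k2 * (\<integral>\<^sup>+\<omega>. ennreal (max 0 (q \<omega> - T)) \<partial>M)"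
    by (simp add: nn_integral_add nn_integral_cmult)
  also have "\<dots> \<le> ennreal k1 * ennreal 1 + ennreal k2 * ennreal (2 * G / (T - 1))"
    using Eq Ex by (intro add_mono mult_left_mono) auto
  also have "\<dots> = ennreal (k1 + k2 * (2 * G / (T - 1)))"
    using k G0 T by (simp add: ennreal_mult[symmetric])
  finally show "(\<integral>\<^sup>+\<omega>. ennreal (k1 * q \<omega> + k2 * max 0 (q \<omega> - T)) \<partial>M) \<le> ennreal (k1 + k2 * (2 * G / (T - 1)))" .
qed

end

section \<open>The random barrier shift\<close>

text \<open>\<open>H / n\<close> bounds the sum of squared weights: \<open>1 / eps\<close> comes
  from the regularisation, \<open>eps^2\<close> from the floor \<open>L\<close>. \<open>T\<close> is
  such that \<open>2 * T * kap * s \<le> eps\<close> follows from \<open>kap \<le> 2 / c0\<close>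
  and \<open>s \<le> 1 / sqrt (eps * n)\<close>. The mean shift consists of
  \<open>kap = (1 + eps) / c\<close>, of \<open>eps / 2\<close> for the trace and of
  \<open>eps / 2\<close> for the excess of \<open>q\<close>. Only \<open>D\<close> depends on the
  sample; \<open>v\<close> and \<open>p'\<close> do not.\<close>

lemma (in isotropic) barrier_step:
  fixes eps eta eta2 R R2 G c0 phi u p :: real
  defines "H \<equiv> 1 / eps + eps\<^sup>2" and "L \<equiv> eps / (4 * real n)" and "T \<equiv> eps * sqrt eps * c0 / 4 * sqrt n"
    and "c \<equiv> 1 - phi - eps"
  assumes n: "n \<ge> 1" and A: "symf n A" "pot_le n A u p" "p \<le> phi"
    and eps: "0 < eps" "eps \<le> 1" and c0: "0 < c0" "c0 \<le> c"
    and f: "\<And>r. 1 \<le> r \<Longrightarrow> f r * real r \<le> R + eta * real r"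
    and g: "\<And>r. 1 \<le> r \<Longrightarrow> g r * real r \<le> R2 + eta2 * real r"
    and G: "\<And>r. 1 \<le> r \<Longrightarrow> g r \<le> G"
    and eta: "eta > 0" "eta2 \<ge> 0" "R \<ge> 0" "R2 \<ge> 0" "eta * (2 + 6 / sqrt eps) \<le> eps / 2"
    and large: "R * sqrt (H / n) \<le> eps / 4" "T \<ge> 2" "8 / (c0\<^sup>2 * eps) * (2 * G / (T - 1)) \<le> eps / 2"
      "2 * sqrt n / eta\<^sup>2 * (R2 * (sqrt (H / n) * sqrt (sqrt (H / n))) + 3 * eta2 * H / (n * sqrt L)) \<le> eps / 2"
  shows "\<exists>v p' D. v \<ge> u \<and> 0 \<le> p' \<and> p' \<le> p \<and> v + eps * n * p' \<le> u + eps * n * p \<and>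
    D \<in> borel_measurable M \<and> (\<forall>\<omega>. D \<omega> \<ge> 0) \<and> (\<integral>\<^sup>+\<omega>. ennreal (D \<omega>) \<partial>M) \<le> ennreal ((1 + eps) / c + eps) \<and>
    (\<forall>\<omega>. pot_le n (add_sq A (x \<omega>)) (v + D \<omega>) p')"
proof -
  obtain e lam where "eigensystem n A e lam" by (rule eigensystem_exists[OF A(1)])
  then interpret eigensystem n A e lam .
  have n0: "real n > 0" "sqrt n > 0" using n by auto
  have "eps * n > 0" using eps n0 by simp
  from barrier_regularise[OF A(2) this] obtain v where v: "v \<ge> u" "\<And>i. i < n \<Longrightarrow> lam i < v"
    "v + eps * n * (\<Sum>i<n. 1 / (v - lam i)) \<le> u + eps * n * p" "(\<Sum>i<n. 1 / (v - lam i)) \<le> p"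
    "eps * n * (\<Sum>i<n. (1 / (v - lam i))\<^sup>2) \<le> 1" by blast
  define a where "a = (\<lambda>i. if i < n then 1 / (v - lam i) else 0)"
  \<comment> \<open>Eigenvalues far below the barrier have tiny weights, but the trace estimate
    costs \<open>1 / sqrt L\<close> in the smallest weight. Raising the weights to \<open>L\<close>
    adds at most \<open>n * L = eps / 4\<close> to the trace. The second-order estimate keeps the
    true weights \<open>a\<close>.\<close>
  define a' where "a' = (\<lambda>i. if i < n then max (a i) L else 0)"
  define p' where "p' = (\<Sum>i<n. a i)"
  have L0: "L > 0" using eps n0 by (simp add: L_def)
  have H0: "H > 0" using eps by (simp add: H_def add_pos_pos)
  have p'_eq: "p' = (\<Sum>i<n. 1 / (v - lam i))" by (simp add: p'_def a_def)
  have sq_eq: "(\<Sum>i<n. (a i)\<^sup>2) = (\<Sum>i<n. (1 / (v - lam i))\<^sup>2)" by (simp add: a_def)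
  have wa: "weights n a"
  proof
    fix r assume r: "r < n"
    show "0 < a r" using v(2)[OF r] r by (simp add: a_def)
    show "a (Suc r) \<le> a r"
    proof (cases "Suc r < n")
      case True
      have "lam (Suc r) \<le> lam r" using sorted[of r "Suc r"] True by simp
      then show ?thesis using True v(2)[OF r] v(2)[OF True] r by (auto simp: a_def intro!: divide_left_mono)
    next
      case False
      then show ?thesis using v(2)[OF r] r by (simp add: a_def)
    qed
  qed (use n in \<open>auto simp: a_def\<close>)
  interpret a: weights n a by fact
  have wa': "weights n a'"
  proof
    fix r assume r: "r < n"
    show "0 < a' r" using a.pos[OF r] r by (simp add: a'_def)
    show "a' (Suc r) \<le> a' r" using a.decreasing[OF r] L0 r by (auto simp: a'_def)
  qed (use n in \<open>auto simp: a'_def\<close>)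
  interpret a': weights n a' by fact
  have nL: "n * L = eps / 4" using n0 by (simp add: L_def)
  have p'0: "p' \<ge> 0" unfolding p'_def using a.pos by (intro sum_nonneg) (auto simp: less_imp_le)
  have p'phi: "p' \<le> phi" using v(4) A(3) by (simp add: p'_eq)
  have sum_a': "(\<Sum>i<n. a' i) \<le> phi + eps / 4"
  proof -
    have "(\<Sum>i<n. a' i) \<le> (\<Sum>i<n. a i + L)"
      using a.pos L0 by (intro sum_mono) (auto simp: a'_def intro: less_imp_le)
    also have "\<dots> = p' + eps / 4" by (simp add: sum.distrib p'_def nL)
    finally show ?thesis using p'phi by simp
  qed
  have sq_a: "(\<Sum>i<n. (a i)\<^sup>2) \<le> 1 / (eps * n)"
    using v(5) eps n0 unfolding sq_eq by (simp add: pos_le_divide_eq mult.commute)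
  have sq_a': "(\<Sum>i<n. (a' i)\<^sup>2) \<le> H / n"
  proof -
    have "(\<Sum>i<n. (a' i)\<^sup>2) \<le> (\<Sum>i<n. (a i)\<^sup>2 + L\<^sup>2)"
      by (intro sum_mono) (auto simp: a'_def max_def)
    also have "\<dots> = (\<Sum>i<n. (a i)\<^sup>2) + n * L\<^sup>2" by (simp add: sum.distrib)
    also have "\<dots> \<le> 1 / (eps * n) + eps\<^sup>2 / n"
    proof (rule add_mono[OF sq_a])
      have "n * L\<^sup>2 = eps / 4 * L" by (simp add: power2_eq_square mult.assoc[symmetric] nL)
      also have "\<dots> \<le> eps\<^sup>2 / n" using eps n0 by (simp add: L_def power2_eq_square divide_simps)
      finally show "n * L\<^sup>2 \<le> eps\<^sup>2 / n" .
    qed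
    also have "\<dots> = H / n" by (simp add: H_def add_divide_distrib)
    finally show ?thesis .
  qed
  have a'0: "a' 0 \<le> sqrt (H / n)" "a' 0 \<ge> 0"
  proof -
    have "(a' 0)\<^sup>2 \<le> (\<Sum>i<n. (a' i)\<^sup>2)" using n by (intro member_le_sum) auto
    then show "a' 0 \<le> sqrt (H / n)" using sq_a' by (intro real_le_rsqrt) simp
    show "a' 0 \<ge> 0" using a'.pos[of 0] n by simp
  qed
  from trace_shift_exists[OF orthonormal wa' f g eta(1-4) sq_a' L0]
  obtain D1 where D1: "D1 \<in> borel_measurable M" "\<And>\<omega>. D1 \<omega> \<ge> 0"
    "(\<integral>\<^sup>+\<omega>. ennreal (D1 \<omega>) \<partial>M)
      \<le> ennreal (2 * sqrt n / eta\<^sup>2 * (R2 * (a' 0 * sqrt (a' 0)) + 3 * eta2 * H / (n * sqrt L)))"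
    "\<And>\<omega> D. D \<ge> D1 \<omega> \<Longrightarrow> (\<Sum>i<n. a' i / (1 + D * a' i) * (ip n (e i) (x \<omega>))\<^sup>2)
      \<le> (\<Sum>i<n. a' i) + (R * a' 0 + eta * (\<Sum>i<n. a' i) + 3 * eta / (sqrt n * sqrt L)) + eta"
    by (auto simp: a'_def)
  have ED1: "(\<integral>\<^sup>+\<omega>. ennreal (D1 \<omega>) \<partial>M) \<le> ennreal (eps / 2)"
  proof (rule order_trans[OF D1(3)], rule ennreal_leI, rule order_trans[OF _ large(4)])
    have "a' 0 * sqrt (a' 0) \<le> sqrt (H / n) * sqrt (sqrt (H / n))"
      using a'0 H0 n0 by (intro mult_mono) auto
    then show "2 * sqrt n / eta\<^sup>2 * (R2 * (a' 0 * sqrt (a' 0)) + 3 * eta2 * H / (n * sqrt L))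
       \<le> 2 * sqrt n / eta\<^sup>2 * (R2 * (sqrt (H / n) * sqrt (sqrt (H / n))) + 3 * eta2 * H / (n * sqrt L))"
      using eta(4) by (intro mult_left_mono add_right_mono) auto
  qed
  define s where "s = sqrt (\<Sum>i<n. (a i)\<^sup>2)"
  have sum_pos: "(\<Sum>i<n. (a i)\<^sup>2) > 0"
  proof (rule sum_pos)
    show "0 < (a i)\<^sup>2" if "i \<in> {..<n}" for i using a.pos[of i] that by simp
  qed (use n in \<open>auto simp: lessThan_empty_iff\<close>)
  have s: "s > 0" "s\<^sup>2 = (\<Sum>i<n. (a i)\<^sup>2)" using sum_pos by (auto simp: s_def)
  have sle: "s \<le> 1 / (sqrt eps * sqrt n)"
  proof -
    have "s \<le> sqrt (1 / (eps * n))" unfolding s_def using sq_a by (rule real_sqrt_le_mono)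
    then show ?thesis by (simp add: real_sqrt_divide real_sqrt_mult)
  qed
  define q where "q = (\<lambda>\<omega>. (\<Sum>i<n. (a i)\<^sup>2 * (ip n (e i) (x \<omega>))\<^sup>2) / s\<^sup>2)"
  have phi0: "phi \<ge> 0" using p'0 p'phi by simp
  have c: "c > 0" "c \<le> 1" using c0 eps phi0 by (auto simp: c_def)
  define kap where "kap = (1 + eps) / c"
  define k2 where "k2 = 4 * kap / (c * eps)"
  have kap: "kap > 0" "kap \<le> 2 / c0"
    using c c0 eps by (auto simp: kap_def intro!: frac_le)
  have k2: "k2 \<ge> 0" "k2 \<le> 8 / (c0\<^sup>2 * eps)"
  proof -
    show "k2 \<ge> 0" using kap c eps by (simp add: k2_def)
    have "k2 \<le> 4 * (2 / c0) / (c0 * eps)"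
      unfolding k2_def using kap c0 eps by (intro frac_le mult_left_mono mult_right_mono mult_pos_pos) auto
    then show "k2 \<le> 8 / (c0\<^sup>2 * eps)" by (simp add: power2_eq_square mult.assoc)
  qed
  have G0: "G \<ge> 0" using G[of 1] g_nonneg[of 1] by simp
  define D2 where "D2 = (\<lambda>\<omega>. kap * q \<omega> + k2 * max 0 (q \<omega> - T))"
  have D2m: "D2 \<in> borel_measurable M"
    and ED2: "(\<integral>\<^sup>+\<omega>. ennreal (D2 \<omega>) \<partial>M) \<le> ennreal (kap + k2 * (2 * G / (T - 1)))"
    and q0: "q \<omega> \<ge> 0" for \<omega>
    using nn_integral_square_shift[OF orthonormal wa s G large(2) less_imp_le[OF kap(1)] k2(1)]
    unfolding D2_def q_def by auto
  have D20: "D2 \<omega> \<ge> 0" for \<omega> using q0 kap(1) k2(1) by (simp add: D2_def)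
  define D where "D = (\<lambda>\<omega>. D1 \<omega> + D2 \<omega>)"
  have ED: "(\<integral>\<^sup>+\<omega>. ennreal (D \<omega>) \<partial>M) \<le> ennreal ((1 + eps) / c + eps)"
  proof -
    have "(\<integral>\<^sup>+\<omega>. ennreal (D \<omega>) \<partial>M) = (\<integral>\<^sup>+\<omega>. ennreal (D1 \<omega>) + ennreal (D2 \<omega>) \<partial>M)"
      using D1(2) D20 by (simp add: D_def)
    also have "\<dots> = (\<integral>\<^sup>+\<omega>. ennreal (D1 \<omega>) \<partial>M) + (\<integral>\<^sup>+\<omega>. ennreal (D2 \<omega>) \<partial>M)"
      using D1(1) D2m by (intro nn_integral_add) auto
    also have "\<dots> \<le> ennreal (eps / 2) + ennreal (kap + k2 * (2 * G / (T - 1)))"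
      by (rule add_mono[OF ED1 ED2])
    also have "\<dots> = ennreal (eps / 2 + (kap + k2 * (2 * G / (T - 1))))"
      using eps kap k2 G0 large(2) by (intro ennreal_plus[symmetric]) auto
    also have "\<dots> \<le> ennreal ((1 + eps) / c + eps)"
    proof (rule ennreal_leI)
      have "k2 * (2 * G / (T - 1)) \<le> 8 / (c0\<^sup>2 * eps) * (2 * G / (T - 1))"
        using k2 G0 large(2) by (intro mult_right_mono) auto
      then show "eps / 2 + (kap + k2 * (2 * G / (T - 1))) \<le> (1 + eps) / c + eps"
        using large(3) by (simp add: kap_def)
    qed
    finally show ?thesis .
  qed
  have pot: "pot_le n (add_sq A (x \<omega>)) (v + D \<omega>) p'" for \<omega>
  proof -
    define z where "z = (\<lambda>i. (ip n (e i) (x \<omega>))\<^sup>2)"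
    define b where "b = (\<lambda>i. a i / (1 + D \<omega> * a i))"
    have Dge: "D \<omega> \<ge> D1 \<omega>" "D \<omega> \<ge> D2 \<omega>" "D \<omega> \<ge> 0" using D1(2)[of \<omega>] D20[of \<omega>] by (auto simp: D_def)
    have Q1: "(\<Sum>i<n. b i * z i) \<le> 1 - c"
    proof -
      \<comment> \<open>\<open>t / (1 + D * t)\<close> increases in \<open>t\<close>, so the floored
        weights dominate also after the shift.\<close>
      have "(\<Sum>i<n. b i * z i) \<le> (\<Sum>i<n. a' i / (1 + D \<omega> * a' i) * z i)"
      proof (intro sum_mono mult_right_mono)
        fix i assume "i \<in> {..<n}"
        then have i: "i < n" by simp
        have aa: "0 < a i" "a i \<le> a' i" using a.pos[OF i] i by (auto simp: a'_def)
        have "1 + D \<omega> * a i > 0" "1 + D \<omega> * a' i > 0"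
          using aa Dge(3) by (auto simp: add_pos_nonneg)
        then show "b i \<le> a' i / (1 + D \<omega> * a' i)"
          using aa by (simp add: b_def divide_simps algebra_simps)
      qed (simp add: z_def)
      also have "\<dots> \<le> (\<Sum>i<n. a' i) + (R * a' 0 + eta * (\<Sum>i<n. a' i) + 3 * eta / (sqrt n * sqrt L)) + eta"
        unfolding z_def by (rule D1(4)[OF Dge(1)])
      \<comment> \<open>The budget: \<open>eps / 4\<close> for the floor, \<open>eps / 4\<close> for
        the small ranks and \<open>eps / 2\<close> for all terms with \<open>eta\<close>, altogether
        \<open>phi + eps = 1 - c\<close>. The 6 is \<open>3 / sqrt (n * L)\<close> with
        \<open>n * L = eps / 4\<close>.\<close>
      also have "\<dots> \<le> (phi + eps / 4) + (eps / 4 + eta * 1 + eta * (6 / sqrt eps)) + eta"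
      proof (intro add_mono order_refl)
        show "(\<Sum>i<n. a' i) \<le> phi + eps / 4" by (rule sum_a')
        have "R * a' 0 \<le> R * sqrt (H / n)" using a'0 eta(3) by (intro mult_left_mono) auto
        then show "R * a' 0 \<le> eps / 4" using large(1) by linarith
        show "eta * (\<Sum>i<n. a' i) \<le> eta * 1"
          using sum_a' c0 eps eta(1) by (intro mult_left_mono) (auto simp: c_def)
        have nLs: "sqrt n * sqrt L = sqrt eps / 2"
          using n0 by (simp add: real_sqrt_mult[symmetric] nL real_sqrt_divide)
        show "3 * eta / (sqrt n * sqrt L) \<le> eta * (6 / sqrt eps)" unfolding nLs by (simp add: mult.commute)
      qed
      also have "\<dots> = phi + eps / 2 + eta * (2 + 6 / sqrt eps)" by (simp add: algebra_simps)
      also have "\<dots> \<le> phi + eps / 2 + eps / 2" using eta(5) by (rule add_left_mono)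
      also have "\<dots> = 1 - c" by (simp add: c_def)
      finally show ?thesis .
    qed
    have Q2: "(\<Sum>i<n. (b i)\<^sup>2 * z i) \<le> c * (D \<omega> * (\<Sum>i<n. a i * b i))"
      unfolding b_def
    proof (rule a.shift_dominates_square_sum[OF _ s c eps(1) kap_def])
      have "kap * s \<le> 2 / c0 * (1 / (sqrt eps * sqrt n))"
        using kap s sle c0 by (intro mult_mono) auto
      then have "2 * T * (kap * s) \<le> 2 * T * (2 / c0 * (1 / (sqrt eps * sqrt n)))"
        using large(2) by (intro mult_left_mono) auto
      also have "\<dots> = eps" using eps c0 n0 by (simp add: T_def)
      finally show "2 * T * kap * s \<le> eps" by (simp add: mult.assoc)
      show "kap * ((\<Sum>i<n. (a i)\<^sup>2 * z i) / s\<^sup>2) + 4 * kap / (c * eps) * max 0 ((\<Sum>i<n. (a i)\<^sup>2 * z i) / s\<^sup>2 - T) \<le> D \<omega>"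
        using Dge(2) by (simp add: D2_def k2_def q_def z_def)
      show "(\<Sum>i<n. a i / (1 + D \<omega> * a i) * z i) \<le> 1" using Q1 c by (simp add: b_def)
    qed (simp add: z_def)
    have "pot_le n (add_sq A (x \<omega>)) (v + D \<omega>) (\<Sum>i<n. 1 / (v - lam i))"
    proof (rule barrier_shift_feasible[OF v(2) Dge(3) c(1)])
      have eq: "1 / (v - lam i) = a i" if "i < n" for i using that by (simp add: a_def)
      show "(\<Sum>i<n. 1 / (v - lam i) / (1 + D \<omega> * (1 / (v - lam i))) * (ip n (e i) (x \<omega>))\<^sup>2) \<le> 1 - c"
        using Q1 eq by (simp add: b_def z_def)
      show "(\<Sum>i<n. (1 / (v - lam i) / (1 + D \<omega> * (1 / (v - lam i))) * ip n (e i) (x \<omega>))\<^sup>2)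
        \<le> c * (D \<omega> * (\<Sum>i<n. 1 / (v - lam i) * (1 / (v - lam i) / (1 + D \<omega> * (1 / (v - lam i))))))"
        using Q2 eq by (simp add: b_def z_def power_mult_distrib power_divide)
    qed
    then show ?thesis by (simp add: p'_eq)
  qed
  show ?thesis
    using v(1,3,4) p'0 D1(1,2) D2m D20 ED pot
    by (intro exI[of _ v] exI[of _ p'] exI[of _ D]) (auto simp: p'_eq D_def)
qed

section \<open>Choice of the constants, uniformly over matrices and laws\<close>

text \<open>\<open>R\<close> collects the finitely many ranks at which \<open>f\<close> is not yet
  below \<open>eta\<close>.\<close>

lemma tendsto_0_imp_linear_bound:
  fixes f :: "nat \<Rightarrow> real"
  assumes "f \<longlonglongrightarrow> 0" "eta > 0"
  shows "\<exists>R\<ge>0. \<forall>r. f r * real r \<le> R + eta * real r"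
proof -
  have "eventually (\<lambda>r. f r < eta) sequentially" using assms by (rule order_tendstoD)
  then obtain N where N: "\<And>r. r \<ge> N \<Longrightarrow> f r < eta" by (auto simp: eventually_sequentially)
  define R where "R = (\<Sum>r<N. \<bar>f r\<bar> * real r)"
  have R0: "R \<ge> 0" by (simp add: R_def sum_nonneg)
  have "f r * real r \<le> R + eta * real r" for r
  proof (cases "r < N")
    case True
    have "f r * real r \<le> \<bar>f r\<bar> * real r" by (intro mult_right_mono) auto
    also have "\<dots> \<le> R" unfolding R_def using True by (intro member_le_sum) auto
    finally show ?thesis using assms(2) by (simp add: add_increasing2)
  next
    case False
    then have "f r * real r \<le> eta * real r" using N[of r] by (intro mult_right_mono) auto
    then show ?thesis using R0 by simp
  qed
  with R0 show ?thesis by blast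
qed

lemma barrier_step_eventually:
  fixes f g :: "nat \<Rightarrow> real" and eps c0 :: real
  assumes f: "f \<longlonglongrightarrow> 0" and g: "g \<longlonglongrightarrow> 0" and eps: "0 < eps" "eps \<le> 1" and c0: "0 < c0"
  shows "eventually (\<lambda>n. \<forall>(M :: 'a measure) x A u p phi. isotropic M n x f g \<longrightarrow> symf n A \<longrightarrow> pot_le n A u p \<longrightarrow>
    p \<le> phi \<longrightarrow> c0 \<le> 1 - phi - eps \<longrightarrow>
    (\<exists>v p' D. v \<ge> u \<and> 0 \<le> p' \<and> p' \<le> p \<and> v + eps * n * p' \<le> u + eps * n * p \<and>
    D \<in> borel_measurable M \<and> (\<forall>\<omega>. D \<omega> \<ge> 0) \<and>
    (\<integral>\<^sup>+\<omega>. ennreal (D \<omega>) \<partial>M) \<le> ennreal ((1 + eps) / (1 - phi - eps) + eps) \<and>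
    (\<forall>\<omega>. pot_le n (add_sq A (x \<omega>)) (v + D \<omega>) p'))) sequentially"
proof -
  define H where "H = 1 / eps + eps\<^sup>2"
  define tau where "tau = eps * sqrt eps * c0 / 4"
  define eta where "eta = eps / 2 / (2 + 6 / sqrt eps)"
  have H: "H > 0" using eps by (simp add: H_def add_pos_pos)
  have tau: "tau > 0" using eps c0 by (simp add: tau_def)
  have den: "2 + 6 / sqrt eps > 0" using eps by (simp add: add_pos_pos)
  then have eta0: "eta > 0" using eps by (simp add: eta_def)
  have "eps / 2 / y * y = eps / 2" if "y > 0" for y :: real using that by simp
  from eq_refl[OF this[OF den]] have eta: "eta > 0" "eta * (2 + 6 / sqrt eps) \<le> eps / 2"
    using eta0 unfolding eta_def by auto
  obtain R where R: "R \<ge> 0" "\<forall>r. f r * real r \<le> R + eta * real r"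
    using tendsto_0_imp_linear_bound[OF f eta(1)] by blast
  \<comment> \<open>In the bound for the mean trace shift the \<open>eta2\<close> term does not
    depend on \<open>n\<close>; this value makes it exactly \<open>eps / 4\<close>. The dimension
    has to be large only for the \<open>R2\<close> term, which decays like
    \<open>n powr (-1/4)\<close>.\<close>
  define eta2 where "eta2 = eps / 4 * eta\<^sup>2 * sqrt eps / (12 * H)"
  have eta2: "eta2 > 0" using eps eta H by (simp add: eta2_def)
  obtain R2 where R2: "R2 \<ge> 0" "\<forall>r. g r * real r \<le> R2 + eta2 * real r"
    using tendsto_0_imp_linear_bound[OF g eta2] by blast
  have "Bseq g" using g by (intro convergent_imp_Bseq convergentI)
  then have "\<exists>G. \<forall>r. norm (g r) \<le> G" by (auto simp: Bseq_def)
  then obtain G where G: "\<forall>r. norm (g r) \<le> G" by blast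
  define k where "k = 8 / (c0\<^sup>2 * eps)"
  have lim: "(\<lambda>n. R * sqrt (H / real n)) \<longlonglongrightarrow> 0"
    "filterlim (\<lambda>n. tau * sqrt (real n)) at_top sequentially"
    "(\<lambda>n. k * (2 * G / (tau * sqrt (real n) - 1))) \<longlonglongrightarrow> 0"
    "(\<lambda>n. 2 * sqrt (real n) / eta\<^sup>2 * (R2 * (sqrt (H / real n) * sqrt (sqrt (H / real n))))) \<longlonglongrightarrow> 0"
    using H tau eta(1) by real_asymp+
  have e4: "eps / 4 > 0" "eps / 2 > 0" using eps by auto
  have "eventually (\<lambda>n. n \<ge> 1) sequentially" by (rule eventually_ge_at_top)
  moreover have "eventually (\<lambda>n. R * sqrt (H / real n) < eps / 4) sequentially"
    by (rule order_tendstoD(2)[OF lim(1) e4(1)])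
  moreover have "eventually (\<lambda>n. 2 \<le> tau * sqrt (real n)) sequentially"
    using lim(2) by (simp add: filterlim_at_top)
  moreover have "eventually (\<lambda>n. k * (2 * G / (tau * sqrt (real n) - 1)) < eps / 2) sequentially"
    by (rule order_tendstoD(2)[OF lim(3) e4(2)])
  moreover have "eventually (\<lambda>n. 2 * sqrt (real n) / eta\<^sup>2 * (R2 * (sqrt (H / real n) * sqrt (sqrt (H / real n)))) < eps / 4) sequentially"
    by (rule order_tendstoD(2)[OF lim(4) e4(1)])
  ultimately show ?thesis
  proof (eventually_elim, intro allI impI)
    fix n and M :: "'a measure" and x A u p phi
    assume n: "1 \<le> n" and l1: "R * sqrt (H / real n) < eps / 4" and l2: "2 \<le> tau * sqrt (real n)"
      and l3: "k * (2 * G / (tau * sqrt (real n) - 1)) < eps / 2"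
      and l4: "2 * sqrt (real n) / eta\<^sup>2 * (R2 * (sqrt (H / real n) * sqrt (sqrt (H / real n)))) < eps / 4"
      and iso: "isotropic M n x f g" and A: "symf n A" "pot_le n A u p" "p \<le> phi" and c: "c0 \<le> 1 - phi - eps"
    have n0: "real n > 0" using n by simp
    have l5: "2 * sqrt n / eta\<^sup>2 * (3 * eta2 * H / (n * sqrt (eps / (4 * real n)))) = eps / 4"
    proof -
      have "sqrt n * sqrt (eps / (4 * real n)) = sqrt eps / 2"
        using n0 by (simp add: real_sqrt_divide real_sqrt_mult)
      then have eq: "n * sqrt (eps / (4 * real n)) = sqrt n * sqrt eps / 2"
        using n0 by (metis mult.assoc of_nat_0_le_iff real_sqrt_mult_self abs_of_nat times_divide_eq_right)
      show ?thesis unfolding eq using n0 eta(1) H eps by (simp add: eta2_def)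
    qed
    have l4': "2 * sqrt n / eta\<^sup>2 * (R2 * (sqrt (H / n) * sqrt (sqrt (H / n)))
        + 3 * eta2 * H / (n * sqrt (eps / (4 * real n)))) \<le> eps / 2"
      unfolding distrib_left by (rule order_trans[OF add_mono[OF less_imp_le[OF l4] eq_refl[OF l5]]]) simp
    interpret isotropic M n x f g by fact
    have g': "g r \<le> G" for r using G[rule_format, of r] by simp
    show "\<exists>v p' D. v \<ge> u \<and> 0 \<le> p' \<and> p' \<le> p \<and> v + eps * n * p' \<le> u + eps * n * p \<and>
      D \<in> borel_measurable M \<and> (\<forall>\<omega>. D \<omega> \<ge> 0) \<and>
      (\<integral>\<^sup>+\<omega>. ennreal (D \<omega>) \<partial>M) \<le> ennreal ((1 + eps) / (1 - phi - eps) + eps) \<and>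
      (\<forall>\<omega>. pot_le n (add_sq A (x \<omega>)) (v + D \<omega>) p')"
      by (rule barrier_step[OF n A eps c0 c R(2)[rule_format] R2(2)[rule_format] g' eta(1) less_imp_le[OF eta2] R(1) R2(1) eta(2)])
        (use l1 l2 l3 l4' in \<open>simp_all add: H_def tau_def k_def\<close>)
  qed
qed

section \<open>The barrier value\<close>

lemma pot_le_cong:
  assumes "\<And>i k. i < n \<Longrightarrow> k < n \<Longrightarrow> A i k = B i k"
  shows "pot_le n A u p \<longleftrightarrow> pot_le n B u p"
proof -
  have "ip n w (mv n A w) = ip n w (mv n B w)" for w
    unfolding ip_def mv_def using assms by (intro sum.cong refl arg_cong2[of _ _ _ _ "(*)"]) auto
  then show ?thesis by (simp add: pot_le_def)
qed

text \<open>Each test matrix \<open>V\<close> gives one affine inequality in the entries, so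
  uncountably many of them still define a closed set. This is what makes the potential bound
  measurable.\<close>

lemma closed_pot_le: "closed {B :: nat \<times> nat \<Rightarrow> real. pot_le n (\<lambda>i k. B (i, k)) u p}"
proof -
  have coord: "continuous_on UNIV (\<lambda>B :: nat \<times> nat \<Rightarrow> real. B i)" for i by simp
  have "{B :: nat \<times> nat \<Rightarrow> real. pot_le n (\<lambda>i k. B (i, k)) u p} =
    (\<Inter>V. {B. (\<Sum>j<n. 2 * V j j - u * ip n (V j) (V j) + ip n (V j) (mv n (\<lambda>i k. B (i, k)) (V j))) \<le> p})"
    by (auto simp: pot_le_def)
  also have "closed \<dots>"
    unfolding ip_def mv_def
    by (intro closed_INT ballI closed_Collect_le continuous_on_sum continuous_on_add continuous_on_mult
        continuous_on_const coord)
  finally show ?thesis .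
qed

lemma measurable_pot_le:
  assumes "\<And>i k. i < n \<Longrightarrow> k < n \<Longrightarrow> (\<lambda>\<omega>. A \<omega> i k) \<in> borel_measurable M"
  shows "Measurable.pred M (\<lambda>\<omega>. pot_le n (A \<omega>) u p)"
proof -
  \<comment> \<open>Only the entries below \<open>n\<close> are known to be measurable; the others
    are set to 0 so that \<open>B\<close> is measurable into the full product space.\<close>
  define B where "B = (\<lambda>\<omega> ik. if fst ik < n \<and> snd ik < n then A \<omega> (fst ik) (snd ik) else 0)"
  have "B \<in> borel_measurable M"
  proof (rule measurable_coordinatewise_then_product)
    fix ik show "(\<lambda>\<omega>. B \<omega> ik) \<in> borel_measurable M"
      using assms by (cases "fst ik < n \<and> snd ik < n") (auto simp: B_def)
  qed
  from measurable_sets[OF this borel_closed[OF closed_pot_le[of n u p]]]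
  have "B -` {B. pot_le n (\<lambda>i k. B (i, k)) u p} \<inter> space M \<in> sets M" .
  also have "B -` {B. pot_le n (\<lambda>i k. B (i, k)) u p} \<inter> space M = {\<omega> \<in> space M. pot_le n (A \<omega>) u p}"
  proof -
    have "pot_le n (A \<omega>) u p \<longleftrightarrow> pot_le n (\<lambda>i k. B \<omega> (i, k)) u p" for \<omega>
      by (rule pot_le_cong) (simp add: B_def)
    then show ?thesis by blast
  qed
  finally show ?thesis unfolding pred_def .
qed

text \<open>The infimum ranges over a countable set so that it is measurable in \<open>A\<close>.\<close>
definition barrier_value :: "nat \<Rightarrow> real \<Rightarrow> real \<Rightarrow> (nat \<Rightarrow> nat \<Rightarrow> real) \<Rightarrow> ennreal" where
  "barrier_value n C phi A = (INF (u, p)\<in>{(u, p). u \<in> \<rat> \<and> p \<in> \<rat> \<and> 0 \<le> u \<and> 0 \<le> p \<and> p \<le> phi}.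
     if pot_le n A u p then ennreal (u + C * p) else \<infinity>)"

lemma measurable_barrier_value:
  assumes "\<And>i k. i < n \<Longrightarrow> k < n \<Longrightarrow> (\<lambda>\<omega>. A \<omega> i k) \<in> borel_measurable M"
  shows "(\<lambda>\<omega>. barrier_value n C phi (A \<omega>)) \<in> borel_measurable M"
proof -
  have "countable (\<rat> \<times> \<rat> :: (real \<times> real) set)"
    by (intro countable_SIGMA countable_rat)
  then have "countable {(u :: real, p :: real). u \<in> \<rat> \<and> p \<in> \<rat> \<and> 0 \<le> u \<and> 0 \<le> p \<and> p \<le> phi}"
    by (rule countable_subset[rotated]) auto
  moreover have "(\<lambda>\<omega>. if pot_le n (A \<omega>) u p then ennreal (u + C * p) else \<infinity>) \<in> borel_measurable M" for u p
    by (rule measurable_If[OF _ _ measurable_pot_le[OF assms, unfolded pred_def]]) auto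
  ultimately show ?thesis
    unfolding barrier_value_def by (intro borel_measurable_INF) (auto simp: split_beta)
qed

text \<open>Real parameters are rounded up to rational ones at arbitrarily small cost. The rational
  \<open>p\<close> between \<open>p'\<close> and \<open>phi\<close> guarantees room for this: an
  irrational \<open>p' = phi\<close> could not be rounded.\<close>

lemma barrier_value_le:
  assumes B: "pot_le n B w p'" and w: "w \<ge> 0" and p: "0 \<le> p'" "p' \<le> p" "p \<in> \<rat>" "p \<le> phi" and C: "C \<ge> 0"
  shows "barrier_value n C phi B \<le> ennreal (w + C * p')"
proof (rule ennreal_le_epsilon)
  fix d :: real assume d: "d > 0"
  obtain u where u: "u \<in> \<rat>" "w \<le> u" "u \<le> w + d / 2"
    using Rats_dense_in_real[of w "w + d / 2"] d by (auto intro: less_imp_le)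
  define d' where "d' = d / (2 * (C + 1))"
  have d': "d' > 0" "C * d' \<le> d / 2" using d C by (auto simp: d'_def field_simps)
  obtain r where r: "r \<in> \<rat>" "p' \<le> r" "r \<le> p" "r \<le> p' + d'"
  proof (cases "p' = p")
    case True
    show ?thesis by (rule that[of p]) (use True p d' in auto)
  next
    case False
    then have "p' < min p (p' + d')" using p d' by auto
    from Rats_dense_in_real[OF this] obtain r where "r \<in> \<rat>" "p' < r" "r < min p (p' + d')" by blast
    then show ?thesis by (intro that[of r]) auto
  qed
  have "barrier_value n C phi B \<le> (if pot_le n B u r then ennreal (u + C * r) else \<infinity>)"
    unfolding barrier_value_def using u r p w by (intro INF_lower2[of "(u, r)"]) auto
  also have "\<dots> = ennreal (u + C * r)" using pot_le_mono[OF B u(2) r(2)] by simp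
  also have "\<dots> \<le> ennreal (w + C * p' + d)"
  proof (rule ennreal_leI)
    have "C * r \<le> C * (p' + d')" using r C by (intro mult_left_mono) auto
    then show "u + C * r \<le> w + C * p' + d" using u d' by (simp add: distrib_left)
  qed
  also have "\<dots> = ennreal (w + C * p') + ennreal d" using w p C d by (intro ennreal_plus) auto
  finally show "barrier_value n C phi B \<le> ennreal (w + C * p') + ennreal d" .
qed

text \<open>\<open>w\<close> has a nonzero component along some \<open>e i\<close>, which forces
  \<open>l = lam i\<close>; every admissible \<open>u\<close> exceeds it.\<close>

lemma eigenvalue_le_barrier_value:
  assumes A: "symf n A" and C: "C \<ge> 0"
    and w: "\<And>i. i < n \<Longrightarrow> mv n A w i = l * w i" "\<exists>i<n. w i \<noteq> 0"
  shows "ennreal l \<le> barrier_value n C phi A"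
  unfolding barrier_value_def
proof (rule INF_greatest, clarify)
  fix u p :: real assume p: "0 \<le> p"
  show "ennreal l \<le> (if pot_le n A u p then ennreal (u + C * p) else \<infinity>)"
  proof (cases "pot_le n A u p")
    case True
    obtain e lam where "eigensystem n A e lam" by (rule eigensystem_exists[OF A])
    then interpret eigensystem n A e lam .
    have "\<exists>i<n. ip n (e i) w \<noteq> 0"
    proof (rule ccontr)
      assume "\<not> ?thesis"
      then have "ip n w w = 0" unfolding parseval[of w w] by (intro sum.neutral) auto
      then show False using ip_eq_0_imp w(2) by blast
    qed
    then obtain i where i: "i < n" "ip n (e i) w \<noteq> 0" by blast
    have "ip n (e i) (mv n A w) = l * ip n (e i) w"
      using w(1) by (simp add: ip_def sum_distrib_left algebra_simps)
    moreover have "ip n (e i) (mv n A w) = ip n (mv n A (e i)) w" by (rule ip_mv_symf[OF A])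
    moreover have "ip n (mv n A (e i)) w = lam i * ip n (e i) w"
      using eigenvector[OF i(1)] by (simp add: ip_def sum_distrib_left mult.assoc)
    ultimately have "l = lam i" using i(2) by simp
    then have "l < u" using pot_le_imp_eigenvalue_less[OF True i(1)] by simp
    then have "l \<le> u + C * p" using mult_nonneg_nonneg[OF C p] by simp
    then show ?thesis using True by (simp add: ennreal_leI)
  qed simp
qed

lemma barrier_value_zero:
  assumes phi: "phi > 0" and C: "C \<ge> 0"
  shows "barrier_value n C phi (\<lambda>i k. 0) \<le> ennreal (n / phi + 1 + C * phi)"
proof -
  \<comment> \<open>At \<open>A = 0\<close> the potential is \<open>n / u\<close>; the summand 1
    makes it strictly smaller than \<open>phi\<close> and leaves space for a rational bound.\<close>
  define u where "u = n / phi + 1"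
  have u: "u > 0" using phi by (simp add: u_def add_nonneg_pos)
  interpret eigensystem n "\<lambda>i k. 0" "\<lambda>i j. of_bool (i = j)" "\<lambda>i. 0"
    by standard (auto simp: symf_def orthonormal_def ip_def mv_def)
  have pot: "pot_le n (\<lambda>i k. 0) u (n / u)" using pot_le_sum[of u] u by simp
  have "n < phi * u" using phi by (simp add: u_def distrib_left)
  then have lt: "n / u < phi" using u by (simp add: pos_divide_less_eq)
  from Rats_dense_in_real[OF this] obtain r where r: "r \<in> \<rat>" "n / u < r" "r < phi" by blast
  have "barrier_value n C phi (\<lambda>i k. 0) \<le> ennreal (u + C * (n / u))"
    using u r by (intro barrier_value_le[OF pot _ _ _ r(1) _ C]) auto
  also have "\<dots> \<le> ennreal (u + C * phi)"
    using lt C by (intro ennreal_leI add_left_mono mult_left_mono) auto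
  finally show ?thesis by (simp add: u_def)
qed

text \<open>Any pair \<open>(u, p)\<close> admissible for \<open>A\<close> yields the pair
  \<open>(v + D, p')\<close> for the updated matrix, whose objective is larger by at most the random
  \<open>D\<close>. Averaging over the sample therefore costs at most the mean of
  \<open>D\<close>.\<close>

lemma barrier_value_step_eventually:
  fixes f g :: "nat \<Rightarrow> real" and eps c0 :: real
  assumes f: "f \<longlonglongrightarrow> 0" and g: "g \<longlonglongrightarrow> 0" and eps: "0 < eps" "eps \<le> 1" and c0: "0 < c0"
  shows "eventually (\<lambda>n. \<forall>(M :: 'a measure) x A phi. isotropic M n x f g \<longrightarrow> symf n A \<longrightarrow>
    0 \<le> phi \<longrightarrow> c0 \<le> 1 - phi - eps \<longrightarrow>
    (\<integral>\<^sup>+\<omega>. barrier_value n (eps * n) phi (add_sq A (x \<omega>)) \<partial>M)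
      \<le> barrier_value n (eps * n) phi A + ennreal ((1 + eps) / (1 - phi - eps) + eps)) sequentially"
  using barrier_step_eventually[OF assms, where ?'a = 'a]
proof eventually_elim
  case (elim n)
  show ?case
  proof (intro allI impI)
    fix M :: "'a measure" and x A phi
    assume iso: "isotropic M n x f g" and A: "symf n A" and phi: "0 \<le> phi" "c0 \<le> 1 - phi - eps"
    interpret isotropic M n x f g by fact
    define C where "C = eps * real n"
    have C: "C \<ge> 0" using eps by (simp add: C_def)
    define k where "k = (1 + eps) / (1 - phi - eps) + eps"
    let ?I = "{(u :: real, p :: real). u \<in> \<rat> \<and> p \<in> \<rat> \<and> 0 \<le> u \<and> 0 \<le> p \<and> p \<le> phi}"
    \<comment> \<open>With the constant on the left, the claim can be checked for each member of the
      infimum separately; no minimiser has to exist.\<close>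
    have "(\<integral>\<^sup>+\<omega>. barrier_value n C phi (add_sq A (x \<omega>)) \<partial>M) - ennreal k \<le> barrier_value n C phi A"
      unfolding barrier_value_def[of n C phi A]
    proof (rule INF_greatest)
      fix up assume "up \<in> ?I"
      then obtain u p where up: "up = (u, p)" "u \<in> \<rat>" "p \<in> \<rat>" "0 \<le> u" "0 \<le> p" "p \<le> phi" by auto
      have "(\<integral>\<^sup>+\<omega>. barrier_value n C phi (add_sq A (x \<omega>)) \<partial>M)
        \<le> (if pot_le n A u p then ennreal (u + C * p) else \<infinity>) + ennreal k"
      proof (cases "pot_le n A u p")
        case True
        from elim[rule_format, OF iso A True up(6) phi(2)] obtain v p' D where *: "v \<ge> u" "0 \<le> p'" "p' \<le> p"
          "v + C * p' \<le> u + C * p" "D \<in> borel_measurable M" "\<forall>\<omega>. D \<omega> \<ge> 0"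
          "(\<integral>\<^sup>+\<omega>. ennreal (D \<omega>) \<partial>M) \<le> ennreal k" "\<forall>\<omega>. pot_le n (add_sq A (x \<omega>)) (v + D \<omega>) p'"
          unfolding C_def k_def by blast
        have vC: "v + C * p' \<ge> 0" using * up C by simp
        have "(\<integral>\<^sup>+\<omega>. barrier_value n C phi (add_sq A (x \<omega>)) \<partial>M)
          \<le> (\<integral>\<^sup>+\<omega>. ennreal (v + C * p') + ennreal (D \<omega>) \<partial>M)"
        proof (rule nn_integral_mono)
          fix \<omega>
          have "D \<omega> \<ge> 0" using *(6) by blast
          then have "v + D \<omega> \<ge> 0" using *(1) up(4) by linarith
          then have "barrier_value n C phi (add_sq A (x \<omega>)) \<le> ennreal ((v + D \<omega>) + C * p')"
            by (rule barrier_value_le[OF *(8)[rule_format] _ *(2,3) up(3,6) C])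
          also have "(v + D \<omega>) + C * p' = (v + C * p') + D \<omega>" by simp
          also have "ennreal \<dots> = ennreal (v + C * p') + ennreal (D \<omega>)"
            using vC * by (intro ennreal_plus) auto
          finally show "barrier_value n C phi (add_sq A (x \<omega>)) \<le> ennreal (v + C * p') + ennreal (D \<omega>)" .
        qed
        also have "\<dots> = ennreal (v + C * p') + (\<integral>\<^sup>+\<omega>. ennreal (D \<omega>) \<partial>M)"
          using *(5) by (subst nn_integral_add) (auto simp: emeasure_space_1)
        also have "\<dots> \<le> ennreal (u + C * p) + ennreal k"
          by (rule add_mono[OF ennreal_leI[OF *(4)] *(7)])
        finally show ?thesis using True by simp
      qed simp
      then show "(\<integral>\<^sup>+\<omega>. barrier_value n C phi (add_sq A (x \<omega>)) \<partial>M) - ennreal k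
        \<le> (case up of (u, p) \<Rightarrow> if pot_le n A u p then ennreal (u + C * p) else \<infinity>)"
        by (simp add: up(1) ennreal_minus_le_iff add.commute)
    qed
    then have "(\<integral>\<^sup>+\<omega>. barrier_value n C phi (add_sq A (x \<omega>)) \<partial>M) \<le> barrier_value n C phi A + ennreal k"
      by (simp add: ennreal_minus_le_iff add.commute)
    then show "(\<integral>\<^sup>+\<omega>. barrier_value n (eps * n) phi (add_sq A (x \<omega>)) \<partial>M)
      \<le> barrier_value n (eps * n) phi A + ennreal ((1 + eps) / (1 - phi - eps) + eps)"
      by (simp add: C_def k_def)
  qed
qed

text \<open>Fubini splits off one factor. For fixed remaining factors their sum is a fixed symmetric
  matrix, to which the one-step inequality applies.\<close>

lemma barrier_value_product:
  fixes cf :: "'c \<Rightarrow> nat \<Rightarrow> real" and I :: "'i set"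
  assumes nu: "prob_space nu" and cf: "\<And>i. i < n \<Longrightarrow> (\<lambda>y. cf y i) \<in> borel_measurable nu"
    and step: "\<And>A. symf n A \<Longrightarrow>
      (\<integral>\<^sup>+y. barrier_value n C phi (add_sq A (cf y)) \<partial>nu) \<le> barrier_value n C phi A + k"
    and "finite I"
  shows "(\<integral>\<^sup>+z. barrier_value n C phi (\<lambda>i l. \<Sum>j\<in>I. cf (z j) i * cf (z j) l) \<partial>(Pi\<^sub>M I (\<lambda>_. nu)))
    \<le> barrier_value n C phi (\<lambda>i l. 0) + of_nat (card I) * k"
  using \<open>finite I\<close>
proof (induction I rule: finite_induct)
  case empty
  then show ?case by (simp add: PiM_empty nn_integral_count_space_finite)
next
  case (insert i0 I)
  interpret prob_space nu by (rule nu)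
  interpret product_sigma_finite "\<lambda>_. nu" by standard
  define F where "F = (\<lambda>(J :: 'i set) z. barrier_value n C phi (\<lambda>i l. \<Sum>j\<in>J. cf (z j) i * cf (z j) l))"
  have comp: "(\<lambda>z. cf (z j) i) \<in> borel_measurable (Pi\<^sub>M J (\<lambda>_. nu))" if "i < n" "j \<in> J" for i j and J :: "'i set"
    by (rule measurable_compose[OF measurable_component_singleton[OF that(2)] cf[OF that(1)]])
  have Fm: "F J \<in> borel_measurable (Pi\<^sub>M J (\<lambda>_. nu))" for J
    unfolding F_def
    by (intro measurable_barrier_value borel_measurable_sum borel_measurable_times comp)
  have "(\<integral>\<^sup>+z. F (insert i0 I) z \<partial>(Pi\<^sub>M (insert i0 I) (\<lambda>_. nu)))
    = (\<integral>\<^sup>+z. (\<integral>\<^sup>+y. F (insert i0 I) (z(i0 := y)) \<partial>nu) \<partial>(Pi\<^sub>M I (\<lambda>_. nu)))"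
    using product_nn_integral_insert[OF insert(1,2), of "F (insert i0 I)"] Fm[of "insert i0 I"] by simp
  also have "\<dots> \<le> (\<integral>\<^sup>+z. F I z + k \<partial>(Pi\<^sub>M I (\<lambda>_. nu)))"
  proof (rule nn_integral_mono)
    fix z
    define A where "A = (\<lambda>i l. \<Sum>j\<in>I. cf (z j) i * cf (z j) l)"
    have "F (insert i0 I) (z(i0 := y)) = barrier_value n C phi (add_sq A (cf y))" for y
    proof -
      have "(\<Sum>j\<in>I. cf ((z(i0 := y)) j) i * cf ((z(i0 := y)) j) l) = A i l" for i l
        unfolding A_def using insert by (intro sum.cong) auto
      then have "(\<lambda>i l. \<Sum>j\<in>insert i0 I. cf ((z(i0 := y)) j) i * cf ((z(i0 := y)) j) l) = add_sq A (cf y)"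
        using insert by (intro ext) (simp add: add_sq_def)
      then show ?thesis by (simp only: F_def)
    qed
    moreover have "symf n A" by (simp add: symf_def A_def mult.commute)
    ultimately show "(\<integral>\<^sup>+y. F (insert i0 I) (z(i0 := y)) \<partial>nu) \<le> F I z + k"
      using step[of A] by (simp add: F_def A_def)
  qed
  also have "\<dots> = (\<integral>\<^sup>+z. F I z \<partial>(Pi\<^sub>M I (\<lambda>_. nu))) + k"
  proof -
    interpret P: prob_space "Pi\<^sub>M I (\<lambda>_. nu)" by (intro prob_space_PiM nu)
    show ?thesis using Fm by (subst nn_integral_add) (auto simp: P.emeasure_space_1)
  qed
  also have "\<dots> \<le> barrier_value n C phi (\<lambda>i l. 0) + of_nat (card I) * k + k"
    using insert.IH by (intro add_right_mono) (simp add: F_def)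
  also have "\<dots> = barrier_value n C phi (\<lambda>i l. 0) + of_nat (card (insert i0 I)) * k"
    using insert by (simp add: distrib_right add_ac)
  finally show ?case by (simp add: F_def)
qed

section \<open>Projections, eigenvalues and the main estimate\<close>

lemma ip_orthonormal_combinations:
  assumes "orthonormal n r e"
  shows "ip n (\<lambda>l. \<Sum>j<r. c j * e j l) (\<lambda>l. \<Sum>j<r. d j * e j l) = (\<Sum>j<r. c j * d j)"
proof -
  have "ip n (\<lambda>l. \<Sum>j<r. c j * e j l) y = (\<Sum>j<r. c j * ip n (e j) y)" for y
  proof -
    have "ip n (\<lambda>l. \<Sum>j<r. c j * e j l) y = (\<Sum>l<n. \<Sum>j<r. c j * (e j l * y l))"
      by (simp add: ip_def sum_distrib_right mult.assoc)
    also have "\<dots> = (\<Sum>j<r. c j * ip n (e j) y)"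
      by (subst sum.swap) (simp add: ip_def sum_distrib_left)
    finally show ?thesis .
  qed
  then show ?thesis using orthonormal_coordinates[OF assms] by simp
qed

text \<open>Arbitrary index sets are allowed so that the complementary projection has the same
  form.\<close>

definition proj_mat :: "nat \<Rightarrow> nat set \<Rightarrow> (nat \<Rightarrow> nat \<Rightarrow> real) \<Rightarrow> real Matrix.mat" where
  "proj_mat n S e = Matrix.mat n n (\<lambda>(i, k). \<Sum>j\<in>S. e j i * e j k)"

lemma proj_mat_carrier [simp]: "proj_mat n S e \<in> carrier_mat n n"
  by (simp add: proj_mat_def)

lemma orthonormal_mono: "orthonormal n n e \<Longrightarrow> r \<le> n \<Longrightarrow> orthonormal n r e"
  by (simp add: orthonormal_def)

lemma orthogonal_projection_proj_mat:
  assumes "orthonormal n r e"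
  shows "orthogonal_projection n (proj_mat n {..<r} e)"
  unfolding orthogonal_projection_def
proof (intro conjI)
  let ?P = "proj_mat n {..<r} e"
  show "?P * ?P = ?P"
  proof (rule eq_matI)
    fix i k assume "i < dim_row ?P" "k < dim_col ?P"
    then have ik: "i < n" "k < n" by (auto simp: proj_mat_def)
    have "(?P * ?P) $$ (i, k) = (\<Sum>l<n. (\<Sum>j<r. e j i * e j l) * (\<Sum>j<r. e j k * e j l))"
      using ik by (simp add: proj_mat_def times_mat_def scalar_prod_def atLeast0LessThan mult.commute)
    also have "\<dots> = ip n (\<lambda>l. \<Sum>j<r. e j i * e j l) (\<lambda>l. \<Sum>j<r. e j k * e j l)"
      by (simp add: ip_def)
    also have "\<dots> = (\<Sum>j<r. e j i * e j k)" by (rule ip_orthonormal_combinations[OF assms])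
    finally show "(?P * ?P) $$ (i, k) = ?P $$ (i, k)" using ik by (simp add: proj_mat_def)
  qed (simp_all add: proj_mat_def)
  show "transpose_mat ?P = ?P"
    by (rule eq_matI) (auto simp: proj_mat_def mult.commute)
qed simp

lemma rank_proj_mat_le:
  assumes "finite S"
  shows "mat_rank n (proj_mat n S e) \<le> card S"
  using assms
proof (induction S)
  case empty
  interpret vec_space "TYPE(real)" n .
  have "proj_mat n {} e = 0\<^sub>m n n" by (rule eq_matI) (auto simp: proj_mat_def)
  then show ?case using rank_0I[of n] by simp
next
  case (insert j S)
  interpret vec_space "TYPE(real)" n .
  have "proj_mat n (insert j S) e = proj_mat n {j} e + proj_mat n S e"
    using insert by (intro eq_matI) (auto simp: proj_mat_def)
  moreover have "rank (proj_mat n {j} e) \<le> 1"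
    by (rule rank_le_1_product_entries[of _ n "e j" "e j"]) (auto simp: proj_mat_def)
  moreover have "rank (proj_mat n {j} e + proj_mat n S e) \<le> rank (proj_mat n {j} e) + rank (proj_mat n S e)"
    by (rule rank_subadditive[of _ n]) auto
  ultimately show ?case using insert by simp
qed

text \<open>The projection and its complement add up to the identity. Their ranks are at most
  \<open>r\<close> and \<open>n - r\<close> and, by subadditivity, sum to at least \<open>n\<close>,
  so both bounds are sharp.\<close>

lemma rank_proj_mat:
  assumes e: "orthonormal n n e" and r: "r \<le> n"
  shows "mat_rank n (proj_mat n {..<r} e) = r"
proof -
  interpret vec_space "TYPE(real)" n .
  have sum: "proj_mat n {..<r} e + proj_mat n {r..<n} e = 1\<^sub>m n"
  proof (rule eq_matI)
    fix i k assume "i < dim_row (1\<^sub>m n :: real Matrix.mat)" "k < dim_col (1\<^sub>m n :: real Matrix.mat)"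
    then have ik: "i < n" "k < n" by auto
    have "{..<n} = {..<r} \<union> {r..<n}" using r by auto
    then have "(\<Sum>j<n. e j i * e j k) = (\<Sum>j<r. e j i * e j k) + (\<Sum>j=r..<n. e j i * e j k)"
      by (simp add: sum.union_disjoint ivl_disj_int)
    then show "(proj_mat n {..<r} e + proj_mat n {r..<n} e) $$ (i, k) = 1\<^sub>m n $$ (i, k)"
      using ik orthonormal_complete[OF e ik] by (cases "i = k") (simp_all add: proj_mat_def)
  qed (auto simp: proj_mat_def)
  have "rank (1\<^sub>m n) = n" using det_rank_iff[of "1\<^sub>m n"] by simp
  moreover have "rank (proj_mat n {..<r} e + proj_mat n {r..<n} e)
      \<le> rank (proj_mat n {..<r} e) + rank (proj_mat n {r..<n} e)"
    by (rule rank_subadditive[of _ n]) auto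
  ultimately have "n \<le> rank (proj_mat n {..<r} e) + rank (proj_mat n {r..<n} e)"
    by (simp only: sum)
  moreover have "rank (proj_mat n {r..<n} e) \<le> n - r"
    using rank_proj_mat_le[of "{r..<n}" n e] by simp
  moreover have "rank (proj_mat n {..<r} e) \<le> r"
    using rank_proj_mat_le[of "{..<r}" n e] by simp
  ultimately show ?thesis using r by linarith
qed

lemma euclid_norm_proj_mat:
  assumes e: "orthonormal n r e" and v: "v \<in> carrier_vec n"
  shows "(euclid_norm (proj_mat n {..<r} e *\<^sub>v v))\<^sup>2 = (\<Sum>j<r. (ip n (e j) (vec_index v))\<^sup>2)"
proof -
  let ?z = "\<lambda>i. \<Sum>j<r. ip n (e j) (vec_index v) * e j i"
  have "vec_index (proj_mat n {..<r} e *\<^sub>v v) i = ?z i" if i: "i < n" for i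
  proof -
    have "vec_index (proj_mat n {..<r} e *\<^sub>v v) i = (\<Sum>k<n. (\<Sum>j<r. e j i * e j k) * vec_index v k)"
      using i v by (simp add: proj_mat_def scalar_prod_def atLeast0LessThan)
    also have "\<dots> = (\<Sum>k<n. \<Sum>j<r. e j i * (e j k * vec_index v k))"
      by (simp add: sum_distrib_right mult.assoc)
    also have "\<dots> = ?z i"
      by (subst sum.swap) (simp add: ip_def sum_distrib_left sum_distrib_right mult_ac)
    finally show ?thesis .
  qed
  then have "scalar_prod (proj_mat n {..<r} e *\<^sub>v v) (proj_mat n {..<r} e *\<^sub>v v) = ip n ?z ?z"
    by (simp add: scalar_prod_def ip_def atLeast0LessThan proj_mat_def del: index_mult_mat_vec)
  also have "\<dots> = (\<Sum>j<r. (ip n (e j) (vec_index v))\<^sup>2)"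
    using ip_orthonormal_combinations[OF e, of "\<lambda>j. ip n (e j) (vec_index v)" "\<lambda>j. ip n (e j) (vec_index v)"]
    by (simp add: power2_eq_square)
  finally show ?thesis by (simp add: euclid_norm_def sum_nonneg)
qed

lemma isotropic_of_tail:
  fixes M :: "'a measure" and X :: "'a \<Rightarrow> real Matrix.vec"
  assumes M: "prob_space M" and X: "X \<in> measurable M (borel_vec n)"
    and cov: "has_mean_mat M n (\<lambda>\<omega>. tensor_sq (X \<omega>)) (1\<^sub>m n)"
    and f: "\<And>r. r \<ge> 1 \<Longrightarrow> f r \<in> {0..1}" and g: "\<And>r. r \<ge> 1 \<Longrightarrow> g r \<ge> 0"
    and tail: "\<And>P t. orthogonal_projection n P \<Longrightarrow> P \<noteq> 0\<^sub>m n n \<Longrightarrow>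
        t \<ge> f (mat_rank n P) * real (mat_rank n P) \<Longrightarrow> t \<noteq> 0 \<Longrightarrow>
        measure M {\<omega> \<in> space M. (euclid_norm (P *\<^sub>v X \<omega>))\<^sup>2 - real (mat_rank n P) \<ge> t}
          \<le> g (mat_rank n P) * real (mat_rank n P) / t\<^sup>2"
  shows "isotropic M n (\<lambda>\<omega>. vec_index (X \<omega>)) f g"
proof -
  have carrier: "X \<omega> \<in> carrier_vec n" if "\<omega> \<in> space M" for \<omega>
    using X that by (simp add: measurable_borel_vec_iff)
  show ?thesis
  proof (intro isotropic.intro[OF M] isotropic_axioms.intro)
    show "(\<lambda>\<omega>. vec_index (X \<omega>) i) \<in> borel_measurable M" if "i < n" for i
      using X that by (simp add: measurable_borel_vec_iff)
    show "has_bochner_integral M (\<lambda>\<omega>. vec_index (X \<omega>) i * vec_index (X \<omega>) j) (of_bool (i = j))"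
      if ij: "i < n" "j < n" for i j
    proof -
      have "has_bochner_integral M (\<lambda>\<omega>. tensor_sq (X \<omega>) $$ (i, j)) (1\<^sub>m n $$ (i, j))"
        using cov ij by (simp add: has_mean_mat_def)
      moreover have "tensor_sq (X \<omega>) $$ (i, j) = vec_index (X \<omega>) i * vec_index (X \<omega>) j"
        if "\<omega> \<in> space M" for \<omega>
        using carrier[OF that] ij by (simp add: tensor_sq_def)
      ultimately show ?thesis
        using ij by (subst has_bochner_integral_cong[OF refl, of _ _ "\<lambda>\<omega>. tensor_sq (X \<omega>) $$ (i, j)" _ "1\<^sub>m n $$ (i, j)"]) auto
    qed
    show "measure M {\<omega> \<in> space M. t \<le> (\<Sum>i<r. (ip n (e i) (vec_index (X \<omega>)))\<^sup>2) - real r} \<le> g r * real r / t\<^sup>2"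
      if e: "orthonormal n n e" and r: "1 \<le> r" "r \<le> n" and t: "f r * real r \<le> t" "0 < t" for e r t
    proof -
      let ?P = "proj_mat n {..<r} e"
      have rank: "mat_rank n ?P = r" by (rule rank_proj_mat[OF e r(2)])
      have er: "orthonormal n r e" by (rule orthonormal_mono[OF e r(2)])
      have "?P \<noteq> 0\<^sub>m n n"
      proof
        assume "?P = 0\<^sub>m n n"
        then have "mat_rank n ?P = 0" using vec_space.rank_0I[of n n] by metis
        then show False using rank r by simp
      qed
      from tail[OF orthogonal_projection_proj_mat[OF er] this, unfolded rank, OF t(1)] t(2)
      have "measure M {\<omega> \<in> space M. t \<le> (euclid_norm (?P *\<^sub>v X \<omega>))\<^sup>2 - real r} \<le> g r * real r / t\<^sup>2" by simp
      moreover have "{\<omega> \<in> space M. t \<le> (euclid_norm (?P *\<^sub>v X \<omega>))\<^sup>2 - real r}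
        = {\<omega> \<in> space M. t \<le> (\<Sum>i<r. (ip n (e i) (vec_index (X \<omega>)))\<^sup>2) - real r}"
        using euclid_norm_proj_mat[OF er carrier] by auto
      ultimately show ?thesis by simp
    qed
  qed (use f g in auto)
qed

section \<open>From the barrier value to the expected largest eigenvalue\<close>

text \<open>\<open>Max\<close> is an eigenvalue only for a finite nonempty spectrum: finiteness
  comes from the roots of the characteristic polynomial, nonemptiness from the spectral
  theorem.\<close>

lemma lambda_max_le_barrier_value:
  assumes n: "n \<ge> 1" and A: "symf n A" and C: "C \<ge> 0"
  shows "ennreal (lambda_max (Matrix.mat n n (\<lambda>(i, j). A i j))) \<le> barrier_value n C phi A"
proof -
  let ?A = "Matrix.mat n n (\<lambda>(i, j). A i j)"
  have mv: "vec_index (?A *\<^sub>v v) i = mv n A (vec_index v) i" if "v \<in> carrier_vec n" "i < n" for v i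
    using that by (simp add: mv_def scalar_prod_def atLeast0LessThan)
  have carrier: "?A \<in> carrier_mat n n" by simp
  have "{l. eigenvalue ?A l} = {l. poly (char_poly ?A) l = 0}"
    using eigenvalue_root_char_poly[OF carrier] by simp
  moreover have "char_poly ?A \<noteq> 0"
    using degree_monic_char_poly[OF carrier] n by auto
  ultimately have fin: "finite {l. eigenvalue ?A l}"
    using poly_roots_finite[of "char_poly ?A"] by simp
  obtain e lam where "eigensystem n A e lam" by (rule eigensystem_exists[OF A])
  then interpret eigensystem n A e lam .
  have "eigenvector ?A (Matrix.vec n (e 0)) (lam 0)"
    unfolding eigenvector_def
  proof (intro conjI)
    show "Matrix.vec n (e 0) \<noteq> 0\<^sub>v (dim_row ?A)"
    proof
      assume "Matrix.vec n (e 0) = 0\<^sub>v (dim_row ?A)"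
      then have "vec_index (Matrix.vec n (e 0)) i = vec_index (0\<^sub>v n) i" for i by simp
      then have "e 0 i = 0" if "i < n" for i using that by (metis index_vec index_zero_vec(1))
      then have "ip n (e 0) (e 0) = 0" by (simp add: ip_def)
      then show False using orthonormal n by (simp add: orthonormal_def)
    qed
    show "?A *\<^sub>v Matrix.vec n (e 0) = lam 0 \<cdot>\<^sub>v Matrix.vec n (e 0)"
    proof (rule eq_vecI)
      fix i assume "i < dim_vec (lam 0 \<cdot>\<^sub>v Matrix.vec n (e 0))"
      then have i: "i < n" by simp
      have "vec_index (?A *\<^sub>v Matrix.vec n (e 0)) i = mv n A (e 0) i"
        using i by (subst mv) (auto simp: mv_def)
      also have "\<dots> = lam 0 * e 0 i" using eigenvector[of 0 i] n i by simp
      finally show "vec_index (?A *\<^sub>v Matrix.vec n (e 0)) i = vec_index (lam 0 \<cdot>\<^sub>v Matrix.vec n (e 0)) i"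
        using i by simp
    qed simp
  qed simp
  then have "{l. eigenvalue ?A l} \<noteq> {}" unfolding eigenvalue_def by blast
  from Max_in[OF fin this] have "eigenvalue ?A (lambda_max ?A)" by (simp add: lambda_max_def)
  then obtain v where v: "v \<in> carrier_vec n" "v \<noteq> 0\<^sub>v n" "?A *\<^sub>v v = lambda_max ?A \<cdot>\<^sub>v v"
    unfolding eigenvalue_def eigenvector_def by auto
  show ?thesis
  proof (rule eigenvalue_le_barrier_value[OF A C, of "vec_index v"])
    fix i assume i: "i < n"
    have "mv n A (vec_index v) i = vec_index (lambda_max ?A \<cdot>\<^sub>v v) i"
      using mv[OF v(1) i] v(3) by simp
    then show "mv n A (vec_index v) i = lambda_max ?A * vec_index v i" using v(1) i by simp
  next
    show "\<exists>i<n. vec_index v i \<noteq> 0"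
    proof (rule ccontr)
      assume "\<not> ?thesis"
      then have "v = 0\<^sub>v n" using v(1) by (intro eq_vecI) auto
      then show False using v(2) by simp
    qed
  qed
qed

text \<open>By independence the joint law of the copies is a power of the law of \<open>X\<close>,
  which carries the product estimate over to \<open>N\<close>.\<close>

lemma nn_integral_barrier_value_iid:
  fixes N :: "'b measure" and Y :: "nat \<Rightarrow> 'b \<Rightarrow> real Matrix.vec" and M :: "'a measure"
  assumes N: "prob_space N" and M: "prob_space M" and X: "X \<in> measurable M (borel_vec n)"
    and Y: "iid_copies N m Y n M X" and m: "m \<ge> 1"
    and step: "\<And>A. symf n A \<Longrightarrow>
      (\<integral>\<^sup>+\<omega>. barrier_value n C phi (add_sq A (vec_index (X \<omega>))) \<partial>M) \<le> barrier_value n C phi A + k"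
  shows "(\<integral>\<^sup>+\<omega>. barrier_value n C phi (\<lambda>i l. \<Sum>j=1..m. vec_index (Y j \<omega>) i * vec_index (Y j \<omega>) l) \<partial>N)
    \<le> barrier_value n C phi (\<lambda>i l. 0) + of_nat m * k"
    and "\<And>j. j \<in> {1..m} \<Longrightarrow> Y j \<in> measurable N (borel_vec n)"
proof -
  interpret N: prob_space N by fact
  define nu where "nu = distr M (borel_vec n) X"
  have nu: "prob_space nu" unfolding nu_def by (rule prob_space.prob_space_distr[OF M X])
  have ind: "N.indep_vars (\<lambda>_. borel_vec n) Y {1..m}" and law: "\<And>j. j \<in> {1..m} \<Longrightarrow> distr N (borel_vec n) (Y j) = nu"
    using Y by (auto simp: iid_copies_def nu_def)
  show Ym: "Y j \<in> measurable N (borel_vec n)" if "j \<in> {1..m}" for j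
    using ind that by (simp add: N.indep_vars_def)
  have coord: "(\<lambda>y. vec_index y i) \<in> borel_measurable (borel_vec n)" if "i < n" for i
    using measurable_ident[of "borel_vec n"] that unfolding measurable_borel_vec_iff by auto
  have coord': "(\<lambda>y. vec_index y i) \<in> borel_measurable nu" if "i < n" for i
    using coord[OF that] by (simp add: nu_def)
  have *: "(\<integral>\<^sup>+z. barrier_value n C phi (\<lambda>i l. \<Sum>j\<in>{1..m}. vec_index (z j) i * vec_index (z j) l) \<partial>(Pi\<^sub>M {1..m} (\<lambda>_. nu)))
    \<le> barrier_value n C phi (\<lambda>i l. 0) + of_nat (card {1..m}) * k"
  proof (rule barrier_value_product[OF nu coord'])
    fix A assume A: "symf n A"
    have "(\<lambda>y. barrier_value n C phi (add_sq A (vec_index y))) \<in> borel_measurable (borel_vec n)"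
      unfolding add_sq_def using coord
      by (intro measurable_barrier_value borel_measurable_add borel_measurable_const borel_measurable_times)
    then have "(\<integral>\<^sup>+y. barrier_value n C phi (add_sq A (vec_index y)) \<partial>nu)
        = (\<integral>\<^sup>+\<omega>. barrier_value n C phi (add_sq A (vec_index (X \<omega>))) \<partial>M)"
      unfolding nu_def by (intro nn_integral_distr[OF X]) simp
    also have "\<dots> \<le> barrier_value n C phi A + k" by (rule step[OF A])
    finally show "(\<integral>\<^sup>+y. barrier_value n C phi (add_sq A (vec_index y)) \<partial>nu) \<le> barrier_value n C phi A + k" .
  qed auto
  have "distr N (\<Pi>\<^sub>M j\<in>{1..m}. borel_vec n) (\<lambda>\<omega>. \<lambda>j\<in>{1..m}. Y j \<omega>) = (\<Pi>\<^sub>M j\<in>{1..m}. distr N (borel_vec n) (Y j))"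
    using ind Ym m by (subst (asm) N.indep_vars_iff_distr_eq_PiM') auto
  also have "\<dots> = Pi\<^sub>M {1..m} (\<lambda>_. nu)" by (intro PiM_cong refl law)
  finally have dist: "Pi\<^sub>M {1..m} (\<lambda>_. nu) = distr N (\<Pi>\<^sub>M j\<in>{1..m}. borel_vec n) (\<lambda>\<omega>. \<lambda>j\<in>{1..m}. Y j \<omega>)" ..
  have comp: "(\<lambda>z. vec_index (z j) i) \<in> borel_measurable (\<Pi>\<^sub>M j\<in>{1..m}. borel_vec n)"
    if "i < n" "j \<in> {1..m}" for i j
    by (rule measurable_compose[OF measurable_component_singleton[OF that(2)] coord[OF that(1)]])
  have Fm: "(\<lambda>z. barrier_value n C phi (\<lambda>i l. \<Sum>j\<in>{1..m}. vec_index (z j) i * vec_index (z j) l))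
      \<in> borel_measurable (\<Pi>\<^sub>M j\<in>{1..m}. borel_vec n)"
    by (intro measurable_barrier_value borel_measurable_sum borel_measurable_times comp)
  have Rm: "(\<lambda>\<omega>. \<lambda>j\<in>{1..m}. Y j \<omega>) \<in> measurable N (\<Pi>\<^sub>M j\<in>{1..m}. borel_vec n)"
    by (rule measurable_restrict[OF Ym])
  show "(\<integral>\<^sup>+\<omega>. barrier_value n C phi (\<lambda>i l. \<Sum>j=1..m. vec_index (Y j \<omega>) i * vec_index (Y j \<omega>) l) \<partial>N)
    \<le> barrier_value n C phi (\<lambda>i l. 0) + of_nat m * k"
    using * unfolding dist by (subst (asm) nn_integral_distr[OF Rm]) (use Fm in simp_all)
qed

text \<open>No integrability is assumed: the Bochner integral of a nonintegrable function is 0.\<close>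
lemma integral_le_of_nn_integral_le:
  assumes "(\<integral>\<^sup>+\<omega>. ennreal (h \<omega>) \<partial>N) \<le> ennreal B" "B \<ge> 0"
  shows "(LINT \<omega>|N. h \<omega>) \<le> B"
proof (cases "integrable N h")
  case True
  have "(LINT \<omega>|N. h \<omega>) \<le> (LINT \<omega>|N. max 0 (h \<omega>))"
    using True by (intro integral_mono integrable_max) auto
  also have "\<dots> = enn2real (\<integral>\<^sup>+\<omega>. ennreal (max 0 (h \<omega>)) \<partial>N)"
    using True by (intro integral_eq_nn_integral) auto
  also have "\<dots> \<le> B" using assms by (intro enn2real_leI) (auto simp: max.commute)
  finally show ?thesis .
qed (use assms(2) in \<open>simp add: not_integrable_integral_eq\<close>)

text \<open>With \<open>w = 1 - phi = sqrt m / S\<close> one has \<open>n = (phi * S)^2\<close> and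
  \<open>m = (w * S)^2\<close>, so the main terms \<open>n / phi\<close> and \<open>m / w\<close>
  contribute \<open>phi + w = 1\<close> after division by \<open>S^2\<close>. The rest is of order
  \<open>eps\<close>; the summand 1 is absorbed by \<open>1 \<le> eps * n\<close>.\<close>

lemma edge_bound:
  fixes n m eps c0 phi :: real
  defines "S \<equiv> sqrt m + sqrt n"
  assumes n: "n > 0" and m: "m > 0" and phi: "phi = sqrt n / S" and eps: "0 < eps" "eps \<le> 1" "eps \<le> c0"
    and c0: "0 < c0" "2 * c0 \<le> 1 - phi" and large: "1 \<le> eps * n"
  shows "(n / phi + 1 + eps * n * phi + m * ((1 + eps) / (1 - phi - eps) + eps)) / S\<^sup>2
    \<le> 1 + eps * (5 + 1 / c0)"
proof -
  define w where "w = 1 - phi"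
  have S: "S > 0" using n m by (simp add: S_def add_pos_pos)
  have phi01: "phi > 0" "phi \<le> 1" using n m S by (auto simp: phi S_def)
  have w: "w = sqrt m / S" using S by (simp add: w_def phi S_def field_simps)
  have nS: "n = (phi * S)\<^sup>2" using n S by (simp add: phi)
  have mS: "m = (w * S)\<^sup>2" using m S by (simp add: w)
  have w1: "w \<le> 1" "2 * c0 \<le> w" using phi01 c0 by (auto simp: w_def)
  have we: "w - eps \<ge> c0" using w1 eps by simp
  have 1: "n / phi / S\<^sup>2 = phi"
    using phi01 S by (subst nS) (simp add: power2_eq_square)
  have n_le: "n / S\<^sup>2 \<le> 1"
    using phi01 S power_le_one[of phi 2] by (subst nS) (simp add: power_mult_distrib)
  have 2: "1 / S\<^sup>2 \<le> eps"
  proof -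
    have "1 / S\<^sup>2 \<le> eps * n / S\<^sup>2" using large by (rule divide_right_mono) simp
    also have "\<dots> \<le> eps" using mult_left_mono[OF n_le, of eps] eps by simp
    finally show ?thesis .
  qed
  have 3: "eps * n * phi / S\<^sup>2 \<le> eps"
  proof -
    have "eps * n * phi / S\<^sup>2 = eps * phi * (n / S\<^sup>2)" by simp
    also have "\<dots> \<le> eps * 1 * 1" using n_le eps phi01 n by (intro mult_mono) auto
    finally show ?thesis by simp
  qed
  have 4: "m * ((1 + eps) / (1 - phi - eps) + eps) / S\<^sup>2 \<le> w + eps / c0 + 3 * eps"
  proof -
    have "m / S\<^sup>2 = w\<^sup>2" using S by (subst mS) (simp add: power_mult_distrib)
    then have "m * ((1 + eps) / (1 - phi - eps) + eps) / S\<^sup>2 = w\<^sup>2 * ((1 + eps) / (w - eps) + eps)"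
      by (metis times_divide_eq_left w_def)
    also have "\<dots> = w * (w / (w - eps)) * (1 + eps) + eps * w\<^sup>2"
      by (simp add: power2_eq_square algebra_simps)
    also have "\<dots> \<le> (w + eps / c0) * (1 + eps) + eps * 1"
    proof (intro add_mono mult_right_mono mult_left_mono)
      have "w * (w / (w - eps)) = w + w * eps / (w - eps)"
        using we c0 by (simp add: field_simps)
      also have "w * eps / (w - eps) \<le> 1 * eps / c0"
        using we w1 c0 eps by (intro frac_le mult_right_mono) auto
      finally show "w * (w / (w - eps)) \<le> w + eps / c0" by simp
      show "w\<^sup>2 \<le> 1" using w1 c0 by (intro power_le_one) auto
    qed (use eps in auto)
    also have "\<dots> = w + eps / c0 + eps * w + eps * (eps / c0) + eps"
    proof -
      have "(w + t) * (1 + eps) + eps * 1 = w + t + eps * w + eps * t + eps" for t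
        by (simp add: algebra_simps)
      then show ?thesis .
    qed
    also have "\<dots> \<le> w + eps / c0 + eps * 1 + eps * 1 + eps"
      using w1 eps c0 by (intro add_mono mult_left_mono order_refl) auto
    finally show ?thesis by simp
  qed
  have "(n / phi + 1 + eps * n * phi + m * ((1 + eps) / (1 - phi - eps) + eps)) / S\<^sup>2
    = n / phi / S\<^sup>2 + 1 / S\<^sup>2 + eps * n * phi / S\<^sup>2 + m * ((1 + eps) / (1 - phi - eps) + eps) / S\<^sup>2"
    by (simp add: add_divide_distrib)
  also have "\<dots> \<le> phi + eps + eps + (w + eps / c0 + 3 * eps)"
    using 1 2 3 4 by linarith
  also have "\<dots> = 1 + eps * (5 + 1 / c0)" by (simp add: w_def algebra_simps)
  finally show ?thesis .
qed

theorem theorem1p7: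
  fixes M :: "nat \<Rightarrow> 'a measure"
    and X :: "nat \<Rightarrow> 'a \<Rightarrow> real Matrix.vec"
    and N :: "nat \<Rightarrow> 'b measure"
    and Y :: "nat \<Rightarrow> nat \<Rightarrow> 'b \<Rightarrow> real Matrix.vec"
    and m :: "nat \<Rightarrow> nat"
    and f g :: "nat \<Rightarrow> real"
    and A :: "nat \<Rightarrow> 'b \<Rightarrow> real Matrix.mat"
  assumes M: "\<And>n. n \<ge> 1 \<Longrightarrow> prob_space (M n)"
    and X: "\<And>n. n \<ge> 1 \<Longrightarrow> X n \<in> measurable (M n) (borel_vec n)"
    and X_mean: "\<And>n. n \<ge> 1 \<Longrightarrow> has_mean (M n) n (X n) (0\<^sub>v n)"
    and X_cov: "\<And>n. n \<ge> 1 \<Longrightarrow> has_mean_mat (M n) n (\<lambda>\<omega>. tensor_sq (X n \<omega>)) (1\<^sub>m n)"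
    and m_pos: "\<And>n. n \<ge> 1 \<Longrightarrow> m n \<ge> 1"
    and ratio_liminf: "0 < liminf (\<lambda>n. ereal (real n / real (m n)))"
    and ratio_limsup: "limsup (\<lambda>n. ereal (real n / real (m n))) < \<infinity>"
    and N: "\<And>n. n \<ge> 1 \<Longrightarrow> prob_space (N n)"
    and Y: "\<And>n. n \<ge> 1 \<Longrightarrow> iid_copies (N n) (m n) (Y n) n (M n) (X n)"
    and A: "\<And>n \<omega>. n \<ge> 1 \<Longrightarrow> A n \<omega> = cov_sum n (m n) (\<lambda>k. Y n k \<omega>)"
    and f_range: "\<And>r. r \<ge> 1 \<Longrightarrow> f r \<in> {0..1}"
    and g_range: "\<And>r. r \<ge> 1 \<Longrightarrow> g r \<ge> 0"
    and f_lim: "f \<longlonglongrightarrow> 0"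
    and g_lim: "g \<longlonglongrightarrow> 0"
    and tail: "\<And>n P t. n \<ge> 1 \<Longrightarrow> orthogonal_projection n P \<Longrightarrow> P \<noteq> 0\<^sub>m n n \<Longrightarrow>
        t \<ge> f (mat_rank n P) * real (mat_rank n P) \<Longrightarrow> t \<noteq> 0 \<Longrightarrow>
        measure (M n) {\<omega> \<in> space (M n).
            (euclid_norm (P *\<^sub>v X n \<omega>))\<^sup>2 - real (mat_rank n P) \<ge> t}
          \<le> g (mat_rank n P) * real (mat_rank n P) / t\<^sup>2"
  shows "limsup (\<lambda>n. ereal ((LINT \<omega>|N n. lambda_max (A n \<omega>)) / (sqrt (real (m n)) + sqrt (real n))\<^sup>2)) \<le> 1"
proof -
  obtain b where b: "limsup (\<lambda>n. ereal (real n / real (m n))) < ereal b"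
    using ratio_limsup by (metis ereal_dense2 ereal_less(5))
  define beta where "beta = max b 0"
  have ev_ratio: "eventually (\<lambda>n. real n / real (m n) < beta) sequentially"
    using Limsup_lessD[OF b] by eventually_elim (simp add: beta_def)
  have beta: "beta \<ge> 0" by (simp add: beta_def)
  \<comment> \<open>Half of the lower bound \<open>1 / (1 + sqrt beta)\<close> for
    \<open>1 - phi\<close>, so that \<open>1 - phi - eps \<ge> c0\<close> still holds for
    \<open>eps \<le> c0\<close>.\<close>
  define c0 where "c0 = 1 / (2 * (1 + sqrt beta))"
  have "2 * (1 / (2 * y)) = 1 / y" for y :: real by simp
  then have two_c0: "2 * c0 = 1 / (1 + sqrt beta)" unfolding c0_def .
  have c0: "c0 > 0" using beta by (simp add: c0_def add_pos_nonneg)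
  show ?thesis
  proof (rule ereal_le_epsilon2)
    fix d :: real assume d: "d > 0"
    define eps where "eps = min (min c0 1) (d / (5 + 1 / c0))"
    have den: "5 + 1 / c0 > 0" using c0 by (simp add: add_pos_pos)
    have eps: "0 < eps" "eps \<le> 1" "eps \<le> c0" using c0 d den by (auto simp: eps_def)
    have "eps \<le> d / (5 + 1 / c0)" by (simp add: eps_def)
    then have eps_d: "eps * (5 + 1 / c0) \<le> d" using den by (simp add: pos_le_divide_eq)
    have "eventually (\<lambda>n. real n \<ge> 1 / eps) sequentially"
      by (rule eventually_compose_filterlim[OF eventually_ge_at_top filterlim_real_sequentially])
    with ev_ratio eventually_ge_at_top[of 1] barrier_value_step_eventually[OF f_lim g_lim eps(1,2) c0, where ?'a = 'a]
    have "eventually (\<lambda>n. ereal ((LINT \<omega>|N n. lambda_max (A n \<omega>)) / (sqrt (real (m n)) + sqrt (real n))\<^sup>2)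
        \<le> 1 + ereal d) sequentially"
    proof eventually_elim
      case (elim n)
      have n: "n \<ge> 1" using elim by simp
      have n0: "real n > 0" "real (m n) > 0" using n m_pos[OF n] by auto
      define S where "S = sqrt (real (m n)) + sqrt (real n)"
      define phi where "phi = sqrt (real n) / S"
      define C where "C = eps * real n"
      define k where "k = (1 + eps) / (1 - phi - eps) + eps"
      have S: "S > 0" using n0 by (simp add: S_def add_pos_pos)
      have phi0: "phi > 0" using n0 S by (simp add: phi_def)
      have C: "C \<ge> 0" using eps by (simp add: C_def)
      have phi_c0: "2 * c0 \<le> 1 - phi"
      proof -
        have "sqrt (real n) \<le> sqrt (beta * real (m n))"
          using elim(1) n0 by (intro real_sqrt_le_mono) (simp add: pos_divide_less_eq)
        then have "S \<le> sqrt (real (m n)) * (1 + sqrt beta)"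
          by (simp add: S_def real_sqrt_mult algebra_simps)
        moreover have "1 + sqrt beta > 0" using beta by (simp add: add_pos_nonneg)
        ultimately have "1 / (1 + sqrt beta) \<le> sqrt (real (m n)) / S"
          using S by (simp add: divide_le_eq pos_le_divide_eq mult.commute)
        also have "sqrt (real (m n)) / S = 1 - phi"
          using S by (simp add: phi_def S_def field_simps)
        finally show ?thesis by (simp only: two_c0)
      qed
      have phi_eps: "c0 \<le> 1 - phi - eps" using phi_c0 eps by simp
      have k: "k \<ge> 0" using phi_eps c0 eps by (simp add: k_def)
      have iso: "isotropic (M n) n (\<lambda>\<omega>. vec_index (X n \<omega>)) f g"
        by (rule isotropic_of_tail[OF M[OF n] X[OF n] X_cov[OF n] f_range g_range tail[OF n]])
      have step: "(\<integral>\<^sup>+\<omega>. barrier_value n C phi (add_sq B (vec_index (X n \<omega>))) \<partial>M n)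
          \<le> barrier_value n C phi B + ennreal k" if "symf n B" for B
        using elim(3)[rule_format, OF iso that less_imp_le[OF phi0] phi_eps] by (simp add: C_def k_def)
      note iid = nn_integral_barrier_value_iid[OF N[OF n] M[OF n] X[OF n] Y[OF n] m_pos[OF n] step]
      let ?B = "\<lambda>\<omega> i l. \<Sum>j=1..m n. vec_index (Y n j \<omega>) i * vec_index (Y n j \<omega>) l"
      \<comment> \<open>Here \<open>ennreal\<close> cuts off negative values, which does no harm to
        an upper bound, and monotonicity of this integral holds for arbitrary functions, so
        measurability of \<open>lambda_max\<close> never enters.\<close>
      have "(\<integral>\<^sup>+\<omega>. ennreal (lambda_max (A n \<omega>)) \<partial>N n) \<le> (\<integral>\<^sup>+\<omega>. barrier_value n C phi (?B \<omega>) \<partial>N n)"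
      proof (rule nn_integral_mono)
        fix \<omega> assume \<omega>: "\<omega> \<in> space (N n)"
        have Yc: "Y n j \<omega> \<in> carrier_vec n" if "j \<in> {1..m n}" for j
          using iid(2)[OF _ that] \<omega> by (simp add: measurable_borel_vec_iff)
        have "tensor_sq (Y n j \<omega>) $$ (i, l) = vec_index (Y n j \<omega>) i * vec_index (Y n j \<omega>) l"
          if "j \<in> {1..m n}" "i < n" "l < n" for j i l
        proof -
          have "dim_vec (Y n j \<omega>) = n" by (rule carrier_vecD[OF Yc[OF that(1)]])
          then show ?thesis unfolding tensor_sq_def using that(2,3) by simp
        qed
        then have "A n \<omega> = Matrix.mat n n (\<lambda>(i, j). ?B \<omega> i j)"
          unfolding A[OF n] cov_sum_def by (intro cong_mat refl) (auto intro!: sum.cong)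
        moreover have "symf n (?B \<omega>)" by (simp add: symf_def mult.commute)
        ultimately show "ennreal (lambda_max (A n \<omega>)) \<le> barrier_value n C phi (?B \<omega>)"
          using lambda_max_le_barrier_value[OF n _ C] by simp
      qed
      also have "\<dots> \<le> barrier_value n C phi (\<lambda>i l. 0) + of_nat (m n) * ennreal k"
        by (rule iid(1))
      also have "\<dots> \<le> ennreal (n / phi + 1 + C * phi) + of_nat (m n) * ennreal k"
        by (intro add_right_mono barrier_value_zero phi0 C)
      also have "\<dots> = ennreal (n / phi + 1 + C * phi + m n * k)"
        using k phi0 C by (simp add: ennreal_of_nat_eq_real_of_nat ennreal_mult[symmetric])
      finally have "(LINT \<omega>|N n. lambda_max (A n \<omega>)) \<le> n / phi + 1 + C * phi + m n * k"
        using k phi0 C by (intro integral_le_of_nn_integral_le) auto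
      then have "(LINT \<omega>|N n. lambda_max (A n \<omega>)) / S\<^sup>2 \<le> (n / phi + 1 + C * phi + m n * k) / S\<^sup>2"
        by (rule divide_right_mono) simp
      also have "\<dots> \<le> 1 + eps * (5 + 1 / c0)"
        unfolding C_def k_def S_def
      proof (rule edge_bound[OF n0 _ eps c0 phi_c0])
        show "1 \<le> eps * real n" using elim(4) eps by (simp add: pos_divide_le_eq mult.commute)
      qed (simp add: phi_def S_def)
      also have "\<dots> \<le> 1 + d" using eps_d by simp
      finally show ?case by (simp add: S_def one_ereal_def)
    qed
    then show "limsup (\<lambda>n. ereal ((LINT \<omega>|N n. lambda_max (A n \<omega>)) / (sqrt (real (m n)) + sqrt (real n))\<^sup>2)) \<le> 1 + ereal d"
      by (rule Limsup_bounded)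
  qed
qed

end
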